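(* Let $G$ be a connected, simply connected nilpotent Lie group equipped with a left-invariant complex structure $\mathcal I$, let $\Gamma\subset G$ be a co-compact discrete subgroup, let $N=\Gamma\backslash G$ be the corresponding complex nilmanifold, and let $n=\dim_{\mathbb C}G$. Then $G$ admits a left-invariant, non-zero, holomorphic section of the canonical bundle $\Lambda^{n,0}(G)$. In particular, the canonical bundle $K(N)$ of $N$ is trivial as a holomorphic line bundle.
   Context: A left-invariant complex structure on a Lie group $G$ is an integrable almost complex structure $\mathcal I$ on $G$ which is invariant under left translations; equivalently it is given by $I\in\operatorname{End}(\mathfrak g)$, $I^2=-\mathrm{Id}$, such that the space $\mathfrak g^{1,0}$ of $(1,0)$-vectors is a complex Lie subalgebra of $\mathfrak g\otimes_{\mathbb R}\mathbb C$. It is not assumed that $G$ is a complex Lie group. The quotient $N=\Gamma\backslash G$ (with $\Gamma$ acting on the left) inherits a complex structure from $\mathcal I$, and $N$ with this structure is called a complex nilmanifold. The canonical bundle of a complex manifold of complex dimension $n$ is the holomorphic line bundle $\Lambda^{n,0}$. *)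

theory Defs
  imports "HOL-Analysis.Analysis" "HOL-Algebra.Generated_Groups"
    "HOL-Library.Function_Algebras"
begin

section \<open>Smooth manifolds\<close>

text \<open>For an open set \<open>S\<close> of a Euclidean space, \<open>ck_on k f S\<close> says that \<open>f\<close> is of class
  \<open>C\<^sup>k\<close> on \<open>S\<close>.\<close>

primrec ck_on :: "nat \<Rightarrow> ('e::euclidean_space \<Rightarrow> 'f::real_normed_vector) \<Rightarrow> 'e set \<Rightarrow> bool" where
  "ck_on 0 f S \<longleftrightarrow> continuous_on S f"
| "ck_on (Suc k) f S \<longleftrightarrow> (\<forall>x\<in>S. f differentiable (at x)) \<and>
     (\<forall>u. ck_on k (\<lambda>x. frechet_derivative f (at x) u) S)"

definition smooth_on :: "('e::euclidean_space \<Rightarrow> 'f::real_normed_vector) \<Rightarrow> 'e set \<Rightarrow> bool" where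
  "smooth_on f S \<longleftrightarrow> (\<forall>k. ck_on k f S)"

text \<open>A chart is a pair of its domain and its coordinate map; the values of the coordinate map
  outside the domain are irrelevant.\<close>

type_synonym ('a, 'e) chart = "'a set \<times> ('a \<Rightarrow> 'e)"

abbreviation cdom :: "('a, 'e) chart \<Rightarrow> 'a set" where "cdom \<equiv> fst"

abbreviation cmap :: "('a, 'e) chart \<Rightarrow> 'a \<Rightarrow> 'e" where "cmap \<equiv> snd"

definition cinv :: "('a, 'e) chart \<Rightarrow> 'e \<Rightarrow> 'a" where
  "cinv c = inv_into (cdom c) (cmap c)"

definition smooth_atlas :: "'a topology \<Rightarrow> ('a, 'e::euclidean_space) chart set \<Rightarrow> bool" where
  "smooth_atlas X A \<longleftrightarrow>
     (\<forall>c\<in>A. openin X (cdom c) \<and> open (cmap c ` cdom c) \<and>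
        homeomorphic_map (subtopology X (cdom c)) (top_of_set (cmap c ` cdom c)) (cmap c)) \<and>
     (\<Union>c\<in>A. cdom c) = topspace X \<and>
     (\<forall>c\<in>A. \<forall>d\<in>A. smooth_on (cmap d \<circ> cinv c) (cmap c ` (cdom c \<inter> cdom d)))"

definition smooth_manifold :: "'a topology \<Rightarrow> ('a, 'e::euclidean_space) chart set \<Rightarrow> bool" where
  "smooth_manifold X A \<longleftrightarrow> Hausdorff_space X \<and> second_countable X \<and> smooth_atlas X A"

definition smooth_map :: "'a topology \<Rightarrow> ('a, 'e::euclidean_space) chart set \<Rightarrow>
    'b topology \<Rightarrow> ('b, 'f::euclidean_space) chart set \<Rightarrow> ('a \<Rightarrow> 'b) \<Rightarrow> bool" where
  "smooth_map X A Y B f \<longleftrightarrow> continuous_map X Y f \<and>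
     (\<forall>c\<in>A. \<forall>d\<in>B. smooth_on (cmap d \<circ> f \<circ> cinv c) (cmap c ` {p \<in> cdom c. f p \<in> cdom d}))"

definition prod_atlas :: "('a, 'e) chart set \<Rightarrow> ('b, 'f) chart set \<Rightarrow> ('a \<times> 'b, 'e \<times> 'f) chart set"
  where "prod_atlas A B = {(cdom c \<times> cdom d, map_prod (cmap c) (cmap d)) |c d. c \<in> A \<and> d \<in> B}"


section \<open>Tangent vectors\<close>

text \<open>A tangent vector at \<open>p\<close> is the family of its coordinate representatives in all charts at \<open>p\<close>,
  extended by \<open>0\<close> to the other charts; any two representatives are related by the derivative of
  the change of coordinates.  Addition and negation of tangent vectors are pointwise.\<close>

type_synonym ('a, 'e) tvec = "('a, 'e) chart \<Rightarrow> 'e"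

definition charts_at :: "('a, 'e) chart set \<Rightarrow> 'a \<Rightarrow> ('a, 'e) chart set" where
  "charts_at A p = {c \<in> A. p \<in> cdom c}"

text \<open>The tangent vector at \<open>p\<close> with representative \<open>u\<close> in the chart \<open>c\<close>.\<close>

definition tvec :: "('a, 'e::euclidean_space) chart set \<Rightarrow> 'a \<Rightarrow> ('a, 'e) chart \<Rightarrow> 'e \<Rightarrow> ('a, 'e) tvec"
  where "tvec A p c u = (\<lambda>d. if d \<in> charts_at A p
     then frechet_derivative (cmap d \<circ> cinv c) (at (cmap c p)) u else 0)"

definition tangent_space :: "('a, 'e::euclidean_space) chart set \<Rightarrow> 'a \<Rightarrow> ('a, 'e) tvec set" where
  "tangent_space A p = {tvec A p c u |c u. c \<in> charts_at A p}"

text \<open>The differential at \<open>p\<close> of a map \<open>f\<close>; by the chain rule the choice of the chart at \<open>p\<close> does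
  not matter.\<close>

definition differential :: "('a, 'e::euclidean_space) chart set \<Rightarrow> ('b, 'f::euclidean_space) chart set
    \<Rightarrow> ('a \<Rightarrow> 'b) \<Rightarrow> 'a \<Rightarrow> ('a, 'e) tvec \<Rightarrow> ('b, 'f) tvec" where
  "differential A B f p v = (\<lambda>d. if d \<in> charts_at B (f p)
     then (let c = (SOME c. c \<in> charts_at A p)
           in frechet_derivative (cmap d \<circ> f \<circ> cinv c) (at (cmap c p)) (v c))
     else 0)"

text \<open>The Lie bracket of vector fields, in each chart \<open>[X, Y] = DY(X) - DX(Y)\<close>.\<close>

definition vf_bracket :: "('a, 'e::euclidean_space) chart set \<Rightarrow> ('a \<Rightarrow> ('a, 'e) tvec) \<Rightarrow>
    ('a \<Rightarrow> ('a, 'e) tvec) \<Rightarrow> 'a \<Rightarrow> ('a, 'e) tvec" where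
  "vf_bracket A V W p = (\<lambda>c. if c \<in> charts_at A p
     then frechet_derivative (\<lambda>x. W (cinv c x) c) (at (cmap c p)) (V p c)
        - frechet_derivative (\<lambda>x. V (cinv c x) c) (at (cmap c p)) (W p c)
     else 0)"


section \<open>Almost complex structures\<close>

text \<open>The pair \<open>(a, b)\<close> stands for the element \<open>a + ib\<close> of the complexification.  The sets below are
  the \<open>i\<close>- and \<open>-i\<close>-eigenspaces of the complex linear extension of \<open>J\<close>.\<close>

definition type10 :: "('v::uminus \<Rightarrow> 'v) \<Rightarrow> ('v \<times> 'v) set" where
  "type10 J = {(a, b). J a = - b \<and> J b = a}"

definition type01 :: "('v::uminus \<Rightarrow> 'v) \<Rightarrow> ('v \<times> 'v) set" where
  "type01 J = {(a, b). J a = b \<and> J b = - a}"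

text \<open>The representative of the endomorphism field \<open>J\<close> in the chart \<open>c\<close> at the coordinate point
  \<open>x\<close>.\<close>

definition local_J :: "('a, 'e::euclidean_space) chart set \<Rightarrow> ('a \<Rightarrow> ('a, 'e) tvec \<Rightarrow> ('a, 'e) tvec)
    \<Rightarrow> ('a, 'e) chart \<Rightarrow> 'e \<Rightarrow> 'e \<Rightarrow> 'e" where
  "local_J A J c x u = J (cinv c x) (tvec A (cinv c x) c u) c"

definition almost_complex_structure :: "'a topology \<Rightarrow> ('a, 'e::euclidean_space) chart set \<Rightarrow>
    ('a \<Rightarrow> ('a, 'e) tvec \<Rightarrow> ('a, 'e) tvec) \<Rightarrow> bool" where
  "almost_complex_structure X A J \<longleftrightarrow>
     (\<forall>p\<in>topspace X. \<forall>v\<in>tangent_space A p. J p v \<in> tangent_space A p \<and> J p (J p v) = - v) \<and>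
     (\<forall>c\<in>A. (\<forall>x\<in>cmap c ` cdom c. linear (local_J A J c x)) \<and>
        (\<forall>u. smooth_on (\<lambda>x. local_J A J c x u) (cmap c ` cdom c)))"


section \<open>Lie groups and left-invariant complex structures\<close>

definition lie_group :: "('a, 'm) monoid_scheme \<Rightarrow> 'a topology \<Rightarrow>
    ('a, 'e::euclidean_space) chart set \<Rightarrow> bool" where
  "lie_group G X A \<longleftrightarrow> group G \<and> topspace X = carrier G \<and> smooth_manifold X A \<and>
     smooth_map (prod_topology X X) (prod_atlas A A) X A (\<lambda>(g, h). g \<otimes>\<^bsub>G\<^esub> h) \<and>
     smooth_map X A X A (\<lambda>g. inv\<^bsub>G\<^esub> g)"

primrec lower_central :: "('a, 'm) monoid_scheme \<Rightarrow> nat \<Rightarrow> 'a set" where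
  "lower_central G 0 = carrier G"
| "lower_central G (Suc k) = generate G
     {x \<otimes>\<^bsub>G\<^esub> y \<otimes>\<^bsub>G\<^esub> inv\<^bsub>G\<^esub> x \<otimes>\<^bsub>G\<^esub> inv\<^bsub>G\<^esub> y |x y. x \<in> lower_central G k \<and> y \<in> carrier G}"

definition nilpotent_group :: "('a, 'm) monoid_scheme \<Rightarrow> bool" where
  "nilpotent_group G \<longleftrightarrow> group G \<and> (\<exists>k. lower_central G k = {\<one>\<^bsub>G\<^esub>})"

text \<open>The counterpart of \<^const>\<open>simply_connected\<close> for abstract topologies.\<close>

definition simply_connected_space :: "'a topology \<Rightarrow> bool" where
  "simply_connected_space X \<longleftrightarrow> path_connected_space X \<and>
     (\<forall>p. pathin X p \<and> p 0 = p 1 \<longrightarrow>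
        (\<exists>a\<in>topspace X. homotopic_with (\<lambda>r. r 0 = r 1) (top_of_set {0..1}) X p (\<lambda>_. a)))"

definition left_translate :: "('a, 'm) monoid_scheme \<Rightarrow> ('a, 'e::euclidean_space) chart set \<Rightarrow>
    'a \<Rightarrow> 'a \<Rightarrow> ('a, 'e) tvec \<Rightarrow> ('a, 'e) tvec" where
  "left_translate G A g h v = differential A A (\<lambda>k. g \<otimes>\<^bsub>G\<^esub> k) h v"

text \<open>The Lie algebra of \<open>G\<close> is the tangent space at the unit with the bracket of left-invariant
  vector fields; \<open>complex_lie_bracket\<close> is its complex bilinear extension to the complexification.\<close>

definition lie_bracket :: "('a, 'm) monoid_scheme \<Rightarrow> ('a, 'e::euclidean_space) chart set \<Rightarrow>
    ('a, 'e) tvec \<Rightarrow> ('a, 'e) tvec \<Rightarrow> ('a, 'e) tvec" where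
  "lie_bracket G A v w = vf_bracket A (\<lambda>g. left_translate G A g \<one>\<^bsub>G\<^esub> v)
     (\<lambda>g. left_translate G A g \<one>\<^bsub>G\<^esub> w) \<one>\<^bsub>G\<^esub>"

definition complex_lie_bracket :: "('a, 'm) monoid_scheme \<Rightarrow> ('a, 'e::euclidean_space) chart set \<Rightarrow>
    ('a, 'e) tvec \<times> ('a, 'e) tvec \<Rightarrow> ('a, 'e) tvec \<times> ('a, 'e) tvec \<Rightarrow>
    ('a, 'e) tvec \<times> ('a, 'e) tvec" where
  "complex_lie_bracket G A z w =
     (lie_bracket G A (fst z) (fst w) - lie_bracket G A (snd z) (snd w),
      lie_bracket G A (fst z) (snd w) + lie_bracket G A (snd z) (fst w))"

definition lie_algebra10 :: "('a, 'm) monoid_scheme \<Rightarrow> ('a, 'e::euclidean_space) chart set \<Rightarrow>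
    ('a \<Rightarrow> ('a, 'e) tvec \<Rightarrow> ('a, 'e) tvec) \<Rightarrow> (('a, 'e) tvec \<times> ('a, 'e) tvec) set" where
  "lie_algebra10 G A J =
     (tangent_space A \<one>\<^bsub>G\<^esub> \<times> tangent_space A \<one>\<^bsub>G\<^esub>) \<inter> type10 (J \<one>\<^bsub>G\<^esub>)"

text \<open>The last clause is integrability.  Only closure under the bracket is demanded, since
  \<^const>\<open>lie_algebra10\<close> is a complex subspace anyway.\<close>

definition left_invariant_complex_structure :: "('a, 'm) monoid_scheme \<Rightarrow> 'a topology \<Rightarrow>
    ('a, 'e::euclidean_space) chart set \<Rightarrow> ('a \<Rightarrow> ('a, 'e) tvec \<Rightarrow> ('a, 'e) tvec) \<Rightarrow> bool" where
  "left_invariant_complex_structure G X A J \<longleftrightarrow> almost_complex_structure X A J \<and>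
     (\<forall>g\<in>carrier G. \<forall>h\<in>carrier G. \<forall>v\<in>tangent_space A h.
        J (g \<otimes>\<^bsub>G\<^esub> h) (left_translate G A g h v) = left_translate G A g h (J h v)) \<and>
     (\<forall>z\<in>lie_algebra10 G A J. \<forall>w\<in>lie_algebra10 G A J.
        complex_lie_bracket G A z w \<in> lie_algebra10 G A J)"


section \<open>The canonical bundle\<close>

text \<open>Complex-valued alternating forms of degree \<open>m\<close> are functions on lists of length \<open>m\<close>.\<close>

definition alternating_form :: "nat \<Rightarrow> ('e::euclidean_space list \<Rightarrow> complex) \<Rightarrow> bool" where
  "alternating_form m \<omega> \<longleftrightarrow>
     (\<forall>us i. length us = m \<and> i < m \<longrightarrow> linear (\<lambda>u. \<omega> (us[i := u]))) \<and>
     (\<forall>us i j. length us = m \<and> i < j \<and> j < m \<and> us ! i = us ! j \<longrightarrow> \<omega> us = 0)"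

text \<open>The complex multilinear extension of a real multilinear form to the complexification.\<close>

definition complexify :: "('v list \<Rightarrow> complex) \<Rightarrow> ('v \<times> 'v) list \<Rightarrow> complex" where
  "complexify \<omega> zs = (\<Sum>S\<in>Pow {..<length zs}. \<i> ^ card S *
     \<omega> (map (\<lambda>k. if k \<in> S then snd (zs ! k) else fst (zs ! k)) [0..<length zs]))"

definition form_n0 :: "nat \<Rightarrow> ('e::euclidean_space \<Rightarrow> 'e) \<Rightarrow> ('e list \<Rightarrow> complex) \<Rightarrow> bool" where
  "form_n0 n J \<omega> \<longleftrightarrow> alternating_form n \<omega> \<and>
     (\<forall>zs. length zs = n \<and> (\<exists>k<n. zs ! k \<in> type01 J) \<longrightarrow> complexify \<omega> zs = 0)"

definition local_form :: "('a, 'e::euclidean_space) chart set \<Rightarrow>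
    ('a \<Rightarrow> ('a, 'e) tvec list \<Rightarrow> complex) \<Rightarrow> ('a, 'e) chart \<Rightarrow> 'e \<Rightarrow> 'e list \<Rightarrow> complex" where
  "local_form A \<eta> c x us = \<eta> (cinv c x) (map (tvec A (cinv c x) c) us)"

text \<open>The fibre of \<open>\<Lambda>\<^sup>n\<^sup>,\<^sup>0\<close> at \<open>p\<close>.  Its elements vanish outside the lists of \<open>n\<close> tangent vectors at
  \<open>p\<close>, so that a form is determined by its values on such lists.\<close>

definition canonical_fibre :: "nat \<Rightarrow> ('a, 'e::euclidean_space) chart set \<Rightarrow>
    ('a \<Rightarrow> ('a, 'e) tvec \<Rightarrow> ('a, 'e) tvec) \<Rightarrow> 'a \<Rightarrow> (('a, 'e) tvec list \<Rightarrow> complex) set" where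
  "canonical_fibre n A J p = {\<omega>.
     (\<forall>vs. \<not> (length vs = n \<and> set vs \<subseteq> tangent_space A p) \<longrightarrow> \<omega> vs = 0) \<and>
     (\<forall>c\<in>charts_at A p. form_n0 n (local_J A J c (cmap c p)) (\<lambda>us. \<omega> (map (tvec A p c) us)))}"

definition ext_deriv :: "('e::euclidean_space \<Rightarrow> 'e list \<Rightarrow> complex) \<Rightarrow> 'e \<Rightarrow> 'e list \<Rightarrow> complex" where
  "ext_deriv \<omega> x us = (\<Sum>i<length us. (-1) ^ i *
     frechet_derivative (\<lambda>y. \<omega> y (take i us @ drop (Suc i) us)) (at x) (us ! i))"

text \<open>The holomorphic structure of \<open>\<Lambda>\<^sup>n\<^sup>,\<^sup>0\<close> is given by the operator \<open>\<partial>\<close>-bar, which maps an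
  \<open>(n,0)\<close>-form to the \<open>(n,1)\<close>-component of its exterior derivative.  This component vanishes iff
  the complexified exterior derivative vanishes on one vector of type \<open>(0,1)\<close> and \<open>n\<close> vectors
  of type \<open>(1,0)\<close>.\<close>

definition dbar_closed_at :: "nat \<Rightarrow> ('e::euclidean_space \<Rightarrow> 'e) \<Rightarrow>
    ('e \<Rightarrow> 'e list \<Rightarrow> complex) \<Rightarrow> 'e \<Rightarrow> bool" where
  "dbar_closed_at n J \<omega> x \<longleftrightarrow>
     (\<forall>zs k. length zs = Suc n \<and> k < Suc n \<and> zs ! k \<in> type01 J \<and>
        (\<forall>j<Suc n. j \<noteq> k \<longrightarrow> zs ! j \<in> type10 J) \<longrightarrow> complexify (ext_deriv \<omega> x) zs = 0)"

text \<open>Holomorphic sections of \<open>\<Lambda>\<^sup>n\<^sup>,\<^sup>0\<close> over an open set \<open>W\<close>.\<close>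

definition holomorphic_canonical_section :: "nat \<Rightarrow> ('a, 'e::euclidean_space) chart set \<Rightarrow>
    ('a \<Rightarrow> ('a, 'e) tvec \<Rightarrow> ('a, 'e) tvec) \<Rightarrow> 'a set \<Rightarrow>
    ('a \<Rightarrow> ('a, 'e) tvec list \<Rightarrow> complex) \<Rightarrow> bool" where
  "holomorphic_canonical_section n A J W \<eta> \<longleftrightarrow>
     (\<forall>p\<in>W. \<eta> p \<in> canonical_fibre n A J p) \<and>
     (\<forall>c\<in>A. \<forall>us. length us = n \<longrightarrow>
        smooth_on (\<lambda>x. local_form A \<eta> c x us) (cmap c ` (cdom c \<inter> W))) \<and>
     (\<forall>c\<in>A. \<forall>x\<in>cmap c ` (cdom c \<inter> W).
        dbar_closed_at n (local_J A J c x) (local_form A \<eta> c) x)"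

text \<open>Holomorphic functions on an open set \<open>W\<close>: smooth and \<open>df(Jv) = i df(v)\<close>.\<close>

definition holomorphic_function :: "('a, 'e::euclidean_space) chart set \<Rightarrow>
    ('a \<Rightarrow> ('a, 'e) tvec \<Rightarrow> ('a, 'e) tvec) \<Rightarrow> 'a set \<Rightarrow> ('a \<Rightarrow> complex) \<Rightarrow> bool" where
  "holomorphic_function A J W f \<longleftrightarrow>
     (\<forall>c\<in>A. smooth_on (f \<circ> cinv c) (cmap c ` (cdom c \<inter> W)) \<and>
        (\<forall>x\<in>cmap c ` (cdom c \<inter> W). \<forall>u.
           frechet_derivative (f \<circ> cinv c) (at x) (local_J A J c x u) =
           \<i> * frechet_derivative (f \<circ> cinv c) (at x) u))"

text \<open>An isomorphism of holomorphic line bundles from the trivial bundle to \<open>\<Lambda>\<^sup>n\<^sup>,\<^sup>0\<close>: complex linear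
  isomorphisms \<open>\<tau> p\<close> of the fibres under which, over every open set, the holomorphic sections of
  the two bundles correspond to each other.  Smoothness of \<open>\<tau>\<close> is included, because the image of
  the constant section \<open>1\<close> is holomorphic.\<close>

definition trivial_canonical_bundle :: "nat \<Rightarrow> 'a topology \<Rightarrow>
    ('a, 'e::euclidean_space) chart set \<Rightarrow> ('a \<Rightarrow> ('a, 'e) tvec \<Rightarrow> ('a, 'e) tvec) \<Rightarrow> bool" where
  "trivial_canonical_bundle n X A J \<longleftrightarrow>
     (\<exists>\<tau>. (\<forall>p\<in>topspace X. bij_betw (\<tau> p) UNIV (canonical_fibre n A J p) \<and>
             (\<forall>a z w. \<tau> p (a * z + w) = (\<lambda>vs. a * \<tau> p z vs + \<tau> p w vs))) \<and>
          (\<forall>W f. openin X W \<longrightarrow>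
             (holomorphic_function A J W f \<longleftrightarrow>
              holomorphic_canonical_section n A J W (\<lambda>p. \<tau> p (f p)))))"

definition left_invariant_form :: "('a, 'm) monoid_scheme \<Rightarrow> nat \<Rightarrow>
    ('a, 'e::euclidean_space) chart set \<Rightarrow> ('a \<Rightarrow> ('a, 'e) tvec list \<Rightarrow> complex) \<Rightarrow> bool" where
  "left_invariant_form G n A \<eta> \<longleftrightarrow>
     (\<forall>g\<in>carrier G. \<forall>h\<in>carrier G. \<forall>vs. length vs = n \<and> set vs \<subseteq> tangent_space A h \<longrightarrow>
        \<eta> (g \<otimes>\<^bsub>G\<^esub> h) (map (left_translate G A g h) vs) = \<eta> h vs)"


section \<open>The quotient by a discrete subgroup\<close>

text \<open>The orbits of \<open>\<Gamma>\<close> acting on \<open>G\<close> by left multiplication are the sets \<open>\<Gamma>g\<close>, which HOL-Algebra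
  calls right cosets.\<close>

definition quotient_topology :: "('a, 'm) monoid_scheme \<Rightarrow> 'a topology \<Rightarrow> 'a set \<Rightarrow> 'a set topology"
  where "quotient_topology G X \<Gamma> = topology (\<lambda>V. V \<subseteq> rcosets\<^bsub>G\<^esub> \<Gamma> \<and>
     openin X {g \<in> topspace X. \<Gamma> #>\<^bsub>G\<^esub> g \<in> V})"

lemma openin_quotient_topology:
  "openin (quotient_topology G X \<Gamma>) V \<longleftrightarrow>
     V \<subseteq> rcosets\<^bsub>G\<^esub> \<Gamma> \<and> openin X {g \<in> topspace X. \<Gamma> #>\<^bsub>G\<^esub> g \<in> V}"
proof -
  have "istopology (\<lambda>V. V \<subseteq> rcosets\<^bsub>G\<^esub> \<Gamma> \<and> openin X {g \<in> topspace X. \<Gamma> #>\<^bsub>G\<^esub> g \<in> V})"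
    unfolding istopology_def
  proof (intro conjI allI impI; (elim conjE)?)
    fix S T
    assume "openin X {g \<in> topspace X. \<Gamma> #>\<^bsub>G\<^esub> g \<in> S}" "openin X {g \<in> topspace X. \<Gamma> #>\<^bsub>G\<^esub> g \<in> T}"
    then have "openin X ({g \<in> topspace X. \<Gamma> #>\<^bsub>G\<^esub> g \<in> S} \<inter> {g \<in> topspace X. \<Gamma> #>\<^bsub>G\<^esub> g \<in> T})"
      by (rule openin_Int)
    also have "{g \<in> topspace X. \<Gamma> #>\<^bsub>G\<^esub> g \<in> S} \<inter> {g \<in> topspace X. \<Gamma> #>\<^bsub>G\<^esub> g \<in> T} =
        {g \<in> topspace X. \<Gamma> #>\<^bsub>G\<^esub> g \<in> S \<inter> T}"
      by auto
    finally show "openin X {g \<in> topspace X. \<Gamma> #>\<^bsub>G\<^esub> g \<in> S \<inter> T}" .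
  next
    fix K
    assume K: "\<forall>S\<in>K. S \<subseteq> rcosets\<^bsub>G\<^esub> \<Gamma> \<and> openin X {g \<in> topspace X. \<Gamma> #>\<^bsub>G\<^esub> g \<in> S}"
    then show "\<Union> K \<subseteq> rcosets\<^bsub>G\<^esub> \<Gamma>"
      by auto
    have "openin X (\<Union>S\<in>K. {g \<in> topspace X. \<Gamma> #>\<^bsub>G\<^esub> g \<in> S})"
      using K by (intro openin_Union) auto
    also have "(\<Union>S\<in>K. {g \<in> topspace X. \<Gamma> #>\<^bsub>G\<^esub> g \<in> S}) = {g \<in> topspace X. \<Gamma> #>\<^bsub>G\<^esub> g \<in> \<Union> K}"
      by auto
    finally show "openin X {g \<in> topspace X. \<Gamma> #>\<^bsub>G\<^esub> g \<in> \<Union> K}" .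
  qed auto
  then show ?thesis
    unfolding quotient_topology_def by (simp add: topology_inverse')
qed

text \<open>The charts of the quotient are the charts of \<open>G\<close>, restricted to open sets on which the
  projection is injective.\<close>

definition quotient_atlas :: "('a, 'm) monoid_scheme \<Rightarrow> 'a topology \<Rightarrow> ('a, 'e) chart set \<Rightarrow>
    'a set \<Rightarrow> ('a set, 'e) chart set" where
  "quotient_atlas G X A \<Gamma> =
     {((\<lambda>g. \<Gamma> #>\<^bsub>G\<^esub> g) ` U, cmap c \<circ> inv_into U (\<lambda>g. \<Gamma> #>\<^bsub>G\<^esub> g)) |c U.
        c \<in> A \<and> openin X U \<and> U \<subseteq> cdom c \<and> inj_on (\<lambda>g. \<Gamma> #>\<^bsub>G\<^esub> g) U}"

text \<open>The complex structure induced on the quotient: \<open>J\<close> is transported by the differential of the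
  projection at a point \<open>g\<close> of the orbit \<open>P\<close>.  For a discrete \<open>\<Gamma>\<close> this differential is bijective,
  and for a left-invariant \<open>J\<close> the choice of \<open>g\<close> does not matter.\<close>

definition quotient_J :: "('a, 'm) monoid_scheme \<Rightarrow> 'a topology \<Rightarrow>
    ('a, 'e::euclidean_space) chart set \<Rightarrow> 'a set \<Rightarrow> ('a \<Rightarrow> ('a, 'e) tvec \<Rightarrow> ('a, 'e) tvec) \<Rightarrow>
    'a set \<Rightarrow> ('a set, 'e) tvec \<Rightarrow> ('a set, 'e) tvec" where
  "quotient_J G X A \<Gamma> J P w =
     (let g = (SOME g. g \<in> P);
          d\<pi> = differential A (quotient_atlas G X A \<Gamma>) (\<lambda>h. \<Gamma> #>\<^bsub>G\<^esub> h) g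
      in d\<pi> (J g (inv_into (tangent_space A g) d\<pi> w)))"

definition discrete_subgroup :: "('a, 'm) monoid_scheme \<Rightarrow> 'a topology \<Rightarrow> 'a set \<Rightarrow> bool" where
  "discrete_subgroup G X \<Gamma> \<longleftrightarrow> subgroup \<Gamma> G \<and> subtopology X \<Gamma> = discrete_topology \<Gamma>"

definition cocompact :: "('a, 'm) monoid_scheme \<Rightarrow> 'a topology \<Rightarrow> 'a set \<Rightarrow> bool" where
  "cocompact G X \<Gamma> \<longleftrightarrow> compact_space (quotient_topology G X \<Gamma>)"

end

theory Submission
  imports Defs "HOL-Combinatorics.Permutations"
begin

text \<open>Let \<open>\<omega>\<close> be a left-invariant form of type \<open>(n,0)\<close>.  Because the \<open>(0,1)\<close>-vectors form a Lie
  subalgebra \<open>\<gg>\<^sup>0\<^sup>1\<close>, each \<open>Z\<close> in it acts by \<open>ad Z\<close> on the quotient of the complexified Lie algebra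
  by \<open>\<gg>\<^sup>0\<^sup>1\<close>, and the contraction of \<open>d\<omega>\<close> with \<open>Z\<close> is, up to sign, the trace of this action times
  \<open>\<omega>\<close>.  The action is nilpotent because the Lie algebra is, so its trace vanishes and
  \<open>d\<omega> = 0\<close>.  Hence a multiple \<open>f \<omega>\<close> is holomorphic iff \<open>f\<close> is.  All of this only uses a frame
  whose brackets have constant coefficients; the left-invariant frame of \<open>G\<close> descends to the
  quotient by \<open>\<Gamma>\<close>, and so does the argument.  Nilpotency of the Lie algebra comes from
  differentiating the identity that all iterated commutators of a fixed length in \<open>G\<close> are
  trivial.\<close>

section \<open>Smooth functions\<close>

text \<open>For a general group an invariant (n,0)-form need not be closed; the obstruction is the
  trace. The map \<open>(v, w) \<mapsto> v + I w\<close> has exactly the (0,1)-vectors as kernel, so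
  \<open>'e\<close> with the complex structure \<open>I\<close> models the quotient of the
  complexified Lie algebra, and no complex vector space is formed. The vector
  \<open>a + i (I a)\<close> acts on it by \<open>b \<mapsto> br a b + I (br (I a) b)\<close>;
  integrability makes this action well defined and complex linear. Type conditions are likewise
  expressed by complex linearity: the complexification of a form that is complex linear in a slot
  vanishes as soon as that slot holds a (0,1)-vector. The argument on forms is carried out in an
  abstract locale, interpreted once for the group and once for the quotient. A chart of the quotient
  borrows the frame of the group chart behind it; two lifts of an orbit differ by a left
  translation, so the choice of lift is harmless. The exponential map is avoided: the differential
  of Ad at the unit comes from the mixed second derivatives of the multiplication.\<close>

lemma frechet_derivative_eqI:
  "(f has_derivative f') (at x) \<Longrightarrow> frechet_derivative f (at x) = f'"
  using frechet_derivative_at by metis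

lemma frechet_derivative_cong_open:
  assumes "open S" "x \<in> S" "\<And>y. y \<in> S \<Longrightarrow> f y = g y"
  shows "frechet_derivative f (at x) = frechet_derivative g (at x)"
proof -
  have "(f has_derivative D) (at x) \<longleftrightarrow> (g has_derivative D) (at x)" for D
    using assms has_derivative_transform_within_open[of f D x UNIV S g]
      has_derivative_transform_within_open[of g D x UNIV S f] by auto
  then show ?thesis by (simp add: frechet_derivative_def)
qed

lemma differentiable_cong_open:
  assumes "open S" "x \<in> S" "\<And>y. y \<in> S \<Longrightarrow> f y = g y" "f differentiable (at x)"
  shows "g differentiable (at x)"
  using assms has_derivative_transform_within_open[of f _ x UNIV S g]
  unfolding differentiable_def by metis

section \<open>Closure properties of the classes \<open>C\<^sup>k\<close>\<close>

lemma ck_on_subset: "ck_on k f S \<Longrightarrow> T \<subseteq> S \<Longrightarrow> ck_on k f T"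
  by (induction k arbitrary: f) (auto intro: continuous_on_subset)

lemma ck_on_cong:
  assumes "open S" "\<And>x. x \<in> S \<Longrightarrow> f x = g x" "ck_on k f S"
  shows "ck_on k g S"
  using assms(2,3)
proof (induction k arbitrary: f g)
  case 0
  then show ?case by (auto cong: continuous_on_cong)
next
  case (Suc k)
  have "frechet_derivative f (at x) = frechet_derivative g (at x)" if "x \<in> S" for x
    using frechet_derivative_cong_open[OF assms(1) that] Suc.prems by blast
  moreover have "g differentiable at x" if "x \<in> S" for x
    using differentiable_cong_open[OF assms(1) that, of f g] Suc.prems that by auto
  ultimately show ?case
    using Suc.prems Suc.IH[of "\<lambda>x. frechet_derivative f (at x) u" "\<lambda>x. frechet_derivative g (at x) u" for u]
    by auto
qed

text \<open>\<open>ck_on\<close> speaks of the chosen \<open>frechet_derivative\<close>. Derivatives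
  at a point of the open set are unique, so any explicit formula for them may be used
  instead.\<close>

lemma ck_on_SucI:
  assumes "open S" "\<And>x. x \<in> S \<Longrightarrow> (f has_derivative f' x) (at x)" "\<And>u. ck_on k (\<lambda>x. f' x u) S"
  shows "ck_on (Suc k) f S"
proof -
  have "ck_on k (\<lambda>x. frechet_derivative f (at x) u) S" for u
    by (rule ck_on_cong[OF assms(1) _ assms(3)[of u]])
      (simp add: frechet_derivative_eqI[OF assms(2)])
  then show ?thesis using assms(2) by (auto simp: differentiable_def)
qed

lemma ck_on_SucD: "ck_on (Suc k) f S \<Longrightarrow> ck_on k f S"
proof (induction k arbitrary: f)
  case 0
  then show ?case
    by (auto intro!: continuous_at_imp_continuous_on differentiable_imp_continuous_within)
next
  case (Suc k)
  then show ?case by (metis ck_on.simps(2))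
qed

lemma ck_on_has_derivative:
  "ck_on (Suc k) f S \<Longrightarrow> x \<in> S \<Longrightarrow> (f has_derivative frechet_derivative f (at x)) (at x)"
  by (simp add: frechet_derivative_works)

lemma ck_on_const: "open S \<Longrightarrow> ck_on k (\<lambda>x. c) S"
proof (induction k arbitrary: c)
  case (Suc k)
  show ?case by (rule ck_on_SucI[where f' = "\<lambda>x u. 0"]) (use Suc in auto)
qed auto

lemma ck_on_bounded_linear:
  assumes "open S" "bounded_linear h" "ck_on k f S"
  shows "ck_on k (\<lambda>x. h (f x)) S"
  using assms(3)
proof (induction k arbitrary: f)
  case 0
  then show ?case using assms bounded_linear.continuous_on by auto
next
  case (Suc k)
  show ?case
    by (rule ck_on_SucI[OF assms(1)])
      (use Suc in \<open>auto intro!: bounded_linear.has_derivative[OF assms(2)] ck_on_has_derivative[OF Suc.prems]\<close>)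
qed

lemma ck_on_add:
  assumes "open S" "ck_on k f S" "ck_on k g S"
  shows "ck_on k (\<lambda>x. f x + g x) S"
  using assms(2,3)
proof (induction k arbitrary: f g)
  case 0
  then show ?case by (auto intro: continuous_intros)
next
  case (Suc k)
  show ?case
    by (rule ck_on_SucI[OF assms(1)],
        rule has_derivative_add[OF ck_on_has_derivative[OF Suc.prems(1)] ck_on_has_derivative[OF Suc.prems(2)]])
      (use Suc in auto)
qed

lemma ck_on_bilinear:
  assumes "open S" "bounded_bilinear b" "ck_on k f S" "ck_on k g S"
  shows "ck_on k (\<lambda>x. b (f x) (g x)) S"
  using assms(3,4)
proof (induction k arbitrary: f g)
  case 0
  then show ?case using bounded_bilinear.continuous_on[OF assms(2)] by auto
next
  case (Suc k)
  show ?case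
  proof (rule ck_on_SucI[OF assms(1)])
    show "((\<lambda>x. b (f x) (g x)) has_derivative (\<lambda>u. b (f x) (frechet_derivative g (at x) u)
        + b (frechet_derivative f (at x) u) (g x))) (at x)" if "x \<in> S" for x
      by (rule bounded_bilinear.FDERIV[OF assms(2)])
        (use ck_on_has_derivative Suc.prems that in blast)+
    show "ck_on k (\<lambda>x. b (f x) (frechet_derivative g (at x) u)
        + b (frechet_derivative f (at x) u) (g x)) S" for u
      using Suc ck_on_SucD[of k f S] ck_on_SucD[of k g S] by (intro ck_on_add assms) auto
  qed
qed

lemma ck_on_sum:
  assumes "open S" "\<And>i. i \<in> I \<Longrightarrow> ck_on k (f i) S"
  shows "ck_on k (\<lambda>x. \<Sum>i\<in>I. f i x) S"
  using assms(2)
  by (induction I rule: infinite_finite_induct) (auto intro: ck_on_const ck_on_add assms(1))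

lemma ck_on_prod:
  fixes f :: "'i \<Rightarrow> 'e::euclidean_space \<Rightarrow> 'f::real_normed_field"
  assumes "open S" "\<And>i. i \<in> I \<Longrightarrow> ck_on k (f i) S"
  shows "ck_on k (\<lambda>x. \<Prod>i\<in>I. f i x) S"
  using assms(2)
  by (induction I rule: infinite_finite_induct)
    (auto intro: ck_on_const ck_on_bilinear[OF assms(1) bounded_bilinear_mult] assms(1))

lemma ck_on_compose:
  fixes f :: "'e::euclidean_space \<Rightarrow> 'f::euclidean_space"
  assumes "open S" "open T" "f ` S \<subseteq> T" "ck_on k f S" "ck_on k g T"
  shows "ck_on k (\<lambda>x. g (f x)) S"
  using assms(4,5)
proof (induction k arbitrary: g)
  case 0
  then show ?case using continuous_on_compose2 assms(3) by auto
next
  case (Suc k)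
  let ?f' = "\<lambda>x. frechet_derivative f (at x)" and ?g' = "\<lambda>y. frechet_derivative g (at y)"
  show ?case
  proof (rule ck_on_SucI[OF assms(1)])
    fix x assume x: "x \<in> S"
    have g: "(g has_derivative ?g' (f x)) (at (f x))"
      using ck_on_has_derivative[OF Suc.prems(2)] assms(3) x by blast
    have "((\<lambda>x. g (f x)) has_derivative (\<lambda>u. ?g' (f x) (?f' x u))) (at x)"
      using diff_chain_at[OF ck_on_has_derivative[OF Suc.prems(1) x] g] by (simp add: o_def)
    \<comment> \<open>The direction \<open>?f' x u\<close> moves with \<open>x\<close>, whereas the
      induction hypothesis treats derivatives of \<open>g\<close> in a fixed direction. Expanding in
      the basis leaves only fixed directions \<open>i\<close>.\<close>
    also have "(\<lambda>u. ?g' (f x) (?f' x u)) = (\<lambda>u. \<Sum>i\<in>Basis. (?f' x u \<bullet> i) *\<^sub>R ?g' (f x) i)"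
    proof
      fix u
      have "linear (?g' (f x))" using g has_derivative_linear by blast
      then show "?g' (f x) (?f' x u) = (\<Sum>i\<in>Basis. (?f' x u \<bullet> i) *\<^sub>R ?g' (f x) i)"
        by (subst euclidean_representation[symmetric]) (simp add: linear_sum linear_scale del: euclidean_representation)
    qed
    finally show "((\<lambda>x. g (f x)) has_derivative (\<lambda>u. \<Sum>i\<in>Basis. (?f' x u \<bullet> i) *\<^sub>R ?g' (f x) i)) (at x)" .
  next
    fix u
    have "ck_on k (\<lambda>x. ?f' x u \<bullet> i) S" for i
      using Suc.prems by (intro ck_on_bounded_linear[OF assms(1) bounded_linear_inner_left]) auto
    moreover have "ck_on k (\<lambda>x. ?g' (f x) i) S" for i
      using Suc.prems ck_on_SucD by (intro Suc.IH) auto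
    ultimately show "ck_on k (\<lambda>x. \<Sum>i\<in>Basis. (?f' x u \<bullet> i) *\<^sub>R ?g' (f x) i) S"
      by (intro ck_on_sum assms ck_on_bilinear[OF assms(1) bounded_bilinear_scaleR])
  qed
qed

lemma ck_on_inverse:
  fixes f :: "'e::euclidean_space \<Rightarrow> 'f::real_normed_field"
  assumes "open S" "\<And>x. x \<in> S \<Longrightarrow> f x \<noteq> 0" "ck_on k f S"
  shows "ck_on k (\<lambda>x. inverse (f x)) S"
  using assms(3)
proof (induction k)
  case 0
  then show ?case using assms(2) by (auto intro!: continuous_intros)
next
  case (Suc k)
  show ?case
  proof (rule ck_on_SucI[OF assms(1)])
    show "((\<lambda>x. inverse (f x)) has_derivative
        (\<lambda>u. - (inverse (f x) * frechet_derivative f (at x) u * inverse (f x)))) (at x)"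
      if "x \<in> S" for x
      using Deriv.has_derivative_inverse[OF assms(2)[OF that] ck_on_has_derivative[OF Suc.prems that]]
      by simp
    show "ck_on k (\<lambda>x. - (inverse (f x) * frechet_derivative f (at x) u * inverse (f x))) S" for u
      using Suc ck_on_SucD
      by (intro ck_on_bounded_linear[OF assms(1) bounded_linear_minus[OF bounded_linear_ident]]
          ck_on_bilinear[OF assms(1) bounded_bilinear_mult]) auto
  qed
qed

lemma ck_on_Pair:
  fixes f :: "'e::euclidean_space \<Rightarrow> 'f::euclidean_space" and g :: "'e \<Rightarrow> 'g::euclidean_space"
  assumes "open S" "ck_on k f S" "ck_on k g S"
  shows "ck_on k (\<lambda>x. (f x, g x)) S"
proof -
  have "ck_on k (\<lambda>x. (f x, 0) + (0, g x)) S"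
    by (intro ck_on_add assms
        ck_on_bounded_linear[OF assms(1) bounded_linear_Pair[OF bounded_linear_ident bounded_linear_zero]]
        ck_on_bounded_linear[OF assms(1) bounded_linear_Pair[OF bounded_linear_zero bounded_linear_ident]])
  then show ?thesis by simp
qed

lemma ck_on_ident: "open S \<Longrightarrow> ck_on k (\<lambda>x. x) S"
  by (cases k) (auto intro!: ck_on_SucI[where f' = "\<lambda>x u. u"] ck_on_const)

lemma smooth_on_subset: "smooth_on f S \<Longrightarrow> T \<subseteq> S \<Longrightarrow> smooth_on f T"
  unfolding smooth_on_def using ck_on_subset by blast

lemma smooth_on_cong:
  "open S \<Longrightarrow> (\<And>x. x \<in> S \<Longrightarrow> f x = g x) \<Longrightarrow> smooth_on f S \<Longrightarrow> smooth_on g S"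
  unfolding smooth_on_def using ck_on_cong by blast

lemma smooth_on_has_derivative:
  "smooth_on f S \<Longrightarrow> x \<in> S \<Longrightarrow> (f has_derivative frechet_derivative f (at x)) (at x)"
  unfolding smooth_on_def using ck_on_has_derivative by blast

lemma smooth_on_frechet_derivative:
  "smooth_on f S \<Longrightarrow> smooth_on (\<lambda>x. frechet_derivative f (at x) u) S"
  unfolding smooth_on_def by (metis ck_on.simps(2))

lemma smooth_on_const: "open S \<Longrightarrow> smooth_on (\<lambda>x. c) S"
  and smooth_on_ident: "open S \<Longrightarrow> smooth_on (\<lambda>x. x) S"
  and smooth_on_bounded_linear:
    "open S \<Longrightarrow> bounded_linear h \<Longrightarrow> smooth_on f S \<Longrightarrow> smooth_on (\<lambda>x. h (f x)) S"
  and smooth_on_bilinear: "open S \<Longrightarrow> bounded_bilinear b \<Longrightarrow> smooth_on f S \<Longrightarrow> smooth_on f' S \<Longrightarrow>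
    smooth_on (\<lambda>x. b (f x) (f' x)) S"
  and smooth_on_sum: "open S \<Longrightarrow> (\<And>i. i \<in> I \<Longrightarrow> smooth_on (F i) S) \<Longrightarrow> smooth_on (\<lambda>x. \<Sum>i\<in>I. F i x) S"
  unfolding smooth_on_def
  by (auto intro: ck_on_const ck_on_ident ck_on_bounded_linear ck_on_bilinear ck_on_sum)

lemma smooth_on_prod:
  fixes f :: "'i \<Rightarrow> 'e::euclidean_space \<Rightarrow> 'f::real_normed_field"
  shows "open S \<Longrightarrow> (\<And>i. i \<in> I \<Longrightarrow> smooth_on (f i) S) \<Longrightarrow> smooth_on (\<lambda>x. \<Prod>i\<in>I. f i x) S"
  unfolding smooth_on_def by (auto intro: ck_on_prod)

lemma smooth_on_inverse:
  fixes f :: "'e::euclidean_space \<Rightarrow> 'f::real_normed_field"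
  shows "open S \<Longrightarrow> (\<And>x. x \<in> S \<Longrightarrow> f x \<noteq> 0) \<Longrightarrow> smooth_on f S \<Longrightarrow> smooth_on (\<lambda>x. inverse (f x)) S"
  unfolding smooth_on_def by (auto intro: ck_on_inverse)

lemma smooth_on_compose:
  fixes f :: "'e::euclidean_space \<Rightarrow> 'f::euclidean_space"
  shows "open S \<Longrightarrow> open T \<Longrightarrow> f ` S \<subseteq> T \<Longrightarrow> smooth_on f S \<Longrightarrow> smooth_on g T \<Longrightarrow>
    smooth_on (\<lambda>x. g (f x)) S"
  unfolding smooth_on_def by (auto intro: ck_on_compose)

lemma smooth_on_Pair:
  fixes f :: "'e::euclidean_space \<Rightarrow> 'f::euclidean_space" and g :: "'e \<Rightarrow> 'g::euclidean_space"
  shows "open S \<Longrightarrow> smooth_on f S \<Longrightarrow> smooth_on g S \<Longrightarrow> smooth_on (\<lambda>x. (f x, g x)) S"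
  unfolding smooth_on_def by (auto intro: ck_on_Pair)

text \<open>Each level of \<open>ck_on\<close> is a condition at single points, as
  \<open>frechet_derivative\<close> does not depend on the set. This serves formulas that are valid
  only near a point, because a chart or a nonvanishing denominator was chosen there.\<close>

lemma smooth_on_local:
  assumes "\<And>x. x \<in> S \<Longrightarrow> \<exists>T. open T \<and> x \<in> T \<and> smooth_on f T"
  shows "smooth_on f S"
proof -
  have "ck_on k f S" if "\<And>x. x \<in> S \<Longrightarrow> \<exists>T. open T \<and> x \<in> T \<and> ck_on k f T" for k
    using that
  proof (induction k arbitrary: f)
    case 0
    have "continuous (at x) f" if "x \<in> S" for x
      using 0[OF that] by (auto simp: continuous_on_eq_continuous_at)
    then show ?case by (simp add: continuous_at_imp_continuous_on)
  next
    case (Suc k)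
    have "f differentiable at x" if "x \<in> S" for x
      using Suc.prems[OF that] by auto
    moreover have "ck_on k (\<lambda>x. frechet_derivative f (at x) u) S" for u
      using Suc.prems by (intro Suc.IH) fastforce
    ultimately show ?case by simp
  qed
  then show ?thesis using assms unfolding smooth_on_def by metis
qed

section \<open>Symmetry of second derivatives\<close>

text \<open>The mean value theorem for \<open>s \<mapsto> f (x + s u + t v) - f (x + s u)\<close>
  produces two values of the \<open>u\<close>-derivative at points of distance \<open>O(t)\<close>
  from \<open>x\<close>; its linear approximation at \<open>x\<close> is then applied to
  both.\<close>

lemma second_difference_estimate:
  fixes f :: "'e::euclidean_space \<Rightarrow> real"
  assumes "0 < r" "\<And>y. y \<in> ball x r \<Longrightarrow> f differentiable at y"
    and "((\<lambda>y. frechet_derivative f (at y) u) has_derivative H) (at x)" and "0 < e"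
  shows "\<exists>d>0. \<forall>t. 0 < t \<and> t < d \<longrightarrow>
    \<bar>f (x + t *\<^sub>R u + t *\<^sub>R v) - f (x + t *\<^sub>R u) - f (x + t *\<^sub>R v) + f x - t\<^sup>2 * H v\<bar> \<le> e * t\<^sup>2"
proof -
  let ?h = "\<lambda>y. frechet_derivative f (at y) u"
  \<comment> \<open>The displacement \<open>s u + s' v\<close> has norm at most \<open>t * M\<close>
    when \<open>s\<close> and \<open>s'\<close> lie between 0 and \<open>t\<close>. The summand 1
    makes \<open>M\<close> positive, so that it can be divided by.\<close>
  define M where "M = 1 + norm u + norm v"
  have M: "M > 0" unfolding M_def by (smt (verit) norm_ge_zero)
  have H: "linear H" using assms(3) has_derivative_linear by blast
  \<comment> \<open>The tolerance is \<open>e / (2 * M)\<close> because two errors of size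
    \<open>e / (2 * M) * (t * M)\<close> have to add up to \<open>e * t\<close>.\<close>
  from assms(3) obtain \<delta> where \<delta>: "\<delta> > 0"
    "\<And>y. norm (y - x) < \<delta> \<Longrightarrow> norm (?h y - ?h x - H (y - x)) \<le> e / (2 * M) * norm (y - x)"
    unfolding has_derivative_at_alt using \<open>0 < e\<close> M by (metis divide_pos_pos mult_pos_pos zero_less_numeral)
  have bd: "norm (s *\<^sub>R u + s' *\<^sub>R v) \<le> t * M" if "0 \<le> s" "s \<le> t" "0 \<le> s'" "s' \<le> t" for s s' t
  proof -
    have "norm (s *\<^sub>R u + s' *\<^sub>R v) \<le> s * norm u + s' * norm v"
      using that norm_triangle_ineq[of "s *\<^sub>R u" "s' *\<^sub>R v"] by simp
    also have "\<dots> \<le> t * norm u + t * norm v"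
      using that by (intro add_mono mult_right_mono) auto
    also have "\<dots> \<le> t * M" unfolding M_def using that by (simp add: algebra_simps)
    finally show ?thesis .
  qed
  define d where "d = min \<delta> r / M"
  have "d > 0" using \<delta> M assms(1) by (simp add: d_def)
  moreover have "\<bar>f (x + t *\<^sub>R u + t *\<^sub>R v) - f (x + t *\<^sub>R u) - f (x + t *\<^sub>R v) + f x - t\<^sup>2 * H v\<bar> \<le> e * t\<^sup>2"
    if t: "0 < t" "t < d" for t
  proof -
    have tM: "t * M < \<delta>" "t * M < r" using t M by (auto simp: d_def field_simps min_def split: if_splits)
    let ?p = "\<lambda>s s'. x + (s *\<^sub>R u + s' *\<^sub>R v)"
    have fd: "(f has_derivative frechet_derivative f (at (?p s s'))) (at (?p s s'))"
      if "0 \<le> s" "s \<le> t" "0 \<le> s'" "s' \<le> t" for s s'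
    proof -
      have dw: "dist x (x + w) = norm w" for w by (simp add: dist_norm)
      have "dist x (?p s s') < r" unfolding dw using bd[OF that] tM(2) by linarith
      then have "?p s s' \<in> ball x r" by simp
      then show ?thesis using assms(2) frechet_derivative_works by blast
    qed
    have der: "((\<lambda>s. f (?p s s')) has_derivative (\<lambda>a. a * ?h (?p s s'))) (at s)"
      if "0 \<le> s" "s \<le> t" "0 \<le> s'" "s' \<le> t" for s s'
    proof -
      have 1: "((\<lambda>s. ?p s s') has_derivative (\<lambda>a. a *\<^sub>R u)) (at s)"
        by (auto intro!: derivative_eq_intros)
      have "linear (frechet_derivative f (at (?p s s')))" using fd[OF that] has_derivative_linear by blast
      then show ?thesis using diff_chain_at[OF 1 fd[OF that]] by (simp add: o_def linear_scale)
    qed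
    let ?\<phi> = "\<lambda>s. f (?p s t) - f (?p s 0)"
    have phi: "(?\<phi> has_derivative (\<lambda>a. a * (?h (?p s t) - ?h (?p s 0)))) (at s)" if "0 \<le> s" "s \<le> t" for s
      using has_derivative_diff[OF der[OF that, of t] der[OF that, of 0]] t by (simp add: right_diff_distrib)
    have "\<exists>\<theta>\<in>{0<..<t}. ?\<phi> t - ?\<phi> 0 = (t - 0) * (?h (?p \<theta> t) - ?h (?p \<theta> 0))"
      by (rule mvt_simple[OF t(1)]) (use phi in \<open>auto intro: has_derivative_at_withinI\<close>)
    then obtain \<theta> where \<theta>: "0 < \<theta>" "\<theta> < t"
      "?\<phi> t - ?\<phi> 0 = (t - 0) * (?h (?p \<theta> t) - ?h (?p \<theta> 0))"
      by auto
    have b1: "\<bar>?h (?p \<theta> t) - ?h x - H (\<theta> *\<^sub>R u + t *\<^sub>R v)\<bar> \<le> e / (2 * M) * (t * M)"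
    proof -
      have "norm (?p \<theta> t - x) \<le> t * M" using bd[of \<theta> t t] \<theta> t by simp
      moreover from this have "norm (?h (?p \<theta> t) - ?h x - H (?p \<theta> t - x)) \<le> e / (2 * M) * norm (?p \<theta> t - x)"
        using \<delta>(2) tM(1) by (meson le_less_trans)
      moreover have "e / (2 * M) \<ge> 0" using assms(4) M by simp
      ultimately have "norm (?h (?p \<theta> t) - ?h x - H (?p \<theta> t - x)) \<le> e / (2 * M) * (t * M)"
        by (meson mult_left_mono order_trans)
      then show ?thesis by simp
    qed
    have b2: "\<bar>?h (?p \<theta> 0) - ?h x - H (\<theta> *\<^sub>R u + 0 *\<^sub>R v)\<bar> \<le> e / (2 * M) * (t * M)"
    proof -
      have "norm (?p \<theta> 0 - x) \<le> t * M" using bd[of \<theta> t 0] \<theta> t by simp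
      moreover from this have "norm (?h (?p \<theta> 0) - ?h x - H (?p \<theta> 0 - x)) \<le> e / (2 * M) * norm (?p \<theta> 0 - x)"
        using \<delta>(2) tM(1) by (meson le_less_trans)
      moreover have "e / (2 * M) \<ge> 0" using assms(4) M by simp
      ultimately have "norm (?h (?p \<theta> 0) - ?h x - H (?p \<theta> 0 - x)) \<le> e / (2 * M) * (t * M)"
        by (meson mult_left_mono order_trans)
      then show ?thesis by simp
    qed
    have "\<bar>?h (?p \<theta> t) - ?h (?p \<theta> 0) - t * H v\<bar> \<le> 2 * (e / (2 * M) * (t * M))"
      using b1 b2 H by (simp add: linear_add linear_scale linear_0)
    also have "\<dots> = e * t" using M by simp
    finally have "\<bar>t * (?h (?p \<theta> t) - ?h (?p \<theta> 0) - t * H v)\<bar> \<le> t * (e * t)"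
      using t by (simp add: abs_mult)
    then have "\<bar>(?\<phi> t - ?\<phi> 0) - t\<^sup>2 * H v\<bar> \<le> e * t\<^sup>2"
      using \<theta>(3) by (simp add: power2_eq_square algebra_simps)
    then show ?thesis by (simp add: algebra_simps)
  qed
  ultimately show ?thesis by blast
qed

text \<open>The second difference over a parallelogram is symmetric in \<open>u\<close> and
  \<open>v\<close>, so \<open>t\<^sup>2 * H v\<close> and \<open>t\<^sup>2 * H' u\<close>
  approximate the same number up to \<open>e * t\<^sup>2\<close> in total; divide by
  \<open>t\<^sup>2\<close>.\<close>

lemma symmetric_second_derivative_real:
  fixes f :: "'e::euclidean_space \<Rightarrow> real"
  assumes r: "0 < r" "\<And>y. y \<in> ball x r \<Longrightarrow> f differentiable at y"
    and H: "((\<lambda>y. frechet_derivative f (at y) u) has_derivative H) (at x)"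
    and H': "((\<lambda>y. frechet_derivative f (at y) v) has_derivative H') (at x)"
  shows "H v = H' u"
proof -
  have "\<bar>H v - H' u\<bar> \<le> 0 + e" if "e > 0" for e
  proof -
    from that have e2: "e / 2 > 0" by simp
    obtain d1 where d1: "d1 > 0" "\<And>t. 0 < t \<and> t < d1 \<Longrightarrow>
      \<bar>f (x + t *\<^sub>R u + t *\<^sub>R v) - f (x + t *\<^sub>R u) - f (x + t *\<^sub>R v) + f x - t\<^sup>2 * H v\<bar> \<le> e / 2 * t\<^sup>2"
      using second_difference_estimate[OF r H e2, where v = v] by blast
    obtain d2 where d2: "d2 > 0" "\<And>t. 0 < t \<and> t < d2 \<Longrightarrow>
      \<bar>f (x + t *\<^sub>R v + t *\<^sub>R u) - f (x + t *\<^sub>R v) - f (x + t *\<^sub>R u) + f x - t\<^sup>2 * H' u\<bar> \<le> e / 2 * t\<^sup>2"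
      using second_difference_estimate[OF r H' e2, where v = u] by blast
    define t where "t = min d1 d2 / 2"
    have t: "0 < t" "t < d1" "t < d2" using d1(1) d2(1) by (auto simp: t_def)
    have eq: "x + t *\<^sub>R v + t *\<^sub>R u = x + t *\<^sub>R u + t *\<^sub>R v" by simp
    have arith: "\<bar>p - q - r + s - a\<bar> \<le> m \<Longrightarrow> \<bar>p - r - q + s - b\<bar> \<le> m \<Longrightarrow> \<bar>a - b\<bar> \<le> m + m"
      for p q r s a b m :: real by linarith
    have "\<bar>t\<^sup>2 * H v - t\<^sup>2 * H' u\<bar> \<le> e / 2 * t\<^sup>2 + e / 2 * t\<^sup>2"
      by (rule arith[OF d1(2)[of t] d2(2)[of t, unfolded eq]]) (use t in auto)
    also have "\<dots> = t\<^sup>2 * e" by simp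
    also have "t\<^sup>2 * H v - t\<^sup>2 * H' u = t\<^sup>2 * (H v - H' u)" by (simp only: right_diff_distrib)
    finally have "t\<^sup>2 * \<bar>H v - H' u\<bar> \<le> t\<^sup>2 * e" unfolding abs_mult by simp
    moreover have "t\<^sup>2 > 0" using t(1) by simp
    ultimately have "\<bar>H v - H' u\<bar> \<le> e" by (rule mult_left_le_imp_le)
    then show ?thesis by simp
  qed
  then have "\<bar>H v - H' u\<bar> \<le> 0" by (rule field_le_epsilon)
  then show ?thesis by simp
qed

lemma symmetric_second_derivative:
  fixes f :: "'e::euclidean_space \<Rightarrow> 'f::euclidean_space"
  assumes "open S" "x \<in> S" "smooth_on f S"
  shows "frechet_derivative (\<lambda>y. frechet_derivative f (at y) u) (at x) v =
    frechet_derivative (\<lambda>y. frechet_derivative f (at y) v) (at x) u"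
proof (rule euclidean_eqI)
  fix i :: 'f assume "i \<in> Basis"
  obtain r where r: "r > 0" "ball x r \<subseteq> S" using assms openE by blast
  define g where "g = (\<lambda>y. f y \<bullet> i)"
  let ?D = "\<lambda>u. frechet_derivative (\<lambda>y. frechet_derivative f (at y) u) (at x)"
  have g: "(g has_derivative (\<lambda>w. frechet_derivative f (at y) w \<bullet> i)) (at y)" if "y \<in> S" for y
    unfolding g_def using smooth_on_has_derivative[OF assms(3) that] by (rule has_derivative_inner_left)
  then have gd: "g differentiable at y" if "y \<in> ball x r" for y
    using that r unfolding differentiable_def by blast
  have gD: "((\<lambda>y. frechet_derivative g (at y) w) has_derivative (\<lambda>w'. ?D w w' \<bullet> i)) (at x)" for w
  proof (rule has_derivative_transform_within_open[OF _ assms(1,2)])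
    show "((\<lambda>y. frechet_derivative f (at y) w \<bullet> i) has_derivative (\<lambda>w'. ?D w w' \<bullet> i)) (at x)"
      using smooth_on_has_derivative[OF smooth_on_frechet_derivative[OF assms(3)] assms(2)]
      by (rule has_derivative_inner_left)
  qed (simp add: frechet_derivative_eqI[OF g])
  show "?D u v \<bullet> i = ?D v u \<bullet> i"
    by (rule symmetric_second_derivative_real[OF r(1) gd gD gD])
qed

section \<open>Complex multilinear algebra\<close>

definition clinear_at :: "nat \<Rightarrow> ('e \<Rightarrow> 'e) \<Rightarrow> ('e list \<Rightarrow> complex) \<Rightarrow> nat \<Rightarrow> bool" where
  "clinear_at m J \<omega> k \<longleftrightarrow> (\<forall>us. length us = m \<longrightarrow> \<omega> (us[k := J (us ! k)]) = \<i> * \<omega> us)"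

text \<open>The (n,0)-forms described without complexification. \<open>form_n0_iff\<close> shows
  that this agrees with \<open>form_n0\<close>, and the algebra is done with this version.\<close>

definition cform :: "nat \<Rightarrow> ('e::euclidean_space \<Rightarrow> 'e) \<Rightarrow> ('e list \<Rightarrow> complex) \<Rightarrow> bool" where
  "cform n J \<omega> \<longleftrightarrow> alternating_form n \<omega> \<and> (\<forall>k<n. clinear_at n J \<omega> k)"

lemma clinear_atD: "clinear_at m J \<omega> k \<Longrightarrow> length us = m \<Longrightarrow> \<omega> (us[k := J (us ! k)]) = \<i> * \<omega> us"
  by (simp add: clinear_at_def)

lemma clinear_at_update:
  "clinear_at m J \<omega> k \<Longrightarrow> length us = m \<Longrightarrow> k < m \<Longrightarrow> \<omega> (us[k := J a]) = \<i> * \<omega> (us[k := a])"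
  using clinear_atD[of m J \<omega> k "us[k := a]"] by simp

subsection \<open>Complexification of multilinear forms\<close>

lemma complexify_Nil: "complexify \<omega> [] = \<omega> []"
  by (simp add: complexify_def)

text \<open>The subsets of the index set are split by whether they contain 0. This is the recursion
  on which inductions over \<open>zs\<close> run.\<close>

lemma complexify_Cons:
  "complexify \<omega> (z # zs) =
    complexify (\<lambda>us. \<omega> (fst z # us)) zs + \<i> * complexify (\<lambda>us. \<omega> (snd z # us)) zs"
proof -
  let ?N = "length zs"
  let ?sel = "\<lambda>ys S. map (\<lambda>k. if k \<in> S then snd (ys ! k) else fst (ys ! k)) [0..<length ys]"
  let ?t = "\<lambda>S. \<i> ^ card S * \<omega> (?sel (z # zs) S)"
  have up: "[0..<Suc ?N] = 0 # map Suc [0..<?N]" by (simp add: upt_conv_Cons map_Suc_upt del: upt_Suc)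
  have sel0: "?sel (z # zs) (Suc ` S) = fst z # ?sel zs S" for S
    unfolding length_Cons up by (simp add: o_def image_iff)
  have sel1: "?sel (z # zs) (insert 0 (Suc ` S)) = snd z # ?sel zs S" for S
    unfolding length_Cons up by (simp add: o_def image_iff)
  have 1: "{..<Suc ?N} = insert 0 (Suc ` {..<?N})" by (simp add: lessThan_Suc_eq_insert_0)
  have 2: "Pow (Suc ` {..<?N}) = (`) Suc ` Pow {..<?N}" by (simp add: image_Pow_surj)
  have inj: "inj_on ((`) Suc) (Pow {..<?N})" by (rule inj_on_image_Pow) simp
  have inj0: "inj_on (insert 0) (Pow (Suc ` {..<?N}))"
    by (auto simp: inj_on_def)
  have "complexify \<omega> (z # zs) = sum ?t (Pow (insert 0 (Suc ` {..<?N})))"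
    unfolding complexify_def list.size 1[symmetric] by simp
  also have "\<dots> = sum ?t (Pow (Suc ` {..<?N})) + sum ?t (insert 0 ` Pow (Suc ` {..<?N}))"
    unfolding Pow_insert by (rule sum.union_disjoint) auto
  also have "sum ?t (Pow (Suc ` {..<?N})) = complexify (\<lambda>us. \<omega> (fst z # us)) zs"
    unfolding 2 sum.reindex[OF inj] o_def complexify_def sel0 by (simp add: card_image)
  also have "sum ?t (insert 0 ` Pow (Suc ` {..<?N})) = \<i> * complexify (\<lambda>us. \<omega> (snd z # us)) zs"
    unfolding sum.reindex[OF inj0] unfolding 2 sum.reindex[OF inj] o_def complexify_def sel1 sum_distrib_left
  proof (rule sum.cong[OF refl])
    fix S assume "S \<in> Pow {..<?N}"
    then have "finite S" by (auto intro: finite_subset)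
    then have "card (insert 0 (Suc ` S)) = Suc (card S)" by (simp add: card_insert_if image_iff card_image)
    then show "\<i> ^ card (insert 0 (Suc ` S)) * \<omega> (snd z # ?sel zs S) = \<i> * (\<i> ^ card S * \<omega> (snd z # ?sel zs S))"
      by simp
  qed
  finally show ?thesis .
qed

lemma complexify_cong:
  "(\<And>us. length us = length zs \<Longrightarrow> \<omega> us = \<omega>' us) \<Longrightarrow> complexify \<omega> zs = complexify \<omega>' zs"
  unfolding complexify_def by simp

lemma complexify_add: "complexify (\<lambda>us. \<omega> us + \<omega>' us) zs = complexify \<omega> zs + complexify \<omega>' zs"
  unfolding complexify_def by (simp add: distrib_left sum.distrib)

lemma complexify_scale: "complexify (\<lambda>us. c * \<omega> us) zs = c * complexify \<omega> zs"
  unfolding complexify_def sum_distrib_left by (simp add: mult.left_commute)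

text \<open>A (0,1)-vector is \<open>(a, J a)\<close>, so its slot contributes the value at
  \<open>a\<close> plus \<open>\<i>\<close> times the value at \<open>J a\<close>, that is, the
  factor \<open>1 + \<i> * \<i> = 0\<close>.\<close>

lemma complexify_type01:
  assumes "clinear_at (length zs) J \<omega> k" "k < length zs" "zs ! k \<in> type01 J"
  shows "complexify \<omega> zs = 0"
  using assms
proof (induction zs arbitrary: \<omega> k)
  case (Cons z zs)
  show ?case
  proof (cases k)
    case 0
    then have z: "snd z = J (fst z)" using Cons.prems by (auto simp: type01_def)
    have "complexify (\<lambda>us. \<omega> (snd z # us)) zs = complexify (\<lambda>us. \<i> * \<omega> (fst z # us)) zs"
      using 0 clinear_atD[OF Cons.prems(1), of "fst z # us" for us] z by (intro complexify_cong) simp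
    then show ?thesis unfolding complexify_Cons complexify_scale by simp
  next
    case (Suc k')
    have "clinear_at (length zs) J (\<lambda>us. \<omega> (u # us)) k'" for u
      unfolding clinear_at_def using clinear_atD[OF Cons.prems(1), of "u # us" for us] Suc by simp
    then show ?thesis unfolding complexify_Cons
      using Cons.IH[of "\<lambda>us. \<omega> (u # us)" k' for u] Cons.prems Suc by simp
  qed
qed simp

text \<open>A (1,0)-vector is \<open>(a, - J a)\<close>: the real and the imaginary part contribute
  equally, which gives a factor 2 for each slot.\<close>

lemma complexify_type10:
  assumes "\<And>k. k < length zs \<Longrightarrow> clinear_at (length zs) J \<omega> k"
    and "\<And>k. k < length zs \<Longrightarrow> zs ! k \<in> type10 J"
  shows "complexify \<omega> zs = 2 ^ length zs * \<omega> (map fst zs)"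
  using assms
proof (induction zs arbitrary: \<omega>)
  case (Cons z zs)
  have z: "fst z = J (snd z)" using Cons.prems(2)[of 0] by (auto simp: type10_def)
  have *: "\<omega> (fst z # us) = \<i> * \<omega> (snd z # us)" if "length us = length zs" for us
    using clinear_atD[OF Cons.prems(1)[of 0], of "snd z # us"] z that by simp
  have "clinear_at (length zs) J (\<lambda>us. \<omega> (u # us)) k" if "k < length zs" for u k
    unfolding clinear_at_def using clinear_atD[OF Cons.prems(1)[of "Suc k"], of "u # us" for us] that by simp
  moreover have "zs ! k \<in> type10 J" if "k < length zs" for k
    using Cons.prems(2)[of "Suc k"] that by simp
  ultimately have "complexify (\<lambda>us. \<omega> (u # us)) zs = 2 ^ length zs * \<omega> (u # map fst zs)" for u
    using Cons.IH by blast
  then show ?case unfolding complexify_Cons using *[of "map fst zs"] by simp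
qed (simp add: complexify_Nil)

text \<open>Every term that selects an imaginary part has a zero entry; multilinearity enters only
  in this form.\<close>

lemma complexify_real:
  assumes "\<And>us k. length us = m \<Longrightarrow> k < m \<Longrightarrow> us ! k = 0 \<Longrightarrow> \<omega> us = 0" "length us = m"
  shows "complexify \<omega> (map (\<lambda>u. (u, 0)) us) = \<omega> us"
  using assms
proof (induction us arbitrary: \<omega> m)
  case (Cons u us)
  have IH: "complexify (\<lambda>us. \<omega> (v # us)) (map (\<lambda>u. (u, 0)) us) = \<omega> (v # us)" for v
    using Cons.prems(1)[of "v # us'" "Suc k" for us' k] Cons.prems(2)
    by (intro Cons.IH[of "length us"]) auto
  have "\<omega> (0 # us) = 0" using Cons.prems(1)[of "0 # us" 0] Cons.prems(2) by auto
  then show ?case by (simp add: complexify_Cons IH)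
qed (simp add: complexify_Nil)

lemma complexify_real_update:
  assumes "\<And>us k. length us = m \<Longrightarrow> k < m \<Longrightarrow> us ! k = 0 \<Longrightarrow> \<omega> us = 0" "length us = m" "k < m"
  shows "complexify \<omega> ((map (\<lambda>u. (u, 0)) us)[k := (a, b)]) = \<omega> (us[k := a]) + \<i> * \<omega> (us[k := b])"
  using assms
proof (induction us arbitrary: \<omega> m k)
  case (Cons u us)
  have zero: "\<omega> (v # us') = 0" if "length us' = length us" "j < length us" "us' ! j = 0" for v us' j
    using Cons.prems(1)[of "v # us'" "Suc j"] Cons.prems(2) that by auto
  show ?case
  proof (cases k)
    case 0
    have "complexify (\<lambda>us. \<omega> (v # us)) (map (\<lambda>u. (u, 0)) us) = \<omega> (v # us)" for v
      by (rule complexify_real[of "length us"]) (use zero in auto)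
    then show ?thesis by (simp add: complexify_Cons 0)
  next
    case (Suc k')
    have IH: "complexify (\<lambda>us. \<omega> (v # us)) ((map (\<lambda>u. (u, 0)) us)[k' := (a, b)]) =
        \<omega> (v # us[k' := a]) + \<i> * \<omega> (v # us[k' := b])" for v
      using Cons.prems Suc zero by (intro Cons.IH[of "length us"]) auto
    have "\<omega> (0 # us[k' := c]) = 0" for c
      using Cons.prems(1)[of "0 # us[k' := c]" 0] Cons.prems(2) by auto
    then show ?thesis by (simp add: complexify_Cons Suc IH)
  qed
qed simp

subsection \<open>Alternating forms\<close>

lemma alternating_formD:
  assumes "alternating_form m \<omega>" "length us = m"
  shows "i < m \<Longrightarrow> linear (\<lambda>u. \<omega> (us[i := u]))"
    and "i < m \<Longrightarrow> j < m \<Longrightarrow> i \<noteq> j \<Longrightarrow> us ! i = us ! j \<Longrightarrow> \<omega> us = 0"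
  using assms unfolding alternating_form_def by (auto, metis linorder_neqE_nat)

lemma alternating_form_zero:
  assumes "alternating_form m \<omega>" "length us = m" "k < m" "us ! k = 0"
  shows "\<omega> us = 0"
  using linear_0[OF alternating_formD(1)[OF assms(1-3)]] assms by (metis list_update_id)

lemma alternating_form_swap:
  assumes "alternating_form m \<omega>" "length us = m" "i < m" "j < m" "i \<noteq> j"
  shows "\<omega> (us[i := b, j := a]) = - \<omega> (us[i := a, j := b])"
proof -
  let ?w = "\<lambda>x y. \<omega> (us[i := x, j := y])"
  have z: "?w x x = 0" for x
    by (rule alternating_formD(2)[OF assms(1), of _ i j]) (use assms in auto)
  have r: "?w x (y + y') = ?w x y + ?w x y'" for x y y'
    using linear_add[OF alternating_formD(1)[OF assms(1), of "us[i := x]" j]] assms by simp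
  have l: "?w (x + x') y = ?w x y + ?w x' y" for x x' y
    using linear_add[OF alternating_formD(1)[OF assms(1), of "us[j := y]" i]] assms
    by (simp add: list_update_swap[of i j])
  have "0 = ?w (a + b) (a + b)" by (rule z[symmetric])
  also have "\<dots> = ?w a b + ?w b a" unfolding l r by (simp add: z)
  finally show ?thesis by (metis add.commute eq_neg_iff_add_eq_0)
qed

text \<open>One adjacent transposition for each entry of \<open>blk\<close>. This is the source of
  the signs when forms are evaluated on lists with an entry left out.\<close>

lemma alternating_form_move:
  assumes "alternating_form m \<omega>" "length pre + length blk + 1 + length post = m"
  shows "\<omega> (pre @ blk @ w # post) = (-1) ^ length blk * \<omega> (pre @ w # blk @ post)"
  using assms(2)
proof (induction blk arbitrary: pre)
  case (Cons x blk)
  let ?us = "pre @ x # w # blk @ post" and ?i = "length pre"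
  have "\<omega> (pre @ (x # blk) @ w # post) = (-1) ^ length blk * \<omega> ?us"
    using Cons.IH[of "pre @ [x]"] Cons.prems by simp
  also have "\<omega> ?us = - \<omega> (pre @ w # x # blk @ post)"
    using alternating_form_swap[OF assms(1), of ?us ?i "Suc ?i" w x] Cons.prems
    by (simp add: list_update_append)
  finally show ?case by simp
qed simp

lemma form_n0_iff:
  assumes J: "\<And>a. J (J a) = - a"
  shows "form_n0 n J \<omega> \<longleftrightarrow> cform n J \<omega>"
proof
  assume f: "form_n0 n J \<omega>"
  then have alt: "alternating_form n \<omega>" by (simp add: form_n0_def)
  have "clinear_at n J \<omega> k" if k: "k < n" for k
    unfolding clinear_at_def
  proof (intro allI impI)
    fix us :: "'a list" assume us: "length us = n"
    \<comment> \<open>All entries are real except the one in slot \<open>k\<close>, which is the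
      (0,1)-vector with real part \<open>us ! k\<close>. Vanishing on this list is complex linearity
      in that slot.\<close>
    let ?zs = "(map (\<lambda>u. (u, 0)) us)[k := (us ! k, J (us ! k))]"
    have "\<exists>k<n. ?zs ! k \<in> type01 J" using k us J by (auto intro!: exI[of _ k] simp: type01_def)
    moreover have "length ?zs = n" using us by simp
    ultimately have "complexify \<omega> ?zs = 0" using f unfolding form_n0_def by blast
    moreover have "complexify \<omega> ?zs = \<omega> (us[k := us ! k]) + \<i> * \<omega> (us[k := J (us ! k)])"
      by (rule complexify_real_update[OF alternating_form_zero[OF alt]]) (use us k in auto)
    ultimately have "\<omega> us = - (\<i> * \<omega> (us[k := J (us ! k)]))" by (simp add: eq_neg_iff_add_eq_0)
    then show "\<omega> (us[k := J (us ! k)]) = \<i> * \<omega> us" by simp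
  qed
  then show "cform n J \<omega>" using alt by (simp add: cform_def)
next
  assume "cform n J \<omega>"
  then show "form_n0 n J \<omega>"
    unfolding form_n0_def cform_def using complexify_type01 by metis
qed

lemma cform_lincomb:
  assumes "cform n J \<omega>" "cform n J \<omega>'"
  shows "cform n J (\<lambda>us. \<omega> us + c * \<omega>' us)"
proof -
  have "linear (\<lambda>u. \<omega> (us[i := u]) + c * \<omega>' (us[i := u]))" if us: "length us = n" "i < n" for us i
  proof -
    have l: "linear (\<lambda>u. \<omega> (us[i := u]))" "linear (\<lambda>u. \<omega>' (us[i := u]))"
      using assms us by (auto simp: cform_def alternating_form_def)
    show ?thesis
      by (rule linearI)
        (simp_all add: l[THEN linear_add] l[THEN linear_scale] distrib_left scaleR_right_distrib)
  qed
  moreover have "\<omega> us + c * \<omega>' us = 0"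
    if "length us = n" "i < j" "j < n" "us ! i = us ! j" for us i j
    using assms that unfolding cform_def alternating_form_def by (metis add.right_neutral mult_zero_right)
  ultimately have "alternating_form n (\<lambda>us. \<omega> us + c * \<omega>' us)"
    unfolding alternating_form_def by blast
  moreover have "clinear_at n J (\<lambda>us. \<omega> us + c * \<omega>' us) k" if "k < n" for k
    using assms that unfolding cform_def clinear_at_def by (simp add: distrib_left mult.left_commute)
  ultimately show ?thesis unfolding cform_def by blast
qed

text \<open>\<open>Re z + Im z J\<close> is the action of the scalar \<open>z\<close> on the complex
  vector space that \<open>J\<close> makes of \<open>'e\<close>.\<close>

lemma cform_scale_slot:
  assumes "cform n J \<omega>" "length us = n" "k < n"
  shows "\<omega> (us[k := Re z *\<^sub>R a + Im z *\<^sub>R J a]) = z * \<omega> (us[k := a])"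
proof -
  have lin: "linear (\<lambda>u. \<omega> (us[k := u]))" using assms by (auto simp: cform_def alternating_form_def)
  have "\<omega> (us[k := J a]) = \<i> * \<omega> (us[k := a])"
    using assms clinear_at_update[of n J \<omega> k us a] by (simp add: cform_def)
  then have "\<omega> (us[k := Re z *\<^sub>R a + Im z *\<^sub>R J a]) =
      (of_real (Re z) + \<i> * of_real (Im z)) * \<omega> (us[k := a])"
    by (simp add: linear_add[OF lin] linear_scale[OF lin] scaleR_conv_of_real algebra_simps)
  then show ?thesis by (simp add: complex_eq[symmetric])
qed

subsection \<open>The complex volume form\<close>

text \<open>Grows a complex basis one vector at a time. The span of the part already found is
  invariant under \<open>I\<close>, so a vector \<open>e\<close> outside of it can be added together
  with \<open>I e\<close>.\<close>

lemma exists_complex_basis: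
  fixes I :: "'e::euclidean_space \<Rightarrow> 'e"
  assumes I: "linear I" "\<And>a. I (I a) = - a" and "2 * m \<le> DIM('e)"
  shows "\<exists>S. finite S \<and> card S = m \<and> independent (S \<union> I ` S) \<and> S \<inter> I ` S = {} \<and> inj_on I S"
  using assms(3)
proof (induction m)
  case 0
  then show ?case by (intro exI[of _ "{}"]) (auto simp: independent_empty)
next
  case (Suc m)
  then obtain S where S: "finite S" "card S = m" "independent (S \<union> I ` S)" "S \<inter> I ` S = {}" "inj_on I S"
    by auto
  let ?B = "S \<union> I ` S"
  have "card ?B = 2 * m" using S by (simp add: card_Un_disjoint card_image)
  then have "dim (span ?B) < DIM('e)" using dim_eq_card_independent[OF S(3)] Suc.prems by simp
  then have "span ?B \<noteq> UNIV" by (metis dim_UNIV less_irrefl)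
  then obtain e where e: "e \<notin> span ?B" by blast
  have Iinv: "I v \<in> span ?B" if "v \<in> span ?B" for v
  proof -
    have "I b \<in> span ?B" if b: "b \<in> ?B" for b
    proof (cases "b \<in> S")
      case False
      then obtain x where "x \<in> S" "b = I x" using b by blast
      then show ?thesis using I(2) span_neg[OF span_base[of x ?B]] by simp
    qed (simp add: span_base)
    then have "I ` ?B \<subseteq> span ?B" by blast
    then have "span (I ` ?B) \<subseteq> span ?B" by (simp add: span_minimal)
    then show ?thesis using that linear_span_image[OF I(1), of ?B] by blast
  qed
  \<comment> \<open>Otherwise \<open>I\<close> would act on the class of \<open>e\<close> modulo the
    invariant span by a real scalar \<open>c\<close>, which would force
    \<open>c * c = - 1\<close>.\<close>
  have Ie: "I e \<notin> span (insert e ?B)"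
  proof
    assume "I e \<in> span (insert e ?B)"
    then obtain c where c: "I e - c *\<^sub>R e \<in> span ?B" using span_breakdown_eq by blast
    then have "I (I e - c *\<^sub>R e) \<in> span ?B" by (rule Iinv)
    then have "- e - c *\<^sub>R I e \<in> span ?B" by (simp add: linear_diff[OF I(1)] linear_scale[OF I(1)] I(2))
    then have "- e - c *\<^sub>R I e + c *\<^sub>R (I e - c *\<^sub>R e) \<in> span ?B" using c by (intro span_add span_scale)
    moreover have "- e - c *\<^sub>R I e + c *\<^sub>R (I e - c *\<^sub>R e) = (- (1 + c * c)) *\<^sub>R e" by (simp add: algebra_simps)
    ultimately have "(- (1 + c * c)) *\<^sub>R e \<in> span ?B" by simp
    then have "(1 / (- (1 + c * c))) *\<^sub>R (- (1 + c * c)) *\<^sub>R e \<in> span ?B" by (rule span_scale)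
    moreover have "1 + c * c \<noteq> 0" using zero_le_square[of c] by linarith
    then have "- 1 - c * c \<noteq> 0" by simp
    ultimately show False using e \<open>1 + c * c \<noteq> 0\<close> by simp
  qed
  let ?S = "insert e S"
  have eq: "?S \<union> I ` ?S = insert (I e) (insert e ?B)" by auto
  have eB: "e \<notin> ?B" using e span_base[of e ?B] by blast
  have IeB: "I e \<notin> insert e ?B" using Ie span_base[of "I e" "insert e ?B"] by blast
  have "independent (insert e ?B)" using S(3) e independent_insert by (metis eB)
  then have "independent (?S \<union> I ` ?S)" unfolding eq using Ie independent_insert IeB by metis
  moreover have "card ?S = Suc m" using S eB by simp
  moreover have "e \<notin> I ` ?S" using eB IeB by auto
  then have "?S \<inter> I ` ?S = {}" using S IeB by auto
  moreover have "inj_on I ?S" using S IeB by auto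
  ultimately show ?case using S(1) by (intro exI[of _ ?S]) simp
qed

lemma exists_complex_coordinates:
  fixes I :: "'e::euclidean_space \<Rightarrow> 'e"
  assumes I: "linear I" "\<And>a. I (I a) = - a" and n: "DIM('e) = 2 * n"
  obtains e :: "nat \<Rightarrow> 'e" and \<zeta> :: "nat \<Rightarrow> 'e \<Rightarrow> complex"
  where "\<And>j. j < n \<Longrightarrow> linear (\<zeta> j)" "\<And>j u. j < n \<Longrightarrow> \<zeta> j (I u) = \<i> * \<zeta> j u"
    "\<And>j k. j < n \<Longrightarrow> k < n \<Longrightarrow> \<zeta> j (e k) = of_bool (j = k)"
    "\<And>u. u = (\<Sum>j<n. Re (\<zeta> j u) *\<^sub>R e j + Im (\<zeta> j u) *\<^sub>R I (e j))"
proof -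
  obtain S where S: "finite S" "card S = n" "independent (S \<union> I ` S)" "S \<inter> I ` S = {}" "inj_on I S"
    using exists_complex_basis[OF I, of n] n by auto
  let ?B = "S \<union> I ` S"
  have "card ?B = 2 * n" using S by (simp add: card_Un_disjoint card_image)
  then have "UNIV \<subseteq> span ?B" using S(3) n by (intro card_ge_dim_independent) auto
  then have sp: "v \<in> span ?B" for v by blast
  obtain e where e: "bij_betw e {..<n} S"
    using ex_bij_betw_nat_finite[OF S(1)] S(2) atLeast0LessThan by metis
  then have eS: "j < n \<Longrightarrow> e j \<in> S" for j by (auto simp: bij_betw_def)
  \<comment> \<open>The coefficients of \<open>e j\<close> and \<open>I (e j)\<close> in the real
    basis are the real and the imaginary part of the complex coordinate.\<close>
  define \<zeta> where "\<zeta> j u = Complex (representation ?B u (e j)) (representation ?B u (I (e j)))" for j u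
  have lin: "linear (\<zeta> j)" for j
    by (rule linearI) (auto simp: \<zeta>_def complex_eq_iff representation_add[OF S(3) sp sp] representation_scale[OF S(3) sp])
  have eqe: "e j = e k \<longleftrightarrow> j = k" if "j < n" "k < n" for j k
    using e that by (auto simp: bij_betw_def inj_on_def)
  have dis: "e j \<noteq> I (e k)" if "j < n" "k < n" for j k
    using S(4) eS that by blast
  have eqI: "I (e j) = I (e k) \<longleftrightarrow> j = k" if "j < n" "k < n" for j k
    using S(5) eS that eqe by (metis inj_onD)
  have rep: "representation ?B b = (\<lambda>v. if v = b then 1 else 0)" if "b \<in> ?B" for b
    using representation_basis[OF S(3) that] .
  have ze: "\<zeta> j (e k) = of_bool (j = k)" if "j < n" "k < n" for j k
    using eS[of k] that dis[of k j] eqe[of j k] by (auto simp: \<zeta>_def rep complex_eq_iff)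
  have zIe: "\<zeta> j (I (e k)) = \<i> * of_bool (j = k)" if "j < n" "k < n" for j k
    using eS[of k] that dis[of j k] eqI[of j k] by (auto simp: \<zeta>_def rep complex_eq_iff)
  show ?thesis
  proof (rule that[of \<zeta> e])
    show "linear (\<zeta> j)" for j by (rule lin)
    show "\<zeta> j (e k) = of_bool (j = k)" if "j < n" "k < n" for j k by (rule ze[OF that])
    show "\<zeta> j (I u) = \<i> * \<zeta> j u" if j: "j < n" for j u
    proof -
      have l1: "linear (\<lambda>u. \<zeta> j (I u))" using linear_compose[OF I(1) lin] by (simp add: o_def)
      have l2: "linear (\<lambda>u. \<i> * \<zeta> j u)"
        using linear_compose[OF lin bounded_linear.linear[OF bounded_linear_mult_right]] by (simp add: o_def)
      have "\<zeta> j (I b) = \<i> * \<zeta> j b" if "b \<in> ?B" for b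
      proof -
        from that obtain k where k: "k < n" "b = e k \<or> b = I (e k)"
          using e by (auto simp: bij_betw_def)
        then show ?thesis using j by (auto simp: ze zIe I(2) linear_neg[OF lin])
      qed
      then show ?thesis using linear_eq_on[OF l1 l2 sp] by blast
    qed
    show "u = (\<Sum>j<n. Re (\<zeta> j u) *\<^sub>R e j + Im (\<zeta> j u) *\<^sub>R I (e j))" for u
    proof -
      have "u = (\<Sum>b\<in>?B. representation ?B u b *\<^sub>R b)"
        using sum_representation_eq[OF S(3) sp, of ?B] S(1) by simp
      also have "\<dots> = (\<Sum>b\<in>S. representation ?B u b *\<^sub>R b) + (\<Sum>b\<in>S. representation ?B u (I b) *\<^sub>R I b)"
        using S by (subst sum.union_disjoint) (auto simp: sum.reindex)
      also have "\<dots> = (\<Sum>b\<in>S. representation ?B u b *\<^sub>R b + representation ?B u (I b) *\<^sub>R I b)"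
        by (simp add: sum.distrib)
      also have "\<dots> = (\<Sum>j<n. Re (\<zeta> j u) *\<^sub>R e j + Im (\<zeta> j u) *\<^sub>R I (e j))"
        by (simp add: sum.reindex_bij_betw[OF e, symmetric] \<zeta>_def)
      finally show ?thesis .
    qed
  qed
qed

text \<open>The determinant of the matrix of the \<open>\<zeta> j (us ! i)\<close>, that is, the
  wedge product of the coordinate forms \<open>\<zeta> j\<close>. The explicit sum over permutations
  lets smoothness and derivatives be computed term by term.\<close>

definition vol_form :: "nat \<Rightarrow> (nat \<Rightarrow> 'e \<Rightarrow> complex) \<Rightarrow> 'e list \<Rightarrow> complex" where
  "vol_form n \<zeta> us = (\<Sum>p | p permutes {..<n}. of_int (sign p) * (\<Prod>i<n. \<zeta> (p i) (us ! i)))"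

lemma vol_form_slot:
  assumes "length us = n" "k < n"
  shows "vol_form n \<zeta> (us[k := a]) = (\<Sum>p | p permutes {..<n}.
    of_int (sign p) * (\<zeta> (p k) a * (\<Prod>i\<in>{..<n} - {k}. \<zeta> (p i) (us ! i))))"
  unfolding vol_form_def
proof (rule sum.cong[OF refl])
  fix p
  have "(\<Prod>i<n. \<zeta> (p i) (us[k := a] ! i)) =
      \<zeta> (p k) a * (\<Prod>i\<in>{..<n} - {k}. \<zeta> (p i) (us[k := a] ! i))"
    using assms by (subst prod.remove[of _ k]) auto
  also have "(\<Prod>i\<in>{..<n} - {k}. \<zeta> (p i) (us[k := a] ! i)) = (\<Prod>i\<in>{..<n} - {k}. \<zeta> (p i) (us ! i))"
    by (rule prod.cong) auto
  finally show "of_int (sign p) * (\<Prod>i<n. \<zeta> (p i) (us[k := a] ! i)) =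
      of_int (sign p) * (\<zeta> (p k) a * (\<Prod>i\<in>{..<n} - {k}. \<zeta> (p i) (us ! i)))"
    by (simp only:)
qed

lemma cform_vol_form:
  fixes \<zeta> :: "nat \<Rightarrow> 'e::euclidean_space \<Rightarrow> complex"
  assumes lin: "\<And>j. j < n \<Longrightarrow> linear (\<zeta> j)" and I: "\<And>j u. j < n \<Longrightarrow> \<zeta> j (I u) = \<i> * \<zeta> j u"
  shows "cform n I (vol_form n \<zeta>)"
  unfolding cform_def alternating_form_def
proof (intro conjI allI impI; (elim conjE)?)
  fix us :: "'e list" and k assume us: "length us = n" "k < n"
  have pk: "p k < n" if "p permutes {..<n}" for p using permutes_in_image[OF that, of k] us by simp
  show "linear (\<lambda>u. vol_form n \<zeta> (us[k := u]))"
    by (rule linearI)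
      (auto simp: vol_form_slot[OF us] linear_add[OF lin[OF pk]] linear_scale[OF lin[OF pk]] algebra_simps
        sum.distrib scaleR_sum_right intro!: sum.cong)
next
  fix us :: "'e list" and i j assume us: "length us = n" "i < j" "j < n" "us ! i = us ! j"
  let ?t = "Transposition.transpose i j"
  let ?f = "\<lambda>p. of_int (sign p) * (\<Prod>k<n. \<zeta> (p k) (us ! k))"
  have t: "?t permutes {..<n}" using us by (intro permutes_swap_id) auto
  \<comment> \<open>Composition with the transposition reverses the sign but keeps the product, as
    the entries \<open>i\<close> and \<open>j\<close> agree. Reindexing by it then gives
    \<open>vol_form n \<zeta> us = - vol_form n \<zeta> us\<close>.\<close>
  have f: "?f (p \<circ> ?t) = - ?f p" if "p permutes {..<n}" for p
  proof -
    have "sign (p \<circ> ?t) = - sign p"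
      using us that permutes_imp_permutation[OF _ that] permutes_imp_permutation[OF _ t]
      by (simp add: sign_compose sign_swap_id)
    moreover have "(\<Prod>k<n. \<zeta> ((p \<circ> ?t) k) (us ! k)) = (\<Prod>k<n. \<zeta> (p k) (us ! k))"
    proof -
      have "us ! k = us ! ?t k" for k using us by (auto simp: Transposition.transpose_def)
      then have "(\<Prod>k<n. \<zeta> ((p \<circ> ?t) k) (us ! k)) = (\<Prod>k<n. (\<lambda>k. \<zeta> (p k) (us ! k)) (?t k))"
        by (intro prod.cong) auto
      also have "\<dots> = (\<Prod>k<n. \<zeta> (p k) (us ! k))"
        by (rule prod.reindex_bij_betw[OF permutes_imp_bij[OF t]])
      finally show ?thesis .
    qed
    ultimately show ?thesis by simp
  qed
  have inv: "p \<circ> ?t \<circ> ?t = p" for p :: "nat \<Rightarrow> nat" by (simp add: o_assoc[symmetric])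
  have bij: "bij_betw (\<lambda>p. p \<circ> ?t) {p. p permutes {..<n}} {p. p permutes {..<n}}"
    by (rule bij_betw_byWitness[where f' = "\<lambda>p. p \<circ> ?t"]) (auto simp: inv intro: permutes_compose[OF t])
  have "vol_form n \<zeta> us = (\<Sum>p | p permutes {..<n}. ?f (p \<circ> ?t))"
    unfolding vol_form_def using sum.reindex_bij_betw[OF bij, of ?f] by simp
  also have "\<dots> = - vol_form n \<zeta> us"
    unfolding vol_form_def sum_negf[symmetric] using f by (intro sum.cong) auto
  finally show "vol_form n \<zeta> us = 0" by (simp add: eq_neg_iff_add_eq_0)
next
  fix k assume k: "k < n"
  have pk: "p k < n" if "p permutes {..<n}" for p using permutes_in_image[OF that, of k] k by simp
  show "clinear_at n I (vol_form n \<zeta>) k"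
    unfolding clinear_at_def
  proof (intro allI impI)
    fix us :: "'e list" assume us: "length us = n"
    show "vol_form n \<zeta> (us[k := I (us ! k)]) = \<i> * vol_form n \<zeta> us"
      using vol_form_slot[OF us k, of \<zeta> "us ! k"]
      by (auto simp: vol_form_slot[OF us k] I pk sum_distrib_left intro!: sum.cong)
  qed
qed

lemma vol_form_basis:
  assumes "\<And>j k. j < n \<Longrightarrow> k < n \<Longrightarrow> \<zeta> j (e k) = of_bool (j = k)"
  shows "vol_form n \<zeta> (map e [0..<n]) = 1"
proof -
  have "(\<Prod>i<n. \<zeta> (p i) (map e [0..<n] ! i)) = of_bool (p = id)" if p: "p permutes {..<n}" for p
  proof -
    have pi: "p i < n" if "i < n" for i using permutes_in_image[OF p, of i] that by simp
    have "(\<Prod>i<n. \<zeta> (p i) (map e [0..<n] ! i)) = (\<Prod>i<n. of_bool (p i = i))"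
      using assms pi by (intro prod.cong) auto
    moreover have "p = id" if "\<forall>i<n. p i = i"
      using that p by (auto simp: permutes_def fun_eq_iff)
    then have "p \<noteq> id \<Longrightarrow> \<exists>i<n. p i \<noteq> i" by blast
    ultimately show ?thesis by (auto simp: prod_zero_iff)
  qed
  then have "vol_form n \<zeta> (map e [0..<n]) = (\<Sum>p | p permutes {..<n}. of_int (sign p) * of_bool (p = id))"
    unfolding vol_form_def by (intro sum.cong) auto
  also have "\<dots> = (\<Sum>p\<in>{id::nat \<Rightarrow> nat}. of_int (sign p) * of_bool (p = id))"
    by (rule sum.mono_neutral_right) (auto simp: finite_permutations permutes_id)
  finally show ?thesis by simp
qed

text \<open>The Leibniz rule, with the derivative falling on one slot at a time. With a moving
  coframe in the slots it yields the exterior derivative of the volume form.\<close>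

lemma vol_form_has_derivative:
  fixes \<zeta> :: "nat \<Rightarrow> 'e::euclidean_space \<Rightarrow> complex" and g :: "nat \<Rightarrow> 'd::euclidean_space \<Rightarrow> 'e"
  assumes lin: "\<And>j. j < n \<Longrightarrow> linear (\<zeta> j)"
    and g: "\<And>i. i < n \<Longrightarrow> (g i has_derivative g' i) (at x)"
  shows "((\<lambda>y. vol_form n \<zeta> (map (\<lambda>i. g i y) [0..<n])) has_derivative
    (\<lambda>u. \<Sum>j<n. vol_form n \<zeta> ((map (\<lambda>i. g i x) [0..<n])[j := g' j u]))) (at x)"
proof -
  have "((\<lambda>y. \<Prod>i<n. \<zeta> (p i) (g i y)) has_derivative
      (\<lambda>u. \<Sum>i<n. \<zeta> (p i) (g' i u) * (\<Prod>j\<in>{..<n} - {i}. \<zeta> (p j) (g j x)))) (at x)"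
    if p: "p permutes {..<n}" for p
  proof (rule has_derivative_prod)
    fix i assume i: "i \<in> {..<n}"
    then have "p i < n" using permutes_in_image[OF p, of i] by simp
    then have "bounded_linear (\<zeta> (p i))" using lin linear_conv_bounded_linear by blast
    then show "((\<lambda>y. \<zeta> (p i) (g i y)) has_derivative (\<lambda>u. \<zeta> (p i) (g' i u))) (at x)"
      using g i by (auto intro: bounded_linear.has_derivative)
  qed
  then have "((\<lambda>y. vol_form n \<zeta> (map (\<lambda>i. g i y) [0..<n])) has_derivative
      (\<lambda>u. \<Sum>p | p permutes {..<n}. of_int (sign p) *
        (\<Sum>i<n. \<zeta> (p i) (g' i u) * (\<Prod>j\<in>{..<n} - {i}. \<zeta> (p j) (g j x))))) (at x)"
    unfolding vol_form_def by (auto intro!: has_derivative_sum has_derivative_mult_right)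
  also have "(\<lambda>u. \<Sum>p | p permutes {..<n}. of_int (sign p) *
        (\<Sum>i<n. \<zeta> (p i) (g' i u) * (\<Prod>j\<in>{..<n} - {i}. \<zeta> (p j) (g j x)))) =
      (\<lambda>u. \<Sum>j<n. vol_form n \<zeta> ((map (\<lambda>i. g i x) [0..<n])[j := g' j u]))"
  proof
    fix u
    have eq: "(\<Prod>j\<in>{..<n} - {i}. \<zeta> (p j) (g j x)) = (\<Prod>j\<in>{..<n} - {i}. \<zeta> (p j) (map (\<lambda>i. g i x) [0..<n] ! j))"
      for i and p :: "nat \<Rightarrow> nat"
      by (rule prod.cong) auto
    show "(\<Sum>p | p permutes {..<n}. of_int (sign p) *
        (\<Sum>i<n. \<zeta> (p i) (g' i u) * (\<Prod>j\<in>{..<n} - {i}. \<zeta> (p j) (g j x)))) =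
      (\<Sum>j<n. vol_form n \<zeta> ((map (\<lambda>i. g i x) [0..<n])[j := g' j u]))"
      unfolding sum_distrib_left eq by (subst sum.swap) (auto simp: vol_form_slot intro!: sum.cong)
  qed
  finally show ?thesis .
qed

lemma alternating_form_permute:
  assumes alt: "alternating_form n \<omega>" and z: "\<omega> (map e [0..<n]) = 0" and p: "p permutes {..<n}"
  shows "\<omega> (map (\<lambda>i. e (p i)) [0..<n]) = 0"
  using p finite_lessThan
proof (induction rule: permutes_induct)
  case id
  then show ?case using z by simp
next
  case (swap a b p)
  let ?us = "map (\<lambda>i. e (p i)) [0..<n]"
  obtain i j where ij: "i < n" "p i = a" "j < n" "p j = b"
    using swap.hyps(1,2) permutes_image[OF swap.hyps(4)] by (metis imageE lessThan_iff)
  then have "i \<noteq> j" using swap by auto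
  have pinj: "p k = p l \<longleftrightarrow> k = l" for k l using permutes_inj[OF swap.hyps(4)] by (auto simp: inj_def)
  have "map (\<lambda>i. e ((Transposition.transpose a b \<circ> p) i)) [0..<n] = ?us[i := e b, j := e a]"
    by (rule nth_equalityI)
      (use ij \<open>i \<noteq> j\<close> in \<open>auto simp: nth_list_update Transposition.transpose_def pinj\<close>)
  also have "\<omega> \<dots> = - \<omega> (?us[i := e a, j := e b])"
    by (rule alternating_form_swap[OF alt]) (use ij \<open>i \<noteq> j\<close> in auto)
  also have "?us[i := e a, j := e b] = ?us"
    by (rule nth_equalityI) (use ij \<open>i \<noteq> j\<close> in \<open>auto simp: nth_list_update\<close>)
  finally show ?case using swap by simp
qed

text \<open>By complex linearity an entry \<open>I (e j)\<close> counts as \<open>\<i>\<close> times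
  \<open>e j\<close>, so the \<open>n\<close> vectors \<open>e j\<close> suffice instead of a real
  basis of twice that size. Hence (n,0)-forms are determined by one value and make up a complex
  line.\<close>

lemma cform_eq_zero:
  fixes I :: "'e::euclidean_space \<Rightarrow> 'e"
  assumes \<omega>: "cform n I \<omega>" and z: "\<omega> (map e [0..<n]) = 0"
    and basis: "\<And>u. u = (\<Sum>j<n. Re (\<zeta> j u) *\<^sub>R e j + Im (\<zeta> j u) *\<^sub>R I (e j))"
    and us: "length us = n"
  shows "\<omega> us = 0"
proof -
  have alt: "alternating_form n \<omega>" using \<omega> by (simp add: cform_def)
  \<comment> \<open>The first \<open>m\<close> slots hold arbitrary vectors, the others already hold
    basis vectors. For \<open>m = 0\<close> the list either repeats a basis vector or is a
    permutation of the basis.\<close>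
  have "\<omega> us = 0" if "m \<le> n" "length us = n" "\<forall>i. m \<le> i \<and> i < n \<longrightarrow> us ! i \<in> e ` {..<n}" for m us
    using that
  proof (induction m arbitrary: us)
    case 0
    then have "\<exists>f. \<forall>i<n. f i < n \<and> us ! i = e (f i)" by (intro choice) (metis imageE le0 lessThan_iff)
    then obtain f where f: "\<And>i. i < n \<Longrightarrow> f i < n \<and> us ! i = e (f i)" by blast
    show ?case
    proof (cases "inj_on f {..<n}")
      case True
      define p where "p i = (if i < n then f i else i)" for i
      have "p ` {..<n} \<subseteq> {..<n}" using f by (auto simp: p_def)
      moreover have ip: "inj_on p {..<n}" using True by (auto simp: p_def inj_on_def)
      ultimately have "bij_betw p {..<n} {..<n}"
        by (metis bij_betw_def endo_inj_surj finite_lessThan)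
      then have "p permutes {..<n}" by (rule bij_imp_permutes) (simp add: p_def)
      moreover have "us = map (\<lambda>i. e (p i)) [0..<n]"
        by (rule nth_equalityI) (use 0 f in \<open>auto simp: p_def\<close>)
      ultimately show ?thesis using alternating_form_permute[OF alt z] by simp
    next
      case False
      then obtain i j where "i < n" "j < n" "i \<noteq> j" "f i = f j" by (auto simp: inj_on_def)
      then show ?thesis using f alternating_formD(2)[OF alt, of us i j] 0 by metis
    qed
  next
    case (Suc m)
    let ?u = "us ! m"
    have lin: "linear (\<lambda>u. \<omega> (us[m := u]))" using alternating_formD(1)[OF alt] Suc.prems by simp
    have "\<omega> us = \<omega> (us[m := \<Sum>j<n. Re (\<zeta> j ?u) *\<^sub>R e j + Im (\<zeta> j ?u) *\<^sub>R I (e j)])"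
      using basis[of ?u] by simp
    also have "\<dots> = (\<Sum>j<n. \<omega> (us[m := Re (\<zeta> j ?u) *\<^sub>R e j + Im (\<zeta> j ?u) *\<^sub>R I (e j)]))"
      by (rule linear_sum[OF lin])
    also have "\<dots> = (\<Sum>j<n. \<zeta> j ?u * \<omega> (us[m := e j]))"
      using Suc.prems by (intro sum.cong) (auto simp: cform_scale_slot[OF \<omega>])
    also have "\<dots> = 0"
    proof (intro sum.neutral ballI)
      fix j assume "j \<in> {..<n}"
      then have "\<omega> (us[m := e j]) = 0"
        using Suc.prems by (intro Suc.IH) (auto simp: nth_list_update)
      then show "\<zeta> j ?u * \<omega> (us[m := e j]) = 0" by simp
    qed
    finally show ?case .
  qed
  then show ?thesis using us by (metis le_refl not_le)
qed

lemma exists_volume_form: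
  fixes I :: "'e::euclidean_space \<Rightarrow> 'e"
  assumes I: "linear I" "\<And>a. I (I a) = - a" and n: "DIM('e) = 2 * n"
  obtains \<zeta> :: "nat \<Rightarrow> 'e \<Rightarrow> complex" and es
  where "\<And>j. j < n \<Longrightarrow> linear (\<zeta> j)" "cform n I (vol_form n \<zeta>)" "length es = n" "vol_form n \<zeta> es = 1"
    "\<And>\<omega>. cform n I \<omega> \<Longrightarrow> \<exists>z. \<forall>us. length us = n \<longrightarrow> \<omega> us = z * vol_form n \<zeta> us"
proof (rule exists_complex_coordinates[OF I n])
  fix e \<zeta>
  assume z: "\<And>j. j < n \<Longrightarrow> linear (\<zeta> j)" "\<And>j u. j < n \<Longrightarrow> \<zeta> j (I u) = \<i> * \<zeta> j u"
    "\<And>j k. j < n \<Longrightarrow> k < n \<Longrightarrow> \<zeta> j (e k) = of_bool (j = k)"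
    "\<And>u. u = (\<Sum>j<n. Re (\<zeta> j u) *\<^sub>R e j + Im (\<zeta> j u) *\<^sub>R I (e j))"
  let ?v = "vol_form n \<zeta>" and ?es = "map e [0..<n]"
  have v: "cform n I ?v" using cform_vol_form[of n \<zeta> I] z by blast
  have v1: "?v ?es = 1" using vol_form_basis[of n \<zeta> e] z(3) by blast
  have "\<exists>z. \<forall>us. length us = n \<longrightarrow> \<omega> us = z * ?v us" if \<omega>: "cform n I \<omega>" for \<omega>
  proof (intro exI allI impI)
    fix us :: "'e list" assume us: "length us = n"
    \<comment> \<open>Subtracting the right multiple of the volume form makes the value on the basis
      vanish.\<close>
    have "cform n I (\<lambda>us. \<omega> us + (- \<omega> ?es) * ?v us)" by (rule cform_lincomb[OF \<omega> v])
    from cform_eq_zero[OF this _ z(4) us] show "\<omega> us = \<omega> ?es * ?v us"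
      using v1 by simp
  qed
  then show thesis using that[of \<zeta> ?es] z(1) v v1 by simp
qed


subsection \<open>Derivations of the volume form\<close>

text \<open>If the entries \<open>i\<close> and \<open>j\<close> agree, all terms vanish except
  those that change \<open>i\<close> or \<open>j\<close>, and these two cancel by antisymmetry.
  Commuting with \<open>I\<close> is what preserves complex linearity in the slot that
  \<open>T\<close> hits.\<close>

lemma cform_derivation:
  fixes T :: "'e::euclidean_space \<Rightarrow> 'e"
  assumes \<omega>: "cform n I \<omega>" and T: "linear T" "\<And>a. T (I a) = I (T a)"
  shows "cform n I (\<lambda>us. \<Sum>j<n. \<omega> (us[j := T (us ! j)]))"
proof -
  let ?D = "\<lambda>us. \<Sum>j<n. \<omega> (us[j := T (us ! j)])"
  have alt: "alternating_form n \<omega>" using \<omega> by (simp add: cform_def)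
  have "linear (\<lambda>u. ?D (us[i := u]))" if us: "length us = n" "i < n" for us i
  proof (rule linear_compose_sum, intro ballI)
    fix j assume j: "j \<in> {..<n}"
    show "linear (\<lambda>u. \<omega> (us[i := u, j := T (us[i := u] ! j)]))"
    proof (cases "i = j")
      case True
      then show ?thesis
        using linear_compose[OF T(1) alternating_formD(1)[OF alt us]] us by (simp add: o_def)
    next
      case False
      then have "us[i := u, j := T (us[i := u] ! j)] = us[j := T (us ! j), i := u]" for u
        by (simp add: list_update_swap)
      then show ?thesis using alternating_formD(1)[OF alt, of "us[j := T (us ! j)]" i] us by simp
    qed
  qed
  moreover have "?D us = 0" if us: "length us = n" "i < j" "j < n" "us ! i = us ! j" for us i j
  proof -
    have "?D us = (\<Sum>k\<in>{i, j}. \<omega> (us[k := T (us ! k)]))"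
    proof (rule sum.mono_neutral_right)
      show "\<forall>k\<in>{..<n} - {i, j}. \<omega> (us[k := T (us ! k)]) = 0"
        using us alternating_formD(2)[OF alt, of "us[k := T (us ! k)]" i j for k] by auto
    qed (use us in auto)
    also have "\<dots> = \<omega> (us[i := T (us ! i)]) + \<omega> (us[j := T (us ! j)])" using us by simp
    also have "\<dots> = 0"
    proof -
      let ?a = "us ! i" and ?b = "T (us ! i)"
      have "us[i := ?b] = us[i := ?b, j := ?a]" "us[j := T (us ! j)] = us[i := ?a, j := ?b]"
        using us by (simp_all add: list_update_swap[of i j])
          (metis list_update_id list_update_swap less_imp_neq)+
      then show ?thesis using alternating_form_swap[OF alt us(1), of i j ?b ?a] us by simp
    qed
    finally show ?thesis .
  qed
  ultimately have "alternating_form n ?D" unfolding alternating_form_def by blast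
  moreover have "clinear_at n I ?D k" if k: "k < n" for k
    unfolding clinear_at_def sum_distrib_left
  proof (intro allI impI sum.cong refl)
    fix us :: "'e list" and j assume us: "length us = n" and j: "j \<in> {..<n}"
    have ck: "clinear_at n I \<omega> k" using \<omega> k by (simp add: cform_def)
    show "\<omega> (us[k := I (us ! k), j := T (us[k := I (us ! k)] ! j)]) = \<i> * \<omega> (us[j := T (us ! j)])"
    proof (cases "k = j")
      case True
      then show ?thesis using clinear_at_update[OF ck us k] us k T by simp
    next
      case False
      then have "us[k := I (us ! k), j := T (us[k := I (us ! k)] ! j)] = us[j := T (us ! j), k := I (us ! k)]"
        by (simp add: list_update_swap)
      then show ?thesis using clinear_atD[OF ck, of "us[j := T (us ! j)]"] us False by simp
    qed
  qed
  ultimately show ?thesis unfolding cform_def by blast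
qed

text \<open>The derivation multiplies \<open>\<omega>\<close> by a scalar \<open>t\<close>, and enough applications of it kill \<open>\<omega>\<close>;
  hence \<open>t = 0\<close>.  This replaces the vanishing of the complex trace of \<open>T\<close>.\<close>

lemma nilpotent_derivation_eq_zero:
  fixes T :: "'e::euclidean_space \<Rightarrow> 'e"
  assumes \<omega>: "cform n I \<omega>" and T: "linear T" "\<And>a. T (I a) = I (T a)" "\<And>a. (T ^^ N) a = 0"
    and uniq: "\<And>\<omega>'. cform n I \<omega>' \<Longrightarrow> \<exists>z. \<forall>us. length us = n \<longrightarrow> \<omega>' us = z * \<omega> us"
    and us: "length us = n"
  shows "(\<Sum>j<n. \<omega> (us[j := T (us ! j)])) = 0"
proof -
  have alt: "alternating_form n \<omega>" using \<omega> by (simp add: cform_def)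
  obtain t where t: "\<And>us. length us = n \<Longrightarrow> (\<Sum>j<n. \<omega> (us[j := T (us ! j)])) = t * \<omega> us"
    using uniq[OF cform_derivation[OF \<omega> T(1,2)]] by auto
  \<comment> \<open>\<open>r j\<close> is a power of \<open>T\<close> that kills the entry
    \<open>j\<close>. Each term of the derivation lowers one \<open>r j\<close> by one or vanishes,
    so their sum bounds how often the derivation can be applied. The start is \<open>r j = N\<close>
    throughout, with sum \<open>n * N\<close>.\<close>
  have "t ^ Suc m * \<omega> us = 0"
    if "length us = n" "\<And>j. j < n \<Longrightarrow> (T ^^ r j) (us ! j) = 0" "(\<Sum>j<n. r j) \<le> m" for m r us
    using that
  proof (induction m arbitrary: us r)
    case 0
    have "\<omega> (us[j := T (us ! j)]) = 0" if "j < n" for j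
    proof -
      have "us ! j = 0" using 0(2)[OF that] 0(3) that by auto
      then show ?thesis using alternating_form_zero[OF alt, of us j] 0(1) that
        by (metis T(1) linear_0 list_update_id)
    qed
    then show ?case using t[OF 0(1)] by simp
  next
    case (Suc m)
    have *: "t ^ Suc m * \<omega> (us[j := T (us ! j)]) = 0" if j: "j < n" for j
    proof (cases "r j")
      case 0
      then have "us ! j = 0" using Suc.prems(2)[OF j] by simp
      then have "\<omega> (us[j := T (us ! j)]) = 0"
        using alternating_form_zero[OF alt, of us j] Suc.prems(1) j by (metis T(1) linear_0 list_update_id)
      then show ?thesis by simp
    next
      case (Suc r')
      let ?r = "r(j := r')"
      have "(T ^^ ?r i) (us[j := T (us ! j)] ! i) = 0" if "i < n" for i
        using Suc.prems(2)[OF that] Suc Suc.prems(1) j by (cases "i = j") (auto simp: funpow_swap1)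
      moreover have "sum ?r {..<n} < sum r {..<n}"
        by (rule sum_strict_mono_ex1) (use Suc j in \<open>auto intro!: bexI[of _ j]\<close>)
      ultimately show ?thesis
        using Suc.prems(1,3) by (intro Suc.IH[of _ ?r]) auto
    qed
    have "t ^ Suc (Suc m) * \<omega> us = t ^ Suc m * (\<Sum>j<n. \<omega> (us[j := T (us ! j)]))"
      unfolding t[OF Suc.prems(1)] by simp
    also have "\<dots> = (\<Sum>j<n. t ^ Suc m * \<omega> (us[j := T (us ! j)]))" by (rule sum_distrib_left)
    also have "\<dots> = 0" using * by (intro sum.neutral) auto
    finally show ?case .
  qed
  from this[of us "\<lambda>_. N" "n * N"] have "t = 0 \<or> \<omega> us = 0" using us T(3) by auto
  then show ?thesis using t[OF us] by auto
qed

subsection \<open>The Chevalley-Eilenberg differential of the volume form\<close>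

definition omit :: "nat \<Rightarrow> 'a list \<Rightarrow> 'a list" where
  "omit i us = take i us @ drop (Suc i) us"

text \<open>The position in \<open>omit i us\<close> of the entry that stood at \<open>k\<close> in
  \<open>us\<close>; meaningful for \<open>k\<close> different from \<open>i\<close>.\<close>

definition slot :: "nat \<Rightarrow> nat \<Rightarrow> nat" where
  "slot i k = (if k < i then k else k - 1)"

lemma length_omit: "i < length us \<Longrightarrow> length (omit i us) = length us - 1"
  by (auto simp: omit_def)

lemma nth_omit: "i < length us \<Longrightarrow> j < length us - 1 \<Longrightarrow> omit i us ! j = us ! (if j < i then j else Suc j)"
  by (auto simp: omit_def nth_append)

lemma nth_omit_slot: "i < length us \<Longrightarrow> k < length us \<Longrightarrow> k \<noteq> i \<Longrightarrow> omit i us ! slot i k = us ! k"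
  by (subst nth_omit) (auto simp: slot_def)

lemma omit_map: "omit i (map f us) = map f (omit i us)"
  by (simp add: omit_def take_map drop_map)

lemma omit_update_same: "omit i (us[i := a]) = omit i us"
  by (simp add: omit_def)

lemma omit_update: "i < length us \<Longrightarrow> k < length us \<Longrightarrow> k \<noteq> i \<Longrightarrow> omit i (us[k := a]) = (omit i us)[slot i k := a]"
  by (rule nth_equalityI) (auto simp: length_omit nth_omit nth_list_update slot_def)

lemma sum_omit:
  fixes f :: "nat \<Rightarrow> 'a::comm_monoid_add"
  assumes "i < Suc n"
  shows "(\<Sum>j<n. f (if j < i then j else Suc j)) = (\<Sum>k\<in>{..<Suc n} - {i}. f k)"
  by (rule sum.reindex_bij_witness[where j = "\<lambda>j. if j < i then j else Suc j" and i = "slot i"])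
    (use assms in \<open>auto simp: slot_def split: if_splits\<close>)

text \<open>One list drops the entry \<open>i\<close> and has \<open>w\<close> in the place of
  \<open>k\<close>, the other drops \<open>k\<close> and has \<open>w\<close> in the place of
  \<open>i\<close>. They differ only by moving \<open>w\<close> past the \<open>k - i - 1\<close>
  entries in between.\<close>

lemma alternating_form_omit_less:
  assumes alt: "alternating_form n \<omega>" and us: "length us = Suc n" and ik: "i < k" "k < Suc n"
  shows "\<omega> ((omit i us)[slot i k := w]) = (-1) ^ (k - i - 1) * \<omega> ((omit k us)[slot k i := w])"
proof -
  let ?pre = "take i us" and ?blk = "take (k - i - 1) (drop (Suc i) us)" and ?post = "drop (Suc k) us"
  have 1: "(omit i us)[slot i k := w] = ?pre @ ?blk @ w # ?post"
    by (rule nth_equalityI)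
      (use us ik in \<open>auto simp: length_omit nth_omit nth_list_update slot_def nth_append nth_Cons'\<close>)
  have 2: "(omit k us)[slot k i := w] = ?pre @ w # ?blk @ ?post"
    by (rule nth_equalityI)
      (use us ik in \<open>auto simp: length_omit nth_omit nth_list_update slot_def nth_append nth_Cons'\<close>)
  show ?thesis unfolding 1 2
    using alternating_form_move[OF alt, of ?pre ?blk ?post w] us ik by simp
qed

text \<open>With the signs of the exterior derivative the two values become opposite. This is why
  the terms for \<open>(k, i)\<close> and \<open>(i, k)\<close> combine to the antisymmetrisation of
  \<open>C\<close>, which is the bracket.\<close>

lemma alternating_form_omit:
  assumes alt: "alternating_form n \<omega>" and us: "length us = Suc n"
    and ik: "i < Suc n" "k < Suc n" "i \<noteq> k"
  shows "(-1) ^ i * \<omega> ((omit i us)[slot i k := w]) = - ((-1) ^ k * \<omega> ((omit k us)[slot k i := w]))"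
proof -
  have *: "(-1) ^ i * \<omega> ((omit i us)[slot i k := w]) = - ((-1) ^ k * \<omega> ((omit k us)[slot k i := w]))"
    if ik': "i < k" "k < Suc n" for i k
  proof -
    obtain d where d: "k = Suc (i + d)" using less_imp_Suc_add[OF ik'(1)] by blast
    have "(-1 :: complex) ^ i * (-1) ^ (k - i - 1) = - ((-1) ^ k)"
      unfolding d by (simp add: power_add)
    then show ?thesis
      unfolding alternating_form_omit_less[OF alt us ik'] by (simp add: mult.assoc[symmetric])
  qed
  show ?thesis using *[of i k] *[of k i] ik by (cases "i < k") auto
qed

text \<open>\<open>?ad\<close> is the adjoint action of \<open>a + i (I a)\<close> on the
  complexification, where the pair \<open>(v, w)\<close> means \<open>v + i w\<close>, and
  \<open>?p\<close> is the projection modulo the (0,1)-vectors. \<open>T a\<close> is the induced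
  action, so it inherits nilpotency from \<open>?ad\<close>.\<close>

lemma nilpotent_twisted_adjoint:
  fixes I :: "'e::euclidean_space \<Rightarrow> 'e" and br :: "'e \<Rightarrow> 'e \<Rightarrow> 'e"
  assumes I: "linear I" "\<And>a. I (I a) = - a"
    and br: "\<And>a. linear (br a)"
    and int: "\<And>a b. I (br a b - br (I a) (I b)) = br a (I b) + br (I a) b"
    and nil: "\<And>as b. length as = N \<Longrightarrow> foldr br as b = 0"
  defines "T \<equiv> \<lambda>a b. br a b + I (br (I a) b)"
  shows "(T a ^^ N) b = 0" and "T a (I b) = I (T a b)"
proof -
  let ?p = "\<lambda>w. fst w + I (snd w)"
  let ?ad = "\<lambda>w. (br a (fst w) - br (I a) (snd w), br a (snd w) + br (I a) (fst w))"
  note lin = I(1)[THEN linear_add] I(1)[THEN linear_diff] I(1)[THEN linear_neg]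
    br[THEN linear_add] br[THEN linear_diff] br[THEN linear_neg]
  \<comment> \<open>Integrability enters here: the action descends along \<open>?p\<close> because
    the (0,1)-vectors are closed under the bracket.\<close>
  have p: "?p (?ad w) = T a (?p w)" for w
    using int[of a "snd w"] by (simp add: T_def lin algebra_simps)
  have pm: "?p ((?ad ^^ m) w) = (T a ^^ m) (?p w)" for m w
    by (induction m) (use p in auto)
  \<comment> \<open>The span of the \<open>m\<close>-fold iterated brackets. Both components of
    \<open>?ad ^^ m\<close> lie in it, although the factors \<open>br a\<close> and
    \<open>br (I a)\<close> are mixed in all possible orders.\<close>
  define L where "L m = span {foldr br as v |as v. length as = m}" for m
  have L: "br c v \<in> L (Suc m)" if "v \<in> L m" for c v m
  proof -
    have "br c ` {foldr br as v |as v. length as = m} \<subseteq> {foldr br as v |as v. length as = Suc m}"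
    proof
      fix x assume "x \<in> br c ` {foldr br as v |as v. length as = m}"
      then obtain as v where "length as = m" "x = br c (foldr br as v)" by blast
      then have "length (c # as) = Suc m" "x = foldr br (c # as) v" by simp_all
      then show "x \<in> {foldr br as v |as v. length as = Suc m}" by blast
    qed
    then show ?thesis
      using that linear_span_image[OF br[of c]] span_mono unfolding L_def by blast
  qed
  have ad: "fst ((?ad ^^ m) w) \<in> L m \<and> snd ((?ad ^^ m) w) \<in> L m" for m w
  proof (induction m)
    case 0
    have "v \<in> L 0" for v unfolding L_def by (rule span_base) auto
    then show ?case by blast
  next
    case (Suc m)
    then have "br c (fst ((?ad ^^ m) w)) \<in> L (Suc m)" "br c (snd ((?ad ^^ m) w)) \<in> L (Suc m)" for c
      using L by blast+
    then show ?case
      unfolding funpow.simps o_apply fst_conv snd_conv by (auto simp: L_def intro: span_add span_diff)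
  qed
  have "{foldr br as v |as v. length as = N} \<subseteq> {0}" using nil by blast
  then have "L N \<subseteq> {0}" unfolding L_def by (rule span_minimal) (rule subspace_single_0)
  then have "(?ad ^^ N) w = 0" for w using ad[of N w] by (auto simp: prod_eq_iff)
  then have "?p ((?ad ^^ N) (b, 0)) = 0" by (simp add: linear_0[OF I(1)])
  then show "(T a ^^ N) b = 0" unfolding pm by (simp add: linear_0[OF I(1)])
  show "T a (I b) = I (T a b)"
    using int[of a b] by (simp add: T_def lin I(2) algebra_simps)
qed

text \<open>The sum is, up to sign, the exterior derivative of the volume form in frame coordinates,
  with \<open>C a b\<close> the derivative of the invariant field \<open>b\<close> along
  \<open>a\<close>. \<open>C\<close> itself need not respect \<open>I\<close>. In the terms that
  involve the slot \<open>k\<close>, however, only its antisymmetrisation \<open>br\<close>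
  survives, and they add up to the derivation by \<open>br (us ! k)\<close>.\<close>

lemma clinear_at_chevalley_eilenberg:
  fixes I :: "'e::euclidean_space \<Rightarrow> 'e" and br C :: "'e \<Rightarrow> 'e \<Rightarrow> 'e"
  assumes \<omega>: "cform n I \<omega>"
    and uniq: "\<And>\<omega>'. cform n I \<omega>' \<Longrightarrow> \<exists>z. \<forall>us. length us = n \<longrightarrow> \<omega>' us = z * \<omega> us"
    and I: "linear I" "\<And>a. I (I a) = - a"
    and C: "\<And>a b. br a b = C a b - C b a" "\<And>a. linear (br a)"
    and int: "\<And>a b. I (br a b - br (I a) (I b)) = br a (I b) + br (I a) b"
    and nil: "\<And>as b. length as = N \<Longrightarrow> foldr br as b = 0"
    and k: "k < Suc n"
  shows "clinear_at (Suc n) I (\<lambda>us. \<Sum>i<Suc n. (-1) ^ i *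
    (\<Sum>j<n. \<omega> ((omit i us)[j := C (us ! i) (omit i us ! j)]))) k"
proof -
  have alt: "alternating_form n \<omega>" using \<omega> by (simp add: cform_def)
  define s where "s us i l = (-1) ^ i * \<omega> ((omit i us)[slot i l := C (us ! i) (us ! l)])" for us i l
  define \<delta> where "\<delta> bs a = (\<Sum>j<n. \<omega> (bs[j := br a (bs ! j)]))" for bs a
  define R where "R us = (\<Sum>i\<in>{..<Suc n} - {k}. \<Sum>l\<in>{..<Suc n} - {i} - {k}. s us i l)" for us
  \<comment> \<open>The derivation by \<open>?T\<close> annihilates the volume form. As
    \<open>I\<close> leaves a slot as a factor \<open>\<i>\<close>, this reads
    \<open>\<delta> bs a + \<i> * \<delta> bs (I a) = 0\<close>.\<close>
  have \<delta>: "\<delta> bs (I a) = \<i> * \<delta> bs a" if bs: "length bs = n" for bs a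
  proof -
    let ?T = "\<lambda>b. br a b + I (br (I a) b)"
    have "linear ?T"
      using linear_compose[OF C(2) I(1)] by (auto intro!: linear_compose_add C(2) simp: o_def)
    then have "(\<Sum>j<n. \<omega> (bs[j := ?T (bs ! j)])) = 0"
      using nilpotent_twisted_adjoint[OF I C(2) int nil] uniq bs
      by (intro nilpotent_derivation_eq_zero[OF \<omega>]) auto
    also have "(\<Sum>j<n. \<omega> (bs[j := ?T (bs ! j)])) = (\<Sum>j<n. \<omega> (bs[j := br a (bs ! j)]) + \<i> * \<omega> (bs[j := br (I a) (bs ! j)]))"
    proof (rule sum.cong[OF refl])
      fix j assume "j \<in> {..<n}"
      then have j: "j < n" by simp
      show "\<omega> (bs[j := ?T (bs ! j)]) = \<omega> (bs[j := br a (bs ! j)]) + \<i> * \<omega> (bs[j := br (I a) (bs ! j)])"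
        using linear_add[OF alternating_formD(1)[OF alt bs j]] clinear_at_update[OF _ bs j] \<omega> j
        unfolding cform_def by metis
    qed
    finally have "\<delta> bs a + \<i> * \<delta> bs (I a) = 0"
      unfolding \<delta>_def by (simp add: sum.distrib sum_distrib_left)
    then have "\<i> * (\<delta> bs a + \<i> * \<delta> bs (I a)) = 0" by simp
    then show ?thesis by (simp add: distrib_left mult.assoc[symmetric])
  qed
  have main: "(\<Sum>i<Suc n. (-1) ^ i * (\<Sum>j<n. \<omega> ((omit i us)[j := C (us ! i) (omit i us ! j)]))) =
      R us + (-1) ^ k * \<delta> (omit k us) (us ! k)" if us: "length us = Suc n" for us
  proof -
    have row: "(-1) ^ i * (\<Sum>j<n. \<omega> ((omit i us)[j := D (omit i us ! j)])) =
        (\<Sum>l\<in>{..<Suc n} - {i}. (-1) ^ i * \<omega> ((omit i us)[slot i l := D (us ! l)]))"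
      if "i < Suc n" for i and D :: "'e \<Rightarrow> 'e"
      unfolding sum_omit[OF that, symmetric] sum_distrib_left
      by (rule sum.cong) (use us that in \<open>auto simp: nth_omit slot_def\<close>)
    have "(\<Sum>i<Suc n. (-1) ^ i * (\<Sum>j<n. \<omega> ((omit i us)[j := C (us ! i) (omit i us ! j)]))) =
        (\<Sum>i<Suc n. \<Sum>l\<in>{..<Suc n} - {i}. s us i l)"
      using row by (intro sum.cong) (auto simp: s_def)
    also have "\<dots> = (\<Sum>l\<in>{..<Suc n} - {k}. s us k l) + (\<Sum>i\<in>{..<Suc n} - {k}. \<Sum>l\<in>{..<Suc n} - {i}. s us i l)"
      using k by (subst sum.remove[of _ k]) auto
    also have "(\<Sum>i\<in>{..<Suc n} - {k}. \<Sum>l\<in>{..<Suc n} - {i}. s us i l) =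
        (\<Sum>i\<in>{..<Suc n} - {k}. s us i k + (\<Sum>l\<in>{..<Suc n} - {i} - {k}. s us i l))"
      using k by (intro sum.cong refl) (subst sum.remove[of _ k], auto)
    also have "(\<Sum>l\<in>{..<Suc n} - {k}. s us k l) +
        (\<Sum>i\<in>{..<Suc n} - {k}. s us i k + (\<Sum>l\<in>{..<Suc n} - {i} - {k}. s us i l)) =
        R us + (\<Sum>i\<in>{..<Suc n} - {k}. s us k i + s us i k)"
      unfolding R_def by (simp add: sum.distrib algebra_simps)
    \<comment> \<open>The term that omits \<open>k\<close> and the one that omits \<open>i\<close>
      carry opposite signs on the same list, so the values of \<open>C\<close> are
      subtracted.\<close>
    also have "(\<Sum>i\<in>{..<Suc n} - {k}. s us k i + s us i k) =
        (\<Sum>i\<in>{..<Suc n} - {k}. (-1) ^ k * \<omega> ((omit k us)[slot k i := br (us ! k) (us ! i)]))"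
    proof (rule sum.cong[OF refl])
      fix i assume "i \<in> {..<Suc n} - {k}"
      then have i: "i < Suc n" "i \<noteq> k" by auto
      have sl: "slot k i < n" using i k by (auto simp: slot_def)
      have lin: "linear (\<lambda>u. \<omega> ((omit k us)[slot k i := u]))"
        by (rule alternating_formD(1)[OF alt _ sl]) (use us k in \<open>simp add: length_omit\<close>)
      have "s us i k = - ((-1) ^ k * \<omega> ((omit k us)[slot k i := C (us ! i) (us ! k)]))"
        unfolding s_def by (rule alternating_form_omit[OF alt us i(1) k i(2)])
      then show "s us k i + s us i k = (-1) ^ k * \<omega> ((omit k us)[slot k i := br (us ! k) (us ! i)])"
        unfolding C(1) linear_diff[OF lin] by (simp add: s_def right_diff_distrib)
    qed
    also have "\<dots> = (-1) ^ k * \<delta> (omit k us) (us ! k)"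
      unfolding \<delta>_def using row[OF k, of "br (us ! k)"] by simp
    finally show ?thesis .
  qed
  \<comment> \<open>In these terms \<open>us ! k\<close> is a plain argument of the volume form and
    is not touched by \<open>C\<close>.\<close>
  have R: "R (us[k := I (us ! k)]) = \<i> * R us" if us: "length us = Suc n" for us
    unfolding R_def sum_distrib_left
  proof (intro sum.cong refl)
    fix i l assume "i \<in> {..<Suc n} - {k}" "l \<in> {..<Suc n} - {i} - {k}"
    then have il: "i < Suc n" "i \<noteq> k" "l < Suc n" "l \<noteq> i" "l \<noteq> k" by auto
    have sl: "slot i k < n" "slot i l \<noteq> slot i k" using il k by (auto simp: slot_def split: if_splits)
    have len: "length (omit i us) = n" using us il by (simp add: length_omit)
    let ?bs = "(omit i us)[slot i l := C (us ! i) (us ! l)]"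
    have "?bs ! slot i k = us ! k" using sl len us il k by (simp add: nth_omit_slot)
    then have "\<omega> (?bs[slot i k := I (us ! k)]) = \<i> * \<omega> ?bs"
      using clinear_atD[of n I \<omega> "slot i k" ?bs] \<omega> sl(1) len by (simp add: cform_def)
    then show "s (us[k := I (us ! k)]) i l = \<i> * s us i l"
      unfolding s_def using il us k sl(2) by (simp add: omit_update list_update_swap)
  qed
  show ?thesis
    unfolding clinear_at_def
  proof (intro allI impI)
    fix us :: "'e list" assume us: "length us = Suc n"
    have len: "length (omit k us) = n" using us k by (simp add: length_omit)
    have 1: "length (us[k := I (us ! k)]) = Suc n" using us by simp
    show "(\<Sum>i<Suc n. (-1) ^ i * (\<Sum>j<n. \<omega> ((omit i (us[k := I (us ! k)]))[j :=
          C (us[k := I (us ! k)] ! i) (omit i (us[k := I (us ! k)]) ! j)]))) =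
        \<i> * (\<Sum>i<Suc n. (-1) ^ i * (\<Sum>j<n. \<omega> ((omit i us)[j := C (us ! i) (omit i us ! j)])))"
      unfolding main[OF 1] main[OF us] R[OF us] using us k \<delta>[OF len]
      by (simp add: omit_update_same distrib_left)
  qed
qed

section \<open>Manifolds with a left-invariant frame\<close>

text \<open>The product rule for a linear map and a vector that both vary. The derivative of the map
  is known only on each fixed vector, so the varying vector is expanded in the basis.\<close>

lemma has_derivative_linear_family:
  fixes A :: "'d::euclidean_space \<Rightarrow> 'e::euclidean_space \<Rightarrow> 'f::euclidean_space"
  assumes T: "open T" "x \<in> T" "\<And>y. y \<in> T \<Longrightarrow> linear (A y)"
    and A: "\<And>v. ((\<lambda>y. A y v) has_derivative (\<lambda>u. A' u v)) (at x)"
    and w: "(w has_derivative w') (at x)"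
  shows "((\<lambda>y. A y (w y)) has_derivative (\<lambda>u. A' u (w x) + A x (w' u))) (at x)"
proof -
  have exp: "A y v = (\<Sum>i\<in>Basis. (v \<bullet> i) *\<^sub>R A y i)" if "y \<in> T" for y v
    by (subst euclidean_representation[of v, symmetric])
      (simp add: linear_sum[OF T(3)[OF that]] linear_scale[OF T(3)[OF that]] del: euclidean_representation)
  have gen: "((\<lambda>y. A y (w y)) has_derivative
      (\<lambda>u. \<Sum>i\<in>Basis. (w x \<bullet> i) *\<^sub>R A' u i + (w' u \<bullet> i) *\<^sub>R A x i)) (at x)"
    if w: "(w has_derivative w') (at x)" for w w'
  proof (rule has_derivative_transform_within_open[OF _ T(1,2)])
    show "((\<lambda>y. \<Sum>i\<in>Basis. (w y \<bullet> i) *\<^sub>R A y i) has_derivative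
        (\<lambda>u. \<Sum>i\<in>Basis. (w x \<bullet> i) *\<^sub>R A' u i + (w' u \<bullet> i) *\<^sub>R A x i)) (at x)"
      by (intro has_derivative_sum has_derivative_scaleR has_derivative_inner_left w A)
  qed (rule exp[symmetric])
  \<comment> \<open>Linearity of \<open>A' u\<close> is not assumed; it follows from uniqueness of
    the derivative, with a constant \<open>w\<close>.\<close>
  have A': "A' u v = (\<Sum>i\<in>Basis. (v \<bullet> i) *\<^sub>R A' u i)" for u v
    using has_derivative_unique[OF A gen[OF has_derivative_const[of v]]] by (simp add: fun_eq_iff)
  have eq: "(\<Sum>i\<in>Basis. (w x \<bullet> i) *\<^sub>R A' u i + (w' u \<bullet> i) *\<^sub>R A x i) = A' u (w x) + A x (w' u)" for u
    unfolding sum.distrib A'[of u "w x", symmetric] exp[OF T(2), of "w' u", symmetric] ..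
  show ?thesis using gen[OF w] unfolding eq .
qed

lemma clinear_at_map:
  assumes "clinear_at m I \<omega> k" "\<And>a. P (J a) = I (P a)" "k < m"
  shows "clinear_at m J (\<lambda>us. \<omega> (map P us)) k"
  unfolding clinear_at_def
proof (intro allI impI)
  fix us :: "'b list" assume "length us = m"
  then show "\<omega> (map P (us[k := J (us ! k)])) = \<i> * \<omega> (map P us)"
    using clinear_atD[OF assms(1), of "map P us"] assms(2,3) by (simp add: map_update)
qed

lemma cform_map:
  assumes \<omega>: "cform n I \<omega>" and P: "linear P" "\<And>a. P (J a) = I (P a)"
  shows "cform n J (\<lambda>us. \<omega> (map P us))"
proof -
  have alt: "alternating_form n \<omega>" using \<omega> by (simp add: cform_def)
  have "linear (\<lambda>u. \<omega> (map P (us[i := u])))" if "length us = n" "i < n" for us i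
    using linear_compose[OF P(1) alternating_formD(1)[OF alt, of "map P us" i]] that
    by (simp add: o_def map_update)
  moreover have "\<omega> (map P us) = 0" if "length us = n" "i < j" "j < n" "us ! i = us ! j" for us i j
    using alternating_formD(2)[OF alt, of "map P us" i j] that by simp
  ultimately have "alternating_form n (\<lambda>us. \<omega> (map P us))"
    unfolding alternating_form_def by blast
  then show ?thesis using \<omega> clinear_at_map[of n I \<omega> _ P J] P(2) unfolding cform_def by blast
qed

lemma cform_cong:
  assumes "\<And>us. length us = n \<Longrightarrow> \<omega> us = \<omega>' us" "cform n J \<omega>"
  shows "cform n J \<omega>'"
proof -
  have eq: "\<omega>' us = \<omega> us" if "length us = n" for us using assms(1)[OF that] by simp
  show ?thesis
    using assms(2) unfolding cform_def alternating_form_def clinear_at_def by (simp add: eq)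
qed

lemma clinear_at_add:
  "clinear_at m J \<omega> k \<Longrightarrow> clinear_at m J \<omega>' k \<Longrightarrow> clinear_at m J (\<lambda>us. \<omega> us + \<omega>' us) k"
  by (simp add: clinear_at_def distrib_left)

lemma clinear_at_scale:
  "clinear_at m J \<omega> k \<Longrightarrow> clinear_at m J (\<lambda>us. c * \<omega> us) k"
  by (simp add: clinear_at_def mult.left_commute)

lemma clinear_at_sum:
  "(\<And>i. i \<in> S \<Longrightarrow> clinear_at m J (\<omega> i) k) \<Longrightarrow> clinear_at m J (\<lambda>us. \<Sum>i\<in>S. \<omega> i us) k"
  by (simp add: clinear_at_def sum_distrib_left)

lemma vol_form_smooth:
  fixes \<zeta> :: "nat \<Rightarrow> 'e::euclidean_space \<Rightarrow> complex" and g :: "nat \<Rightarrow> 'd::euclidean_space \<Rightarrow> 'e"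
  assumes T: "open T" and lin: "\<And>j. j < n \<Longrightarrow> linear (\<zeta> j)" and g: "\<And>i. i < n \<Longrightarrow> smooth_on (g i) T"
  shows "smooth_on (\<lambda>y. vol_form n \<zeta> (map (\<lambda>i. g i y) [0..<n])) T"
proof -
  have "smooth_on (\<lambda>y. of_int (sign p) * (\<Prod>i<n. \<zeta> (p i) (g i y))) T" if p: "p permutes {..<n}" for p
  proof (intro smooth_on_bilinear[OF T bounded_bilinear_mult] smooth_on_const[OF T] smooth_on_prod[OF T])
    fix i assume i: "i \<in> {..<n}"
    then have "p i < n" using permutes_in_image[OF p, of i] by simp
    then have "bounded_linear (\<zeta> (p i))" using lin linear_conv_bounded_linear by blast
    then show "smooth_on (\<lambda>y. \<zeta> (p i) (g i y)) T"
      by (rule smooth_on_bounded_linear[OF T]) (use g i in auto)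
  qed
  note summand = this
  have eq: "vol_form n \<zeta> (map (\<lambda>i. g i y) [0..<n]) =
      (\<Sum>p | p permutes {..<n}. of_int (sign p) * (\<Prod>i<n. \<zeta> (p i) (g i y)))" for y
    unfolding vol_form_def by (intro sum.cong refl arg_cong2[where f = times] prod.cong) simp
  show ?thesis unfolding eq by (rule smooth_on_sum[OF T]) (simp add: summand)
qed

text \<open>In the chart \<open>c\<close>, \<open>F c x\<close> sends a vector \<open>a\<close> of the Lie algebra to the value at \<open>x\<close> of the
  corresponding invariant vector field, and \<open>Q c x\<close> is the inverse coframe.\<close>

locale frame_atlas =
  fixes Y :: "'b topology" and B :: "('b, 'e::euclidean_space) chart set"
    and F Q :: "('b, 'e) chart \<Rightarrow> 'e \<Rightarrow> 'e \<Rightarrow> 'e"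
  assumes inj: "\<And>c. c \<in> B \<Longrightarrow> inj_on (cmap c) (cdom c)"
    and dom: "\<And>c. c \<in> B \<Longrightarrow> cdom c \<subseteq> topspace Y"
    and open_image: "\<And>c W. c \<in> B \<Longrightarrow> openin Y W \<Longrightarrow> open (cmap c ` (cdom c \<inter> W))"
    and cover: "\<And>p. p \<in> topspace Y \<Longrightarrow> charts_at B p \<noteq> {}"
    and linF: "\<And>c x. c \<in> B \<Longrightarrow> x \<in> cmap c ` cdom c \<Longrightarrow> linear (F c x)"
    and linQ: "\<And>c x. c \<in> B \<Longrightarrow> x \<in> cmap c ` cdom c \<Longrightarrow> linear (Q c x)"
    and QF: "\<And>c x a. c \<in> B \<Longrightarrow> x \<in> cmap c ` cdom c \<Longrightarrow> Q c x (F c x a) = a"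
    and FQ: "\<And>c x a. c \<in> B \<Longrightarrow> x \<in> cmap c ` cdom c \<Longrightarrow> F c x (Q c x a) = a"
    and smoothF: "\<And>c a. c \<in> B \<Longrightarrow> smooth_on (\<lambda>x. F c x a) (cmap c ` cdom c)"
    and smoothQ: "\<And>c a. c \<in> B \<Longrightarrow> smooth_on (\<lambda>x. Q c x a) (cmap c ` cdom c)"
    and transition: "\<And>p c d. c \<in> charts_at B p \<Longrightarrow> d \<in> charts_at B p \<Longrightarrow>
      ((cmap d \<circ> cinv c) has_derivative (\<lambda>u. F d (cmap d p) (Q c (cmap c p) u))) (at (cmap c p))"
begin

text \<open>The value at \<open>p\<close> of the invariant field with coordinates \<open>a\<close>.
  By \<open>transition\<close> the frames of any two charts at \<open>p\<close> correspond, so this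
  family of representatives is a tangent vector; \<open>coord\<close> reads \<open>a\<close> off
  from it.\<close>

definition tv :: "'b \<Rightarrow> 'e \<Rightarrow> ('b, 'e) tvec" where
  "tv p a = (\<lambda>d. if d \<in> charts_at B p then F d (cmap d p) a else 0)"

definition coord :: "'b \<Rightarrow> ('b, 'e) tvec \<Rightarrow> 'e" where
  "coord p v = (let c = (SOME c. c \<in> charts_at B p) in Q c (cmap c p) (v c))"

lemma charts_atD: "c \<in> charts_at B p \<Longrightarrow> c \<in> B \<and> p \<in> cdom c \<and> cmap c p \<in> cmap c ` cdom c \<and> p \<in> topspace Y"
  using dom[of c] by (auto simp: charts_at_def)

lemma cinv_cmap: "c \<in> charts_at B p \<Longrightarrow> cinv c (cmap c p) = p"
  using inj charts_atD unfolding cinv_def by (auto intro: inv_into_f_f)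

lemma cinv_chart: "c \<in> B \<Longrightarrow> x \<in> cmap c ` cdom c \<Longrightarrow> c \<in> charts_at B (cinv c x) \<and> cmap c (cinv c x) = x"
  unfolding cinv_def charts_at_def by (auto simp: inv_into_into f_inv_into_f)

lemma open_dom: "c \<in> B \<Longrightarrow> open (cmap c ` cdom c)"
  using open_image[of c "topspace Y"] dom[of c] by (simp add: Int_absorb2)

lemma tvec_eq: "c \<in> charts_at B p \<Longrightarrow> tvec B p c u = tv p (Q c (cmap c p) u)"
  unfolding tvec_def tv_def by (rule ext) (simp add: frechet_derivative_eqI[OF transition])

lemma tvec_F: "c \<in> charts_at B p \<Longrightarrow> tvec B p c (F c (cmap c p) a) = tv p a"
  using tvec_eq QF charts_atD by metis

lemma tangent_space_eq: "p \<in> topspace Y \<Longrightarrow> tangent_space B p = range (tv p)"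
proof
  assume p: "p \<in> topspace Y"
  show "tangent_space B p \<subseteq> range (tv p)"
    unfolding tangent_space_def using tvec_eq by auto
  obtain c where "c \<in> charts_at B p" using cover[OF p] by blast
  then show "range (tv p) \<subseteq> tangent_space B p"
    unfolding tangent_space_def using tvec_F by (metis (mono_tags, lifting) image_subsetI mem_Collect_eq)
qed

lemma coord_tv:
  assumes "p \<in> topspace Y"
  shows "coord p (tv p a) = a"
proof -
  define c where "c = (SOME c. c \<in> charts_at B p)"
  have c: "c \<in> charts_at B p" unfolding c_def using cover[OF assms] some_in_eq by blast
  then show ?thesis
    unfolding coord_def c_def[symmetric] Let_def using QF charts_atD[OF c] by (simp add: tv_def)
qed

text \<open>The rule for the derivative of an inverse matrix, obtained by differentiating the
  constant \<open>Q c y (F c y a)\<close> for \<open>a = Q c x v\<close>.\<close>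

lemma Q_has_derivative:
  assumes c: "c \<in> B" and x: "x \<in> cmap c ` cdom c"
  shows "((\<lambda>y. Q c y v) has_derivative
    (\<lambda>u. - Q c x (frechet_derivative (\<lambda>y. F c y (Q c x v)) (at x) u))) (at x)"
proof -
  let ?Q' = "\<lambda>u v. frechet_derivative (\<lambda>y. Q c y v) (at x) u"
  let ?w' = "frechet_derivative (\<lambda>y. F c y (Q c x v)) (at x)"
  have dQ: "((\<lambda>y. Q c y v) has_derivative (\<lambda>u. ?Q' u v)) (at x)" for v
    by (rule smooth_on_has_derivative[OF smoothQ[OF c] x])
  have dF: "((\<lambda>y. F c y (Q c x v)) has_derivative ?w') (at x)"
    by (rule smooth_on_has_derivative[OF smoothF[OF c] x])
  have "((\<lambda>y. Q c y (F c y (Q c x v))) has_derivative (\<lambda>u. ?Q' u (F c x (Q c x v)) + Q c x (?w' u))) (at x)"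
    by (rule has_derivative_linear_family[OF open_dom[OF c] x linQ[OF c] dQ dF])
  moreover have "((\<lambda>y. Q c y (F c y (Q c x v))) has_derivative (\<lambda>u. 0)) (at x)"
    by (rule has_derivative_transform_within_open[OF has_derivative_const[of "Q c x v"] open_dom[OF c] x])
      (simp add: QF[OF c])
  ultimately have "(\<lambda>u. ?Q' u (F c x (Q c x v)) + Q c x (?w' u)) = (\<lambda>u. 0)"
    by (rule has_derivative_unique)
  then have "(\<lambda>u. ?Q' u v) = (\<lambda>u. - Q c x (?w' u))"
    by (simp add: FQ[OF c x] fun_eq_iff eq_neg_iff_add_eq_0)
  then show ?thesis using dQ[of v] by simp
qed

end

text \<open>\<open>bracket\<close> says that the frame has constant structure coefficients
  \<open>br\<close>. \<open>int\<close> is integrability in real terms: it compares the real and the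
  imaginary part of the bracket of \<open>a - i (I a)\<close> and
  \<open>b - i (I b)\<close>.\<close>

locale invariant_frame = frame_atlas Y B F Q
  for Y :: "'b topology" and B :: "('b, 'e::euclidean_space) chart set"
    and F Q :: "('b, 'e) chart \<Rightarrow> 'e \<Rightarrow> 'e \<Rightarrow> 'e" +
  fixes K :: "'b \<Rightarrow> ('b, 'e) tvec \<Rightarrow> ('b, 'e) tvec"
    and I :: "'e \<Rightarrow> 'e" and br :: "'e \<Rightarrow> 'e \<Rightarrow> 'e" and n N :: nat
  assumes K_tv: "\<And>p a. p \<in> topspace Y \<Longrightarrow> K p (tv p a) = tv p (I a)"
    and I: "linear I" "\<And>a. I (I a) = - a"
    and bracket: "\<And>c x a b. c \<in> B \<Longrightarrow> x \<in> cmap c ` cdom c \<Longrightarrow>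
      frechet_derivative (\<lambda>y. F c y b) (at x) (F c x a) -
      frechet_derivative (\<lambda>y. F c y a) (at x) (F c x b) = F c x (br a b)"
    and br: "\<And>a. linear (br a)"
    and int: "\<And>a b. I (br a b - br (I a) (I b)) = br a (I b) + br (I a) b"
    and nil: "\<And>as b. length as = N \<Longrightarrow> foldr br as b = 0"
    and dim: "DIM('e) = 2 * n"
begin

lemma local_J_eq:
  assumes "c \<in> B" "x \<in> cmap c ` cdom c"
  shows "local_J B K c x u = F c x (I (Q c x u))"
  using cinv_chart[OF assms] charts_atD[of c "cinv c x"] unfolding local_J_def
  by (simp add: tvec_eq K_tv) (simp add: tv_def)

lemma local_J_sq:
  assumes "c \<in> B" "x \<in> cmap c ` cdom c"
  shows "local_J B K c x (local_J B K c x u) = - u"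
  using assms by (simp add: local_J_eq QF I(2) linear_neg[OF linF] FQ)

lemma Q_local_J:
  assumes "c \<in> B" "x \<in> cmap c ` cdom c"
  shows "Q c x (local_J B K c x u) = I (Q c x u)"
  using assms by (simp add: local_J_eq QF)

end

section \<open>The invariant volume section and its multiples\<close>

locale invariant_volume = invariant_frame Y B F Q K I br n N
  for Y :: "'b topology" and B :: "('b, 'e::euclidean_space) chart set"
    and F Q :: "('b, 'e) chart \<Rightarrow> 'e \<Rightarrow> 'e \<Rightarrow> 'e"
    and K :: "'b \<Rightarrow> ('b, 'e) tvec \<Rightarrow> ('b, 'e) tvec"
    and I :: "'e \<Rightarrow> 'e" and br :: "'e \<Rightarrow> 'e \<Rightarrow> 'e" and n N :: nat +
  fixes \<zeta> :: "nat \<Rightarrow> 'e \<Rightarrow> complex" and es :: "'e list"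
  assumes lin\<zeta>: "\<And>j. j < n \<Longrightarrow> linear (\<zeta> j)"
    and vol: "cform n I (vol_form n \<zeta>)"
    and es: "length es = n" "vol_form n \<zeta> es = 1"
    and uniq: "\<And>\<omega>. cform n I \<omega> \<Longrightarrow> \<exists>z. \<forall>us. length us = n \<longrightarrow> \<omega> us = z * vol_form n \<zeta> us"
begin

abbreviation \<omega> :: "'e list \<Rightarrow> complex" where "\<omega> \<equiv> vol_form n \<zeta>"

text \<open>The volume form with constant coefficients in the invariant coframe. The default 0 is
  the one that \<open>canonical_fibre\<close> prescribes.\<close>

definition sec :: "'b \<Rightarrow> ('b, 'e) tvec list \<Rightarrow> complex" where
  "sec p vs = (if length vs = n \<and> set vs \<subseteq> tangent_space B p then \<omega> (map (coord p) vs) else 0)"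

lemma sec_tv: "p \<in> topspace Y \<Longrightarrow> length as = n \<Longrightarrow> sec p (map (tv p) as) = \<omega> as"
  unfolding sec_def by (auto simp: tangent_space_eq o_def coord_tv)

lemma sec_tvec:
  assumes "c \<in> charts_at B p" "length us = n"
  shows "sec p (map (tvec B p c) us) = \<omega> (map (Q c (cmap c p)) us)"
proof -
  have "map (tvec B p c) us = map (tv p) (map (Q c (cmap c p)) us)"
    by (simp add: tvec_eq[OF assms(1)])
  note eq = this
  show ?thesis unfolding eq using charts_atD[OF assms(1)] assms(2) by (intro sec_tv) auto
qed

lemma sec_in_fibre:
  assumes p: "p \<in> topspace Y"
  shows "(\<lambda>vs. z * sec p vs) \<in> canonical_fibre n B K p"
  unfolding canonical_fibre_def
proof (intro CollectI conjI allI impI ballI)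
  fix c assume c: "c \<in> charts_at B p"
  let ?x = "cmap c p"
  have cx: "c \<in> B" "?x \<in> cmap c ` cdom c" using charts_atD[OF c] by auto
  have "cform n (local_J B K c ?x) (\<lambda>us. \<omega> (map (Q c ?x) us))"
    by (rule cform_map[where P = "Q c ?x" and I = I and J = "local_J B K c ?x"])
      (rule vol linQ[OF cx] Q_local_J[OF cx])+
  \<comment> \<open>The multiple by \<open>z\<close> is written as the form plus
    \<open>z - 1\<close> times itself.\<close>
  from cform_lincomb[OF this this, of "z - 1"]
  have "cform n (local_J B K c ?x) (\<lambda>us. z * \<omega> (map (Q c ?x) us))"
    by (simp add: algebra_simps)
  then have "cform n (local_J B K c ?x) (\<lambda>us. z * sec p (map (tvec B p c) us))"
    by (rule cform_cong[rotated]) (simp add: sec_tvec[OF c])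
  then show "form_n0 n (local_J B K c ?x) (\<lambda>us. z * sec p (map (tvec B p c) us))"
    using form_n0_iff[OF local_J_sq[OF cx]] by blast
qed (auto simp: sec_def)

text \<open>The frame at \<open>p\<close> pulls an element of the fibre back to an (n,0)-form on
  \<open>'e\<close>, where such forms make up a line.\<close>

lemma fibre_eq_sec:
  assumes p: "p \<in> topspace Y" and \<eta>: "\<eta> \<in> canonical_fibre n B K p"
  shows "\<exists>z. \<eta> = (\<lambda>vs. z * sec p vs)"
proof -
  obtain c where c: "c \<in> charts_at B p" using cover[OF p] by blast
  let ?x = "cmap c p"
  have cx: "c \<in> B" "?x \<in> cmap c ` cdom c" using charts_atD[OF c] by auto
  have "cform n (local_J B K c ?x) (\<lambda>us. \<eta> (map (tvec B p c) us))"
    using \<eta> c form_n0_iff[OF local_J_sq[OF cx]] unfolding canonical_fibre_def by blast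
  from cform_map[OF this linF[OF cx], of I]
  have "cform n I (\<lambda>as. \<eta> (map (tvec B p c) (map (F c ?x) as)))"
    by (simp add: local_J_eq[OF cx] QF[OF cx])
  then have "cform n I (\<lambda>as. \<eta> (map (tv p) as))"
    by (simp add: o_def tvec_F[OF c])
  then obtain z where z: "\<And>as. length as = n \<Longrightarrow> \<eta> (map (tv p) as) = z * \<omega> as" using uniq by blast
  have "\<eta> vs = z * sec p vs" for vs
  proof (cases "length vs = n \<and> set vs \<subseteq> tangent_space B p")
    case True
    have "tv p (coord p v) = v" if "v \<in> set vs" for v
    proof -
      have "v \<in> range (tv p)" using True that tangent_space_eq[OF p] by blast
      then show ?thesis using coord_tv[OF p] by auto
    qed
    then have vs: "vs = map (tv p) (map (coord p) vs)" by (simp add: map_idI)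
    show ?thesis
      using arg_cong[OF vs, of \<eta>] z[of "map (coord p) vs"] True by (simp add: sec_def)
  next
    case False
    then have "\<eta> vs = 0" using \<eta> unfolding canonical_fibre_def by blast
    then show ?thesis using False by (auto simp: sec_def)
  qed
  then show ?thesis by blast
qed

lemma local_form_sec:
  assumes "c \<in> B" "x \<in> cmap c ` cdom c" "length us = n"
  shows "local_form B (\<lambda>p vs. f p * sec p vs) c x us = f (cinv c x) * \<omega> (map (Q c x) us)"
  using cinv_chart[OF assms(1,2)] sec_tvec[of c "cinv c x" us] assms(3) unfolding local_form_def by simp

lemma smooth_coframe_volume:
  assumes "c \<in> B" "length us = n"
  shows "smooth_on (\<lambda>x. \<omega> (map (Q c x) us)) (cmap c ` cdom c)"
proof -
  have eq: "map (Q c x) us = map (\<lambda>i. Q c x (us ! i)) [0..<n]" for x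
    by (rule nth_equalityI) (use assms(2) in auto)
  show ?thesis unfolding eq
    by (rule vol_form_smooth[OF open_dom[OF assms(1)] lin\<zeta> smoothQ[OF assms(1)]])
qed

lemma coframe_volume_has_derivative:
  assumes c: "c \<in> B" and x: "x \<in> cmap c ` cdom c" and us: "length us = n"
  shows "((\<lambda>y. \<omega> (map (Q c y) us)) has_derivative (\<lambda>u. \<Sum>j<n. \<omega> ((map (Q c x) us)
    [j := - Q c x (frechet_derivative (\<lambda>y. F c y (Q c x (us ! j))) (at x) u)]))) (at x)"
proof -
  have eq: "map (Q c y) us = map (\<lambda>i. Q c y (us ! i)) [0..<n]" for y
    using us by (intro nth_equalityI) auto
  show ?thesis unfolding eq
    by (rule vol_form_has_derivative[OF lin\<zeta> Q_has_derivative[OF c x]])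
qed

text \<open>The first sum is the wedge product of \<open>df\<close> with the volume form. The second
  comes from differentiating the coframe and is the sum of
  \<open>clinear_at_chevalley_eilenberg\<close>; its minus sign is that of
  \<open>Q_has_derivative\<close>.\<close>

lemma ext_deriv_sec:
  assumes c: "c \<in> B" and T: "open T" "T \<subseteq> cmap c ` cdom c" "x \<in> T"
    and h: "((f \<circ> cinv c) has_derivative h') (at x)"
    and us: "length us = Suc n"
  defines "C \<equiv> \<lambda>a b. Q c x (frechet_derivative (\<lambda>y. F c y b) (at x) (F c x a))"
  shows "ext_deriv (local_form B (\<lambda>p vs. f p * sec p vs) c) x us =
    (\<Sum>i<Suc n. (-1) ^ i * (h' (us ! i) * \<omega> (map (Q c x) (omit i us)))) -
    f (cinv c x) * (\<Sum>i<Suc n. (-1) ^ i * (\<Sum>j<n. \<omega> ((omit i (map (Q c x) us))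
      [j := C (map (Q c x) us ! i) (omit i (map (Q c x) us) ! j)])))"
proof -
  have x: "x \<in> cmap c ` cdom c" using T by blast
  let ?h = "f \<circ> cinv c" and ?Q = "map (Q c x)"
  have der: "frechet_derivative (\<lambda>y. local_form B (\<lambda>p vs. f p * sec p vs) c y ws) (at x) u =
      h' u * \<omega> (?Q ws) - ?h x * (\<Sum>j<n. \<omega> ((?Q ws)[j := C (Q c x u) (?Q ws ! j)]))"
    if ws: "length ws = n" for ws u
  proof -
    let ?d = "\<lambda>j u. Q c x (frechet_derivative (\<lambda>y. F c y (Q c x (ws ! j))) (at x) u)"
    have "((\<lambda>y. ?h y * \<omega> (map (Q c y) ws)) has_derivative
        (\<lambda>u. ?h x * (\<Sum>j<n. \<omega> ((?Q ws)[j := - ?d j u])) + h' u * \<omega> (?Q ws))) (at x)"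
      by (rule has_derivative_mult[OF h coframe_volume_has_derivative[OF c x ws]])
    then have "((\<lambda>y. local_form B (\<lambda>p vs. f p * sec p vs) c y ws) has_derivative
        (\<lambda>u. ?h x * (\<Sum>j<n. \<omega> ((?Q ws)[j := - ?d j u])) + h' u * \<omega> (?Q ws))) (at x)"
      by (rule has_derivative_transform_within_open[OF _ T(1,3)])
        (use T(2) in \<open>auto simp: local_form_sec[OF c _ ws]\<close>)
    then have *: "frechet_derivative (\<lambda>y. local_form B (\<lambda>p vs. f p * sec p vs) c y ws) (at x) u =
        ?h x * (\<Sum>j<n. \<omega> ((?Q ws)[j := - ?d j u])) + h' u * \<omega> (?Q ws)"
      by (simp only: frechet_derivative_eqI)
    have neg: "\<omega> ((?Q ws)[j := - ?d j u]) = - \<omega> ((?Q ws)[j := C (Q c x u) (?Q ws ! j)])" if j: "j < n" for j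
    proof -
      have "linear (\<lambda>u. \<omega> ((?Q ws)[j := u]))"
        using vol ws j by (intro alternating_formD(1)) (auto simp: cform_def)
      then show ?thesis using linear_neg ws j unfolding C_def by (fastforce simp: FQ[OF c x])
    qed
    have "(\<Sum>j<n. \<omega> ((?Q ws)[j := - ?d j u])) = - (\<Sum>j<n. \<omega> ((?Q ws)[j := C (Q c x u) (?Q ws ! j)]))"
      unfolding sum_negf[symmetric] using neg by (intro sum.cong) auto
    then show ?thesis unfolding * by (simp only: mult_minus_right) simp
  qed
  have "ext_deriv (local_form B (\<lambda>p vs. f p * sec p vs) c) x us =
      (\<Sum>i<Suc n. (-1) ^ i * (h' (us ! i) * \<omega> (?Q (omit i us)) -
        ?h x * (\<Sum>j<n. \<omega> ((?Q (omit i us))[j := C (Q c x (us ! i)) (?Q (omit i us) ! j)]))))"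
    unfolding ext_deriv_def us omit_def[symmetric]
    by (intro sum.cong refl) (simp add: der length_omit us)
  also have "\<dots> = (\<Sum>i<Suc n. (-1) ^ i * (h' (us ! i) * \<omega> (map (Q c x) (omit i us)))) -
    ?h x * (\<Sum>i<Suc n. (-1) ^ i * (\<Sum>j<n. \<omega> ((omit i (?Q us))
      [j := C (Q c x (us ! i)) (omit i (?Q us) ! j)])))"
    unfolding sum_distrib_left[of "?h x"] sum_subtractf[symmetric] omit_map
    by (intro sum.cong refl) (simp add: right_diff_distrib mult.left_commute sum_distrib_left)
  also have "(\<Sum>i<Suc n. (-1) ^ i * (\<Sum>j<n. \<omega> ((omit i (?Q us))
      [j := C (Q c x (us ! i)) (omit i (?Q us) ! j)]))) =
    (\<Sum>i<Suc n. (-1) ^ i * (\<Sum>j<n. \<omega> ((omit i (?Q us))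
      [j := C (?Q us ! i) (omit i (?Q us) ! j)])))"
    using us by (intro sum.cong refl) simp
  finally show ?thesis by simp
qed

text \<open>Up to the term \<open>df \<and> \<omega>\<close>, the exterior derivative of \<open>f \<omega>\<close> is complex linear in every
  slot: this is where \<open>d\<omega> = 0\<close> enters.\<close>

lemma complexify_ext_deriv_sec:
  assumes c: "c \<in> B" and T: "open T" "T \<subseteq> cmap c ` cdom c" "x \<in> T"
    and h: "((f \<circ> cinv c) has_derivative h') (at x)"
    and zs: "length zs = Suc n" and k: "k < Suc n" "zs ! k \<in> type01 (local_J B K c x)"
  shows "complexify (ext_deriv (local_form B (\<lambda>p vs. f p * sec p vs) c) x) zs =
    (-1) ^ k * complexify (\<lambda>us. h' (us ! k) * \<omega> (map (Q c x) (omit k us))) zs"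
proof -
  have x: "x \<in> cmap c ` cdom c" using T by blast
  let ?J = "local_J B K c x" and ?Q = "map (Q c x)"
  define C where "C a b = Q c x (frechet_derivative (\<lambda>y. F c y b) (at x) (F c x a))" for a b
  define CE where "CE us = (\<Sum>i<Suc n. (-1) ^ i * (\<Sum>j<n. \<omega> ((omit i us)[j := C (us ! i) (omit i us ! j)])))"
    for us
  define t where "t i us = (-1) ^ i * (h' (us ! i) * \<omega> (?Q (omit i us)))" for i us
  have "br a b = C a b - C b a" for a b
    unfolding C_def linear_diff[OF linQ[OF c x], symmetric] bracket[OF c x] QF[OF c x] ..
  then have "clinear_at (Suc n) I CE k"
    unfolding CE_def using clinear_at_chevalley_eilenberg[OF vol uniq I _ br int nil k(1), of C] by blast
  then have CE: "clinear_at (Suc n) ?J (\<lambda>us. CE (?Q us)) k"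
    using k(1) by (rule clinear_at_map[where P = "Q c x" and J = ?J, OF _ Q_local_J[OF c x]])
  have t: "clinear_at (Suc n) ?J (t i) k" if i: "i \<in> {..<Suc n} - {k}" for i
    unfolding clinear_at_def
  proof (intro allI impI)
    fix us :: "'e list" assume us: "length us = Suc n"
    have sl: "slot i k < n" using i k by (auto simp: slot_def)
    have "clinear_at n ?J (\<lambda>us. \<omega> (?Q us)) (slot i k)"
      using vol sl by (intro clinear_at_map[where P = "Q c x" and J = ?J, OF _ Q_local_J[OF c x]]) (auto simp: cform_def)
    from clinear_atD[OF this, of "omit i us"]
    have "\<omega> (?Q ((omit i us)[slot i k := ?J (us ! k)])) = \<i> * \<omega> (?Q (omit i us))"
      using us i k by (simp add: length_omit nth_omit_slot)
    then show "t i (us[k := ?J (us ! k)]) = \<i> * t i us"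
      using i us k by (simp add: t_def omit_update)
  qed
  \<comment> \<open>Everything except the term in which \<open>f\<close> is differentiated along the
    vector in slot \<open>k\<close>. It is complex linear in that slot, so it vanishes on the
    (0,1)-vector there.\<close>
  define R where "R us = (\<Sum>i\<in>{..<Suc n} - {k}. t i us) + (- f (cinv c x)) * CE (?Q us)" for us
  have R: "clinear_at (Suc n) ?J R k"
    unfolding R_def by (intro clinear_at_add clinear_at_scale clinear_at_sum CE t)
  have "ext_deriv (local_form B (\<lambda>p vs. f p * sec p vs) c) x us = t k us + R us"
    if us: "length us = Suc n" for us
  proof -
    have "(\<Sum>i<Suc n. t i us) = t k us + (\<Sum>i\<in>{..<Suc n} - {k}. t i us)"
      using k(1) by (intro sum.remove) auto
    then show ?thesis
      using ext_deriv_sec[OF c T h us] unfolding R_def CE_def C_def t_def by simp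
  qed
  then have "complexify (ext_deriv (local_form B (\<lambda>p vs. f p * sec p vs) c) x) zs =
      complexify (\<lambda>us. t k us + R us) zs"
    by (intro complexify_cong) (simp add: zs)
  also have "\<dots> = complexify (t k) zs + complexify R zs" by (rule complexify_add)
  also have "complexify R zs = 0"
    using complexify_type01[of zs ?J R k] R zs k by simp
  finally show ?thesis unfolding t_def complexify_scale by simp
qed

text \<open>After \<open>complexify_ext_deriv_sec\<close> only \<open>df\<close> on the (0,1)-vector
  is left, times the volume form on the remaining vectors. The latter are of type (1,0), where the
  form takes nonzero values, so the condition becomes the Cauchy-Riemann equation.\<close>

lemma dbar_closed_sec_iff:
  assumes c: "c \<in> B" and T: "open T" "T \<subseteq> cmap c ` cdom c" "x \<in> T"
    and h: "((f \<circ> cinv c) has_derivative h') (at x)"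
  shows "dbar_closed_at n (local_J B K c x) (local_form B (\<lambda>p vs. f p * sec p vs) c) x \<longleftrightarrow>
    (\<forall>u. h' (local_J B K c x u) = \<i> * h' u)"
proof -
  have x: "x \<in> cmap c ` cdom c" using T by blast
  let ?J = "local_J B K c x" and ?Q = "map (Q c x)"
  note cx = complexify_ext_deriv_sec[OF c T h]
  show ?thesis
  proof
    assume hol: "\<forall>u. h' (?J u) = \<i> * h' u"
    show "dbar_closed_at n ?J (local_form B (\<lambda>p vs. f p * sec p vs) c) x"
      unfolding dbar_closed_at_def
    proof (intro allI impI; elim conjE)
      fix zs :: "('e \<times> 'e) list" and k
      assume zs: "length zs = Suc n" and k: "k < Suc n" "zs ! k \<in> type01 ?J"
      have "clinear_at (length zs) ?J (\<lambda>us. h' (us ! k) * \<omega> (?Q (omit k us))) k"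
        unfolding clinear_at_def using hol zs k(1) by (auto simp: omit_update_same)
      then have "complexify (\<lambda>us. h' (us ! k) * \<omega> (?Q (omit k us))) zs = 0"
        using complexify_type01[of zs ?J _ k] k zs by simp
      then show "complexify (ext_deriv (local_form B (\<lambda>p vs. f p * sec p vs) c) x) zs = 0"
        unfolding cx[OF zs k] by simp
    qed
  next
    assume cl: "dbar_closed_at n ?J (local_form B (\<lambda>p vs. f p * sec p vs) c) x"
    show "\<forall>u. h' (?J u) = \<i> * h' u"
    proof
      fix u
      \<comment> \<open>The (1,0)-vectors over the frame vectors of \<open>es\<close>. On them the
        complexified volume form is \<open>2 ^ n\<close>, so the factor
        \<open>h' u + \<i> * h' (?J u)\<close> must vanish.\<close>
      let ?ws = "map (\<lambda>e. (F c x e, - ?J (F c x e))) es"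
      let ?zs = "(u, ?J u) # ?ws"
      have z0: "?zs ! 0 \<in> type01 ?J" using local_J_sq[OF c x] by (simp add: type01_def)
      have linJ: "linear ?J"
        using linear_compose[OF linear_compose[OF linQ[OF c x] I(1)] linF[OF c x]]
        by (simp add: o_def local_J_eq[OF c x, abs_def])
      have ws: "?ws ! j \<in> type10 ?J" if "j < n" for j
        using that es(1) local_J_sq[OF c x] by (simp add: type10_def linear_neg[OF linJ])
      have zs: "length ?zs = Suc n" using es(1) by simp
      have z10: "?zs ! j \<in> type10 ?J" if "j < Suc n" "j \<noteq> 0" for j
        using ws that by (cases j) auto
      have "complexify (ext_deriv (local_form B (\<lambda>p vs. f p * sec p vs) c) x) ?zs = 0"
        using cl zs z0 z10 unfolding dbar_closed_at_def by blast
      then have "complexify (\<lambda>us. h' (us ! 0) * \<omega> (?Q (omit 0 us))) ?zs = 0"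
        unfolding cx[OF zs zero_less_Suc z0] by simp
      then have "(h' u + \<i> * h' (?J u)) * complexify (\<lambda>us. \<omega> (?Q us)) ?ws = 0"
        unfolding complexify_Cons by (simp add: omit_def complexify_scale algebra_simps)
      moreover have "complexify (\<lambda>us. \<omega> (?Q us)) ?ws = 2 ^ length ?ws * \<omega> (?Q (map fst ?ws))"
      proof (rule complexify_type10)
        fix k assume "k < length ?ws"
        then show "clinear_at (length ?ws) ?J (\<lambda>us. \<omega> (?Q us)) k" "?ws ! k \<in> type10 ?J"
          using ws es(1) vol
          by (auto intro!: clinear_at_map[where P = "Q c x" and J = ?J, OF _ Q_local_J[OF c x]] simp: cform_def)
      qed
      moreover have "?Q (map fst ?ws) = es" by (simp add: o_def QF[OF c x])
      ultimately have "h' u + \<i> * h' (?J u) = 0" using es(2) by simp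
      then have "\<i> * (h' u + \<i> * h' (?J u)) = 0" by simp
      then show "h' (?J u) = \<i> * h' u" by (simp add: distrib_left mult.assoc[symmetric])
    qed
  qed
qed

lemma holomorphic_sec_iff:
  assumes W: "openin Y W"
  shows "holomorphic_function B K W f \<longleftrightarrow>
    holomorphic_canonical_section n B K W (\<lambda>p vs. f p * sec p vs)"
proof -
  let ?T = "\<lambda>c. cmap c ` (cdom c \<inter> W)" and ?\<eta> = "\<lambda>p vs. f p * sec p vs"
  have T: "open (?T c)" "?T c \<subseteq> cmap c ` cdom c" if "c \<in> B" for c
    using open_image[OF that W] by auto
  have fib: "?\<eta> p \<in> canonical_fibre n B K p" if "p \<in> W" for p
    using sec_in_fibre openin_subset[OF W] that by blast
  have smooth: "smooth_on (f \<circ> cinv c) (?T c) \<longleftrightarrow>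
      (\<forall>us. length us = n \<longrightarrow> smooth_on (\<lambda>x. local_form B ?\<eta> c x us) (?T c))" if c: "c \<in> B" for c
  proof (intro iffI allI impI)
    fix us :: "'e list" assume f: "smooth_on (f \<circ> cinv c) (?T c)" and us: "length us = n"
    show "smooth_on (\<lambda>x. local_form B ?\<eta> c x us) (?T c)"
    proof (rule smooth_on_cong[OF T(1)[OF c]])
      show "smooth_on (\<lambda>x. (f \<circ> cinv c) x * \<omega> (map (Q c x) us)) (?T c)"
        by (intro smooth_on_bilinear[OF T(1)[OF c] bounded_bilinear_mult] f
            smooth_on_subset[OF smooth_coframe_volume[OF c us] T(2)[OF c]])
    qed (use T(2)[OF c] in \<open>auto simp: local_form_sec[OF c _ us]\<close>)
  next
    assume lf: "\<forall>us. length us = n \<longrightarrow> smooth_on (\<lambda>x. local_form B ?\<eta> c x us) (?T c)"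
    show "smooth_on (f \<circ> cinv c) (?T c)"
    proof (rule smooth_on_local)
      fix x0 assume x0: "x0 \<in> ?T c"
      then have x0': "x0 \<in> cmap c ` cdom c" by blast
      \<comment> \<open>On these fixed vectors the volume form is 1 at \<open>x0\<close>, hence
        nonzero nearby, and \<open>f\<close> is recovered there by division.\<close>
      let ?us = "map (F c x0) es"
      let ?g = "\<lambda>x. \<omega> (map (Q c x) ?us)"
      have us: "length ?us = n" using es(1) by simp
      have g: "smooth_on ?g (?T c)" by (rule smooth_on_subset[OF smooth_coframe_volume[OF c us] T(2)[OF c]])
      have g0: "?g x0 \<noteq> 0" using es(2) by (simp add: o_def QF[OF c x0'])
      define S where "S = {x \<in> ?T c. ?g x \<noteq> 0}"
      have "continuous_on (?T c) ?g" using g unfolding smooth_on_def by (metis ck_on.simps(1))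
      then have "open (?T c \<inter> ?g -` (- {0}))"
        by (rule continuous_open_preimage[OF _ T(1)[OF c]]) auto
      moreover have "S = ?T c \<inter> ?g -` (- {0})" unfolding S_def by auto
      ultimately have S: "open S" by simp
      have ST: "S \<subseteq> ?T c" unfolding S_def by blast
      have "smooth_on (f \<circ> cinv c) S"
      proof (rule smooth_on_cong[OF S])
        show "smooth_on (\<lambda>x. local_form B ?\<eta> c x ?us * inverse (?g x)) S"
          using lf us S_def
          by (intro smooth_on_bilinear[OF S bounded_bilinear_mult] smooth_on_inverse[OF S]
              smooth_on_subset[OF _ ST] g) auto
      qed (use T(2)[OF c] ST in \<open>auto simp: local_form_sec[OF c _ us] S_def\<close>)
      then show "\<exists>T. open T \<and> x0 \<in> T \<and> smooth_on (f \<circ> cinv c) T"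
        using S x0 g0 unfolding S_def by blast
    qed
  qed
  have dbar: "dbar_closed_at n (local_J B K c x) (local_form B ?\<eta> c) x \<longleftrightarrow>
      (\<forall>u. frechet_derivative (f \<circ> cinv c) (at x) (local_J B K c x u) =
        \<i> * frechet_derivative (f \<circ> cinv c) (at x) u)"
    if "c \<in> B" "x \<in> ?T c" "smooth_on (f \<circ> cinv c) (?T c)" for c x
    by (rule dbar_closed_sec_iff[OF that(1) T[OF that(1)] that(2) smooth_on_has_derivative[OF that(3,2)]])
  show ?thesis
  proof
    assume L: "holomorphic_function B K W f"
    then have sm: "smooth_on (f \<circ> cinv c) (?T c)" if "c \<in> B" for c
      using that unfolding holomorphic_function_def by blast
    show "holomorphic_canonical_section n B K W ?\<eta>"
      unfolding holomorphic_canonical_section_def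
    proof (intro conjI ballI allI impI)
      fix c and us :: "'e list" assume "c \<in> B" "length us = n"
      then show "smooth_on (\<lambda>x. local_form B ?\<eta> c x us) (?T c)" using smooth sm by blast
    next
      fix c x assume c: "c \<in> B" and x: "x \<in> ?T c"
      show "dbar_closed_at n (local_J B K c x) (local_form B ?\<eta> c) x"
        unfolding dbar[OF c x sm[OF c]] using L c x unfolding holomorphic_function_def by blast
    qed (rule fib)
  next
    assume R: "holomorphic_canonical_section n B K W ?\<eta>"
    have sm: "smooth_on (f \<circ> cinv c) (?T c)" if "c \<in> B" for c
      using R that smooth unfolding holomorphic_canonical_section_def by blast
    show "holomorphic_function B K W f"
      unfolding holomorphic_function_def
    proof (intro conjI ballI allI)
      fix c x u assume c: "c \<in> B" and x: "x \<in> ?T c"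
      have "dbar_closed_at n (local_J B K c x) (local_form B ?\<eta> c) x"
        using R c x unfolding holomorphic_canonical_section_def by blast
      then show "frechet_derivative (f \<circ> cinv c) (at x) (local_J B K c x u) =
          \<i> * frechet_derivative (f \<circ> cinv c) (at x) u"
        unfolding dbar[OF c x sm[OF c]] by blast
    qed (rule sm)
  qed
qed

lemma holomorphic_sec: "openin Y W \<Longrightarrow> holomorphic_canonical_section n B K W sec"
proof -
  assume W: "openin Y W"
  have "holomorphic_function B K W (\<lambda>_. 1)"
    unfolding holomorphic_function_def o_def
    using open_image[OF _ W] by (auto intro: smooth_on_const)
  then show ?thesis using holomorphic_sec_iff[OF W, of "\<lambda>_. 1"] by simp
qed

lemma trivial_canonical_bundle: "trivial_canonical_bundle n Y B K"
  unfolding trivial_canonical_bundle_def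
proof (intro exI[of _ "\<lambda>p z vs. z * sec p vs"] conjI ballI allI impI)
  fix p assume p: "p \<in> topspace Y"
  have "z = w" if "(\<lambda>vs. z * sec p vs) = (\<lambda>vs. w * sec p vs)" for z w
    using fun_cong[OF that, of "map (tv p) es"] sec_tv[OF p es(1)] es(2) by simp
  then have "inj (\<lambda>z vs. z * sec p vs)" by (rule injI)
  moreover have "range (\<lambda>z vs. z * sec p vs) = canonical_fibre n B K p"
    using sec_in_fibre[OF p] fibre_eq_sec[OF p] by blast
  ultimately show "bij_betw (\<lambda>z vs. z * sec p vs) UNIV (canonical_fibre n B K p)"
    by (simp add: bij_betw_def)
qed (auto simp: holomorphic_sec_iff algebra_simps)

end

lemma (in invariant_frame) invariant_volume_exists:
  "\<exists>\<zeta> es. invariant_volume Y B F Q K I br n N \<zeta> es"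
proof (rule exists_volume_form[OF I dim])
  fix \<zeta> :: "nat \<Rightarrow> 'e \<Rightarrow> complex" and es
  assume "\<And>j. j < n \<Longrightarrow> linear (\<zeta> j)" "cform n I (vol_form n \<zeta>)" "length es = n" "vol_form n \<zeta> es = 1"
    "\<And>\<omega>. cform n I \<omega> \<Longrightarrow> \<exists>z. \<forall>us. length us = n \<longrightarrow> \<omega> us = z * vol_form n \<zeta> us"
  then have "invariant_volume Y B F Q K I br n N \<zeta> es"
    by (intro invariant_volume.intro invariant_volume_axioms.intro invariant_frame_axioms)
  then show ?thesis by blast
qed

section \<open>The invariant frame of a Lie group\<close>

locale lie_atlas =
  fixes G :: "('a, 'm) monoid_scheme" (structure) and X :: "'a topology"
    and A :: "('a, 'e::euclidean_space) chart set"
  assumes lie: "lie_group G X A"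

sublocale lie_atlas \<subseteq> group G
  using lie by (simp add: lie_group_def)

context lie_atlas
begin

lemma topspace_eq: "topspace X = carrier G"
  using lie by (simp add: lie_group_def)

lemma smooth_atlas: "smooth_atlas X A"
  using lie by (simp add: lie_group_def smooth_manifold_def)

lemma openin_dom: "c \<in> A \<Longrightarrow> openin X (cdom c)"
  using smooth_atlas unfolding smooth_atlas_def by blast

lemma dom: "c \<in> A \<Longrightarrow> cdom c \<subseteq> carrier G"
  using openin_subset[OF openin_dom] topspace_eq by simp

lemma chart_homeomorphic:
  "c \<in> A \<Longrightarrow> homeomorphic_map (subtopology X (cdom c)) (top_of_set (cmap c ` cdom c)) (cmap c)"
  using smooth_atlas unfolding smooth_atlas_def by blast

lemma inj: "c \<in> A \<Longrightarrow> inj_on (cmap c) (cdom c)"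
  using homeomorphic_imp_injective_map[OF chart_homeomorphic] openin_subset[OF openin_dom]
  by (metis topspace_subtopology_subset)

lemma open_image:
  assumes "c \<in> A" "openin X W"
  shows "open (cmap c ` (cdom c \<inter> W))"
proof -
  have "openin (subtopology X (cdom c)) (cdom c \<inter> W)"
    using assms openin_dom by (simp add: openin_subtopology_Int2)
  then have "openin (top_of_set (cmap c ` cdom c)) (cmap c ` (cdom c \<inter> W))"
    using homeomorphic_imp_open_map[OF chart_homeomorphic[OF assms(1)]] unfolding open_map_def by blast
  moreover have "open (cmap c ` cdom c)" using smooth_atlas assms(1) unfolding smooth_atlas_def by blast
  ultimately show ?thesis by (rule openin_open_trans)
qed

lemma open_chart: "c \<in> A \<Longrightarrow> open (cmap c ` cdom c)"
  using open_image[of c "cdom c"] openin_dom by simp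

lemma cover: "p \<in> carrier G \<Longrightarrow> charts_at A p \<noteq> {}"
  using smooth_atlas topspace_eq unfolding smooth_atlas_def charts_at_def by blast

lemma charts_atD: "c \<in> charts_at A p \<Longrightarrow> c \<in> A \<and> p \<in> cdom c \<and> cmap c p \<in> cmap c ` cdom c \<and> p \<in> carrier G"
  using dom[of c] by (auto simp: charts_at_def)

lemma charts_atI: "c \<in> A \<Longrightarrow> p \<in> cdom c \<Longrightarrow> c \<in> charts_at A p"
  by (simp add: charts_at_def)

lemma cinv_cmap: "c \<in> charts_at A p \<Longrightarrow> cinv c (cmap c p) = p"
  using inj charts_atD unfolding cinv_def by (auto intro: inv_into_f_f)

lemma cinv_chart: "c \<in> A \<Longrightarrow> x \<in> cmap c ` cdom c \<Longrightarrow> c \<in> charts_at A (cinv c x) \<and> cmap c (cinv c x) = x"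
  unfolding cinv_def charts_at_def by (auto simp: inv_into_into f_inv_into_f)

lemma cinv_carrier: "c \<in> A \<Longrightarrow> x \<in> cmap c ` cdom c \<Longrightarrow> cinv c x \<in> carrier G"
  using cinv_chart[of c x] charts_atD[of c "cinv c x"] by simp

lemma open_preimage:
  assumes "c \<in> A" "openin X W"
  shows "open {x \<in> cmap c ` cdom c. cinv c x \<in> W}"
proof -
  have "{x \<in> cmap c ` cdom c. cinv c x \<in> W} = cmap c ` (cdom c \<inter> W)"
    using cinv_cmap[OF charts_atI[OF assms(1)]] by auto
  then show ?thesis using open_image[OF assms] by simp
qed

lemma open_preimage_map:
  assumes "c \<in> A" "d \<in> A" "continuous_map X X f"
  shows "open {x \<in> cmap c ` cdom c. f (cinv c x) \<in> cdom d}"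
proof -
  have 1: "openin X {q \<in> topspace X. f q \<in> cdom d}"
    by (rule openin_continuous_map_preimage[OF assms(3) openin_dom[OF assms(2)]])
  have "{x \<in> cmap c ` cdom c. f (cinv c x) \<in> cdom d} =
      {x \<in> cmap c ` cdom c. cinv c x \<in> {q \<in> topspace X. f q \<in> cdom d}}"
    using cinv_carrier[OF assms(1)] unfolding topspace_eq by blast
  then show ?thesis using open_preimage[OF assms(1) 1] by simp
qed

subsection \<open>Multiplication and inversion in charts\<close>

definition mu :: "('a, 'e) chart \<Rightarrow> ('a, 'e) chart \<Rightarrow> ('a, 'e) chart \<Rightarrow> 'e \<times> 'e \<Rightarrow> 'e" where
  "mu c d e z = cmap e (cinv c (fst z) \<otimes> cinv d (snd z))"

definition mu_dom :: "('a, 'e) chart \<Rightarrow> ('a, 'e) chart \<Rightarrow> ('a, 'e) chart \<Rightarrow> ('e \<times> 'e) set" where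
  "mu_dom c d e = {z. fst z \<in> cmap c ` cdom c \<and> snd z \<in> cmap d ` cdom d \<and>
    cinv c (fst z) \<otimes> cinv d (snd z) \<in> cdom e}"

lemma smooth_mult: "smooth_map (prod_topology X X) (prod_atlas A A) X A (\<lambda>(g, h). g \<otimes> h)"
  and smooth_inv: "smooth_map X A X A (\<lambda>g. inv g)"
  using lie by (simp_all add: lie_group_def)

lemma continuous_mult: "continuous_map (prod_topology X X) X (\<lambda>(g, h). g \<otimes> h)"
  and continuous_inv: "continuous_map X X (\<lambda>g. inv g)"
  using smooth_mult smooth_inv by (auto simp: smooth_map_def)

lemma mu_dom_iff:
  "c \<in> charts_at A p \<Longrightarrow> d \<in> charts_at A q \<Longrightarrow> e \<in> charts_at A (p \<otimes> q) \<Longrightarrow> (cmap c p, cmap d q) \<in> mu_dom c d e"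
  using charts_atD by (auto simp: mu_dom_def cinv_cmap)

lemma open_mu_dom:
  assumes "c \<in> A" "d \<in> A" "e \<in> A"
  shows "open (mu_dom c d e)"
proof (subst open_subopen, intro ballI)
  fix z assume z: "z \<in> mu_dom c d e"
  obtain x y where xy: "z = (x, y)" by (cases z)
  define W where "W = {p \<in> topspace (prod_topology X X). (case p of (g, h) \<Rightarrow> g \<otimes> h) \<in> cdom e}"
  have W: "openin (prod_topology X X) W"
    unfolding W_def by (rule openin_continuous_map_preimage[OF continuous_mult openin_dom[OF assms(3)]])
  have "cinv c x \<in> topspace X" "cinv d y \<in> topspace X"
    using z cinv_carrier[OF assms(1), of x] cinv_carrier[OF assms(2), of y]
    by (auto simp: mu_dom_def xy topspace_eq)
  then have xyW: "(cinv c x, cinv d y) \<in> W" using z by (simp add: W_def mu_dom_def xy)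
  have "\<exists>U V. openin X U \<and> openin X V \<and> cinv c x \<in> U \<and> cinv d y \<in> V \<and> U \<times> V \<subseteq> W"
    by (rule W[unfolded openin_prod_topology_alt, THEN spec, THEN spec, THEN mp, OF xyW])
  then obtain U V where UV: "openin X U" "openin X V" "cinv c x \<in> U" "cinv d y \<in> V" "U \<times> V \<subseteq> W"
    by (elim exE conjE) (rule that)
  let ?T = "{x \<in> cmap c ` cdom c. cinv c x \<in> U} \<times> {y \<in> cmap d ` cdom d. cinv d y \<in> V}"
  have "open ?T" by (intro open_Times open_preimage assms UV)
  moreover have "z \<in> ?T" using z UV by (auto simp: mu_dom_def xy)
  moreover have "?T \<subseteq> mu_dom c d e" using UV(5) by (auto simp: W_def mu_dom_def)
  ultimately show "\<exists>T. open T \<and> z \<in> T \<and> T \<subseteq> mu_dom c d e" by blast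
qed

lemma smooth_mu:
  assumes cde: "c \<in> A" "d \<in> A" "e \<in> A"
  shows "smooth_on (mu c d e) (mu_dom c d e)"
proof -
  let ?P = "(cdom c \<times> cdom d, map_prod (cmap c) (cmap d))"
  let ?m = "\<lambda>(g, h). g \<otimes> h"
  have "?P \<in> prod_atlas A A" using cde unfolding prod_atlas_def by blast
  then have sm: "smooth_on (cmap e \<circ> ?m \<circ> cinv ?P) (cmap ?P ` {p \<in> cdom ?P. ?m p \<in> cdom e})"
    using smooth_mult cde unfolding smooth_map_def by blast
  have "inj_on (map_prod (cmap c) (cmap d)) (cdom c \<times> cdom d)"
    using map_prod_inj_on inj cde by blast
  then have ci: "cinv ?P (x, y) = (cinv c x, cinv d y)" if "x \<in> cmap c ` cdom c" "y \<in> cmap d ` cdom d" for x y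
    unfolding cinv_def[of ?P] fst_conv snd_conv
    using cinv_chart[OF cde(1) that(1)] cinv_chart[OF cde(2) that(2)]
    by (intro inv_into_f_eq) (auto simp: charts_at_def)
  have "mu_dom c d e \<subseteq> cmap ?P ` {p \<in> cdom ?P. ?m p \<in> cdom e}"
  proof
    fix z assume z: "z \<in> mu_dom c d e"
    obtain x y where xy: "z = (x, y)" by (cases z)
    have x: "x \<in> cmap c ` cdom c" "y \<in> cmap d ` cdom d" "cinv c x \<otimes> cinv d y \<in> cdom e"
      using z by (auto simp: mu_dom_def xy)
    show "z \<in> cmap ?P ` {p \<in> cdom ?P. ?m p \<in> cdom e}"
      using cinv_chart[OF cde(1) x(1)] cinv_chart[OF cde(2) x(2)] x(3)
      by (intro image_eqI[of _ _ "(cinv c x, cinv d y)"]) (auto simp: xy charts_at_def)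
  qed
  with sm have "smooth_on (cmap e \<circ> ?m \<circ> cinv ?P) (mu_dom c d e)" by (rule smooth_on_subset)
  then show ?thesis
    by (rule smooth_on_cong[OF open_mu_dom[OF cde], rotated]) (auto simp: mu_dom_def mu_def ci)
qed

lemma mu_partial:
  assumes cde: "c \<in> A" "d \<in> A" "e \<in> A" and xy: "(x, y) \<in> mu_dom c d e"
  shows "((\<lambda>y'. mu c d e (x, y')) has_derivative (\<lambda>u. frechet_derivative (mu c d e) (at (x, y)) (0, u))) (at y)"
    and "((\<lambda>x'. mu c d e (x', y)) has_derivative (\<lambda>u. frechet_derivative (mu c d e) (at (x, y)) (u, 0))) (at x)"
proof -
  have D: "(mu c d e has_derivative frechet_derivative (mu c d e) (at (x, y))) (at (x, y))"
    by (rule smooth_on_has_derivative[OF smooth_mu[OF cde] xy])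
  have "((\<lambda>y'. (x, y')) has_derivative (\<lambda>u. (0, u))) (at y)" by (auto intro!: derivative_eq_intros)
  from diff_chain_at[OF this D] show "((\<lambda>y'. mu c d e (x, y')) has_derivative
      (\<lambda>u. frechet_derivative (mu c d e) (at (x, y)) (0, u))) (at y)" by (simp add: o_def)
  have "((\<lambda>x'. (x', y)) has_derivative (\<lambda>u. (u, 0))) (at x)" by (auto intro!: derivative_eq_intros)
  from diff_chain_at[OF this D] show "((\<lambda>x'. mu c d e (x', y)) has_derivative
      (\<lambda>u. frechet_derivative (mu c d e) (at (x, y)) (u, 0))) (at x)" by (simp add: o_def)
qed

definition iv :: "('a, 'e) chart \<Rightarrow> ('a, 'e) chart \<Rightarrow> 'e \<Rightarrow> 'e" where
  "iv c d x = cmap d (inv (cinv c x))"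

definition iv_dom :: "('a, 'e) chart \<Rightarrow> ('a, 'e) chart \<Rightarrow> 'e set" where
  "iv_dom c d = {x \<in> cmap c ` cdom c. inv (cinv c x) \<in> cdom d}"

lemma open_iv_dom: "c \<in> A \<Longrightarrow> d \<in> A \<Longrightarrow> open (iv_dom c d)"
  unfolding iv_dom_def using open_preimage_map[OF _ _ continuous_inv] by blast

lemma smooth_iv:
  assumes "c \<in> A" "d \<in> A"
  shows "smooth_on (iv c d) (iv_dom c d)"
proof -
  have "smooth_on (cmap d \<circ> (\<lambda>g. inv g) \<circ> cinv c) (cmap c ` {p \<in> cdom c. inv p \<in> cdom d})"
    using smooth_inv assms unfolding smooth_map_def by blast
  moreover have "iv_dom c d \<subseteq> cmap c ` {p \<in> cdom c. inv p \<in> cdom d}"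
  proof
    fix x assume "x \<in> iv_dom c d"
    then show "x \<in> cmap c ` {p \<in> cdom c. inv p \<in> cdom d}"
      using cinv_chart[OF assms(1), of x] by (intro image_eqI[of _ _ "cinv c x"]) (auto simp: iv_dom_def charts_at_def)
  qed
  ultimately have "smooth_on (cmap d \<circ> (\<lambda>g. inv g) \<circ> cinv c) (iv_dom c d)" by (rule smooth_on_subset)
  moreover have "cmap d \<circ> (\<lambda>g. inv g) \<circ> cinv c = iv c d" by (simp add: fun_eq_iff iv_def)
  ultimately show ?thesis by simp
qed

subsection \<open>Differentials of self-maps\<close>

text \<open>Differentiability in all charts is stable under composition, products and inversion, so
  the differential of any word in the group operations can be computed by the chain rule.
  \<open>MD\<close> is that differential in a pair of charts.\<close>

definition mdiff :: "('a \<Rightarrow> 'a) \<Rightarrow> bool" where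
  "mdiff f \<longleftrightarrow> continuous_map X X f \<and> (\<forall>p\<in>carrier G. \<forall>c\<in>charts_at A p. \<forall>d\<in>charts_at A (f p).
     (cmap d \<circ> f \<circ> cinv c) differentiable (at (cmap c p)))"

definition MD :: "('a, 'e) chart \<Rightarrow> ('a, 'e) chart \<Rightarrow> ('a \<Rightarrow> 'a) \<Rightarrow> 'a \<Rightarrow> 'e \<Rightarrow> 'e" where
  "MD c d f p = frechet_derivative (cmap d \<circ> f \<circ> cinv c) (at (cmap c p))"

lemma mdiff_continuous: "mdiff f \<Longrightarrow> continuous_map X X f"
  by (simp add: mdiff_def)

lemma mdiff_closed: "mdiff f \<Longrightarrow> p \<in> carrier G \<Longrightarrow> f p \<in> carrier G"
  using continuous_map_image_subset_topspace[of X X f] topspace_eq by (auto simp: mdiff_def)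

lemma MD_has_derivative:
  "mdiff f \<Longrightarrow> c \<in> charts_at A p \<Longrightarrow> d \<in> charts_at A (f p) \<Longrightarrow>
    ((cmap d \<circ> f \<circ> cinv c) has_derivative MD c d f p) (at (cmap c p))"
  unfolding mdiff_def MD_def using charts_atD frechet_derivative_works by blast

lemma linear_MD: "mdiff f \<Longrightarrow> c \<in> charts_at A p \<Longrightarrow> d \<in> charts_at A (f p) \<Longrightarrow> linear (MD c d f p)"
  using MD_has_derivative has_derivative_linear by blast

lemma MD_eqI: "((cmap d \<circ> f \<circ> cinv c) has_derivative D) (at (cmap c p)) \<Longrightarrow> MD c d f p = D"
  unfolding MD_def by (rule frechet_derivative_eqI)

text \<open>Group identities hold only on the carrier. This transfers derivatives along
  them.\<close>

lemma has_derivative_chart_cong: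
  assumes "((cmap d \<circ> f \<circ> cinv c) has_derivative D) (at (cmap c p))" "c \<in> charts_at A p"
    "\<And>q. q \<in> carrier G \<Longrightarrow> f q = g q"
  shows "((cmap d \<circ> g \<circ> cinv c) has_derivative D) (at (cmap c p))"
proof (rule has_derivative_transform_within_open[OF assms(1)])
  show "open (cmap c ` cdom c)" "cmap c p \<in> cmap c ` cdom c"
    using open_chart charts_atD[OF assms(2)] by auto
  fix x assume "x \<in> cmap c ` cdom c"
  then have "cinv c x \<in> carrier G" using cinv_chart charts_atD assms(2) by metis
  then show "(cmap d \<circ> f \<circ> cinv c) x = (cmap d \<circ> g \<circ> cinv c) x" by (simp add: assms(3))
qed

lemma MD_cong:
  assumes "mdiff f" "c \<in> charts_at A p" "d \<in> charts_at A (f p)" "\<And>q. q \<in> carrier G \<Longrightarrow> f q = g q"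
  shows "MD c d g p = MD c d f p"
  by (rule MD_eqI[OF has_derivative_chart_cong[OF MD_has_derivative[OF assms(1-3)] assms(2,4)]])

lemma comp_has_derivative:
  assumes f: "mdiff f" and g: "mdiff g" and c: "c \<in> charts_at A p" and d: "d \<in> charts_at A (f p)"
    and e: "e \<in> charts_at A (g (f p))"
  shows "((cmap e \<circ> (\<lambda>q. g (f q)) \<circ> cinv c) has_derivative (\<lambda>u. MD d e g (f p) (MD c d f p u))) (at (cmap c p))"
proof (rule has_derivative_transform_within_open)
  have 1: "(cmap d \<circ> f \<circ> cinv c) (cmap c p) = cmap d (f p)" by (simp add: cinv_cmap[OF c])
  show "(((cmap e \<circ> g \<circ> cinv d) \<circ> (cmap d \<circ> f \<circ> cinv c)) has_derivative
      (\<lambda>u. MD d e g (f p) (MD c d f p u))) (at (cmap c p))"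
    using diff_chain_at[OF MD_has_derivative[OF f c d], of "cmap e \<circ> g \<circ> cinv d" "MD d e g (f p)"]
      MD_has_derivative[OF g d e] unfolding 1 by (simp add: o_def)
  let ?S = "{x \<in> cmap c ` cdom c. f (cinv c x) \<in> cdom d}"
  show "open ?S" using open_preimage_map[OF _ _ mdiff_continuous[OF f]] charts_atD[OF c] charts_atD[OF d] by blast
  show "cmap c p \<in> ?S" using charts_atD[OF c] charts_atD[OF d] cinv_cmap[OF c] by simp
  fix x assume "x \<in> ?S"
  then have "cinv d (cmap d (f (cinv c x))) = f (cinv c x)"
    using cinv_cmap charts_atI charts_atD[OF d] by blast
  then show "((cmap e \<circ> g \<circ> cinv d) \<circ> (cmap d \<circ> f \<circ> cinv c)) x = (cmap e \<circ> (\<lambda>q. g (f q)) \<circ> cinv c) x"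
    by simp
qed

lemma MD_comp:
  "mdiff f \<Longrightarrow> mdiff g \<Longrightarrow> c \<in> charts_at A p \<Longrightarrow> d \<in> charts_at A (f p) \<Longrightarrow> e \<in> charts_at A (g (f p)) \<Longrightarrow>
    MD c e (\<lambda>q. g (f q)) p = (\<lambda>u. MD d e g (f p) (MD c d f p u))"
  by (rule MD_eqI[OF comp_has_derivative])

lemma mdiff_comp:
  assumes f: "mdiff f" and g: "mdiff g"
  shows "mdiff (\<lambda>q. g (f q))"
  unfolding mdiff_def
proof (intro conjI ballI)
  show "continuous_map X X (\<lambda>q. g (f q))"
    using continuous_map_compose[OF mdiff_continuous[OF f] mdiff_continuous[OF g]] by (simp add: o_def)
  fix p c e assume p: "p \<in> carrier G" and c: "c \<in> charts_at A p" and e: "e \<in> charts_at A (g (f p))"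
  obtain d where "d \<in> charts_at A (f p)" using cover mdiff_closed[OF f p] by blast
  then show "(cmap e \<circ> (\<lambda>q. g (f q)) \<circ> cinv c) differentiable at (cmap c p)"
    using comp_has_derivative[OF f g c _ e] unfolding differentiable_def by blast
qed

lemma mult_has_derivative:
  assumes f: "mdiff f" and g: "mdiff g" and c: "c \<in> charts_at A p"
    and d: "d \<in> charts_at A (f p)" "d' \<in> charts_at A (g p)" and e: "e \<in> charts_at A (f p \<otimes> g p)"
  shows "((cmap e \<circ> (\<lambda>q. f q \<otimes> g q) \<circ> cinv c) has_derivative
    (\<lambda>u. frechet_derivative (mu d d' e) (at (cmap d (f p), cmap d' (g p))) (MD c d f p u, MD c d' g p u))) (at (cmap c p))"
proof (rule has_derivative_transform_within_open)
  let ?h = "\<lambda>x. ((cmap d \<circ> f \<circ> cinv c) x, (cmap d' \<circ> g \<circ> cinv c) x)"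
  have h: "(?h has_derivative (\<lambda>u. (MD c d f p u, MD c d' g p u))) (at (cmap c p))"
    by (rule has_derivative_Pair[OF MD_has_derivative[OF f c d(1)] MD_has_derivative[OF g c d(2)]])
  have 1: "?h (cmap c p) = (cmap d (f p), cmap d' (g p))" by (simp add: cinv_cmap[OF c])
  have mu: "(mu d d' e has_derivative frechet_derivative (mu d d' e) (at (?h (cmap c p)))) (at (?h (cmap c p)))"
    unfolding 1 using charts_atD[OF d(1)] charts_atD[OF d(2)] charts_atD[OF e] mu_dom_iff[OF d e]
    by (intro smooth_on_has_derivative[OF smooth_mu]) auto
  show "((mu d d' e \<circ> ?h) has_derivative (\<lambda>u. frechet_derivative (mu d d' e) (at (cmap d (f p), cmap d' (g p)))
      (MD c d f p u, MD c d' g p u))) (at (cmap c p))"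
    using diff_chain_at[OF h mu] unfolding 1 by (simp add: o_def)
  let ?S = "{x \<in> cmap c ` cdom c. f (cinv c x) \<in> cdom d} \<inter> {x \<in> cmap c ` cdom c. g (cinv c x) \<in> cdom d'}"
  show "open ?S"
    using open_preimage_map[OF _ _ mdiff_continuous[OF f]] open_preimage_map[OF _ _ mdiff_continuous[OF g]]
      charts_atD[OF c] charts_atD[OF d(1)] charts_atD[OF d(2)] by (intro open_Int) auto
  show "cmap c p \<in> ?S"
    using charts_atD[OF c] charts_atD[OF d(1)] charts_atD[OF d(2)] cinv_cmap[OF c] by simp
  fix x assume "x \<in> ?S"
  then have "cinv d (cmap d (f (cinv c x))) = f (cinv c x)" "cinv d' (cmap d' (g (cinv c x))) = g (cinv c x)"
    using cinv_cmap charts_atI charts_atD[OF d(1)] charts_atD[OF d(2)] by blast+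
  then show "(mu d d' e \<circ> ?h) x = (cmap e \<circ> (\<lambda>q. f q \<otimes> g q) \<circ> cinv c) x"
    by (simp add: mu_def)
qed

lemma mdiff_mult:
  assumes f: "mdiff f" and g: "mdiff g"
  shows "mdiff (\<lambda>q. f q \<otimes> g q)"
  unfolding mdiff_def
proof (intro conjI ballI)
  have "continuous_map X (prod_topology X X) (\<lambda>q. (f q, g q))"
    using mdiff_continuous[OF f] mdiff_continuous[OF g] by (simp add: continuous_map_pairwise o_def)
  from continuous_map_compose[OF this continuous_mult]
  show "continuous_map X X (\<lambda>q. f q \<otimes> g q)" by (simp add: o_def)
  fix p c e assume p: "p \<in> carrier G" and c: "c \<in> charts_at A p" and e: "e \<in> charts_at A (f p \<otimes> g p)"
  obtain d d' where "d \<in> charts_at A (f p)" "d' \<in> charts_at A (g p)"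
    using cover mdiff_closed[OF f p] mdiff_closed[OF g p] by blast
  then show "(cmap e \<circ> (\<lambda>q. f q \<otimes> g q) \<circ> cinv c) differentiable at (cmap c p)"
    using mult_has_derivative[OF f g c _ _ e] unfolding differentiable_def by blast
qed

lemma const_has_derivative: "((cmap d \<circ> (\<lambda>q. a) \<circ> cinv c) has_derivative (\<lambda>u. 0)) (at (cmap c p))"
  by (simp add: o_def)

lemma mdiff_const: "a \<in> carrier G \<Longrightarrow> mdiff (\<lambda>q. a)"
  unfolding mdiff_def using const_has_derivative topspace_eq
  by (auto simp: differentiable_def simp del: o_apply)

lemma MD_const: "MD c d (\<lambda>q. a) p = (\<lambda>u. 0)"
  by (rule MD_eqI[OF const_has_derivative])

lemma mdiff_id: "mdiff (\<lambda>q. q)"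
  unfolding mdiff_def
proof (intro conjI ballI)
  fix p c d assume c: "c \<in> charts_at A p" and d: "d \<in> charts_at A p"
  have "smooth_on (cmap d \<circ> cinv c) (cmap c ` (cdom c \<inter> cdom d))"
    using smooth_atlas charts_atD[OF c] charts_atD[OF d] unfolding smooth_atlas_def by blast
  moreover have "cmap c p \<in> cmap c ` (cdom c \<inter> cdom d)" using charts_atD[OF c] charts_atD[OF d] by blast
  ultimately have "(cmap d \<circ> cinv c) differentiable at (cmap c p)"
    using smooth_on_has_derivative unfolding differentiable_def by blast
  then show "(cmap d \<circ> (\<lambda>q. q) \<circ> cinv c) differentiable at (cmap c p)" by (simp add: o_def)
qed simp

lemma MD_id:
  assumes c: "c \<in> charts_at A p"
  shows "MD c c (\<lambda>q. q) p = (\<lambda>u. u)"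
proof (rule MD_eqI, rule has_derivative_transform_within_open[OF has_derivative_ident])
  show "open (cmap c ` cdom c)" "cmap c p \<in> cmap c ` cdom c"
    using open_chart charts_atD[OF c] by auto
  show "x = (cmap c \<circ> (\<lambda>q. q) \<circ> cinv c) x" if "x \<in> cmap c ` cdom c" for x
    using cinv_chart[of c x] that charts_atD[OF c] by simp
qed

lemma mdiff_inv: "mdiff (\<lambda>q. inv q)"
  unfolding mdiff_def
proof (intro conjI ballI)
  fix p c d assume c: "c \<in> charts_at A p" and d: "d \<in> charts_at A (inv p)"
  have "cmap c p \<in> iv_dom c d" using charts_atD[OF c] charts_atD[OF d] cinv_cmap[OF c] by (simp add: iv_dom_def)
  then have "iv c d differentiable at (cmap c p)"
    using smooth_on_has_derivative[OF smooth_iv] charts_atD[OF c] charts_atD[OF d]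
    unfolding differentiable_def by blast
  then show "(cmap d \<circ> (\<lambda>q. inv q) \<circ> cinv c) differentiable at (cmap c p)" by (simp add: o_def iv_def[abs_def])
qed (rule continuous_inv)

lemma mdiff_left: "g \<in> carrier G \<Longrightarrow> mdiff (\<lambda>h. g \<otimes> h)"
  and mdiff_right: "g \<in> carrier G \<Longrightarrow> mdiff (\<lambda>h. h \<otimes> g)"
  by (auto intro: mdiff_mult mdiff_const mdiff_id)

lemma MD_left_comp:
  assumes gh: "g \<in> carrier G" "h \<in> carrier G" and c: "c \<in> charts_at A p" and d: "d \<in> charts_at A (g \<otimes> p)"
    and e: "e \<in> charts_at A (h \<otimes> g \<otimes> p)"
  shows "MD d e (\<lambda>q. h \<otimes> q) (g \<otimes> p) (MD c d (\<lambda>q. g \<otimes> q) p u) = MD c e (\<lambda>q. h \<otimes> g \<otimes> q) p u"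
proof -
  have p: "p \<in> carrier G" using charts_atD[OF c] by simp
  have e': "e \<in> charts_at A (h \<otimes> (g \<otimes> p))" using e gh p by (simp add: m_assoc)
  have "MD c e (\<lambda>q. h \<otimes> (g \<otimes> q)) p = MD c e (\<lambda>q. h \<otimes> g \<otimes> q) p"
    by (rule MD_cong[OF mdiff_left c e]) (use gh in \<open>auto simp: m_assoc\<close>)
  then show ?thesis using fun_cong[OF MD_comp[OF mdiff_left[OF gh(1)] mdiff_left[OF gh(2)] c d e'], of u] by simp
qed

lemma MD_left_one:
  assumes c: "c \<in> charts_at A p"
  shows "MD c c (\<lambda>q. \<one> \<otimes> q) p u = u"
  using MD_cong[OF mdiff_id c, of c "\<lambda>q. \<one> \<otimes> q"] c MD_id[OF c] by simp

subsection \<open>The left-invariant frame\<close>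

text \<open>One chart at the unit identifies the Lie algebra with \<open>'e\<close>. In these
  coordinates \<open>F\<close> is the differential of left translation from the unit to a point, and
  \<open>Q\<close> that of the translation back.\<close>

definition c0 :: "('a, 'e) chart" where "c0 = (SOME c. c \<in> charts_at A \<one>)"

definition x0 :: 'e where "x0 = cmap c0 \<one>"

definition F :: "('a, 'e) chart \<Rightarrow> 'e \<Rightarrow> 'e \<Rightarrow> 'e" where
  "F c x = MD c0 c (\<lambda>h. cinv c x \<otimes> h) \<one>"

definition Q :: "('a, 'e) chart \<Rightarrow> 'e \<Rightarrow> 'e \<Rightarrow> 'e" where
  "Q c x = MD c c0 (\<lambda>h. inv (cinv c x) \<otimes> h) (cinv c x)"

lemma c0: "c0 \<in> charts_at A \<one>"
  unfolding c0_def using cover[OF one_closed] some_in_eq by blast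

lemma c0_A: "c0 \<in> A" and x0_in: "x0 \<in> cmap c0 ` cdom c0" and cinv_x0: "cinv c0 x0 = \<one>"
  using charts_atD[OF c0] cinv_cmap[OF c0] by (auto simp: x0_def)

lemma F_cmap: "c \<in> charts_at A p \<Longrightarrow> F c (cmap c p) = MD c0 c (\<lambda>h. p \<otimes> h) \<one>"
  by (simp add: F_def cinv_cmap)

lemma Q_cmap: "c \<in> charts_at A p \<Longrightarrow> Q c (cmap c p) = MD c c0 (\<lambda>h. inv p \<otimes> h) p"
  by (simp add: Q_def cinv_cmap)

lemma F_x0: "F c0 x0 a = a"
  unfolding x0_def F_cmap[OF c0] by (rule MD_left_one[OF c0])

lemma MD_left_F:
  assumes g: "g \<in> carrier G" and c: "c \<in> charts_at A p" and d: "d \<in> charts_at A (g \<otimes> p)"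
  shows "MD c d (\<lambda>h. g \<otimes> h) p (F c (cmap c p) a) = F d (cmap d (g \<otimes> p)) a"
  using MD_left_comp[of p g c0 \<one> c d a] charts_atD[OF c] g c d c0 unfolding F_cmap[OF c] F_cmap[OF d] by simp

text \<open>Translating from \<open>p\<close> to the unit and then to \<open>g \<otimes> p\<close>
  is translating by \<open>g\<close>. The case of the unit gives the change of coordinates; elements
  of \<open>\<Gamma>\<close> will give the charts of the quotient.\<close>

lemma MD_left_Q:
  assumes g: "g \<in> carrier G" and c: "c \<in> charts_at A p" and d: "d \<in> charts_at A (g \<otimes> p)"
  shows "F d (cmap d (g \<otimes> p)) (Q c (cmap c p) u) = MD c d (\<lambda>h. g \<otimes> h) p u"
proof -
  have p: "p \<in> carrier G" using charts_atD[OF c] by simp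
  have "g \<otimes> p \<otimes> inv p = g" using g p by (simp add: m_assoc)
  then show ?thesis
    using MD_left_comp[of "inv p" "g \<otimes> p" c p c0 d u] p g c d c0
    unfolding Q_cmap[OF c] F_cmap[OF d] by (simp add: m_assoc)
qed

lemma left_translation_has_derivative:
  assumes g: "g \<in> carrier G" and c: "c \<in> charts_at A p" and d: "d \<in> charts_at A (g \<otimes> p)"
  shows "((cmap d \<circ> (\<lambda>h. g \<otimes> h) \<circ> cinv c) has_derivative
    (\<lambda>u. F d (cmap d (g \<otimes> p)) (Q c (cmap c p) u))) (at (cmap c p))"
  using MD_has_derivative[OF mdiff_left[OF g] c d] MD_left_Q[OF assms] by simp

lemma FQ_charts:
  assumes "c \<in> charts_at A p"
  shows "F c (cmap c p) (Q c (cmap c p) u) = u"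
  using MD_left_Q[OF one_closed assms, of c u] charts_atD[OF assms] MD_left_one[OF assms] assms by simp

lemma QF_charts:
  assumes c: "c \<in> charts_at A p"
  shows "Q c (cmap c p) (F c (cmap c p) a) = a"
proof -
  have p: "p \<in> carrier G" using charts_atD[OF c] by simp
  show ?thesis
    using MD_left_F[of "inv p" c p c0 a] p c c0 F_x0 unfolding Q_cmap[OF c] by (simp add: x0_def)
qed

text \<open>Presents the frame as a partial derivative of the multiplication, which makes its
  dependence on the base point visibly smooth.\<close>

lemma F_eq_mu:
  assumes c: "c \<in> A" and x: "x \<in> cmap c ` cdom c"
  shows "F c x a = frechet_derivative (mu c c0 c) (at (x, x0)) (0, a)" "(x, x0) \<in> mu_dom c c0 c"
proof -
  have cx: "c \<in> charts_at A (cinv c x)" "cmap c (cinv c x) = x" using cinv_chart[OF c x] by auto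
  then show M: "(x, x0) \<in> mu_dom c c0 c"
    using mu_dom_iff[OF cx(1) c0, of c] charts_atD[OF cx(1)] by (simp add: x0_def)
  have "(cmap c \<circ> (\<lambda>h. cinv c x \<otimes> h) \<circ> cinv c0) = (\<lambda>y. mu c c0 c (x, y))"
    by (simp add: fun_eq_iff mu_def)
  then show "F c x a = frechet_derivative (mu c c0 c) (at (x, x0)) (0, a)"
    unfolding F_def MD_def x0_def[symmetric]
    using frechet_derivative_eqI[OF mu_partial(1)[OF c c0_A c M]] by simp
qed

lemma smooth_F:
  assumes c: "c \<in> A"
  shows "smooth_on (\<lambda>x. F c x a) (cmap c ` cdom c)"
proof (rule smooth_on_cong[OF open_chart[OF c]])
  have "smooth_on (\<lambda>x. (x, x0)) (cmap c ` cdom c)"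
    by (intro smooth_on_Pair smooth_on_const smooth_on_ident open_chart[OF c])
  then show "smooth_on (\<lambda>x. frechet_derivative (mu c c0 c) (at (x, x0)) (0, a)) (cmap c ` cdom c)"
    by (rule smooth_on_compose[OF open_chart[OF c] open_mu_dom[OF c c0_A c] _ _
          smooth_on_frechet_derivative[OF smooth_mu[OF c c0_A c], where u = "(0, a)"], rotated])
      (use F_eq_mu(2)[OF c] in auto)
qed (simp add: F_eq_mu(1)[OF c])

text \<open>\<open>Q\<close> is a partial derivative of the multiplication at the pair of the
  inverse and the point. A chart around one inverse need not contain the inverses of all points of
  \<open>c\<close>, hence the local argument.\<close>

lemma smooth_Q:
  assumes c: "c \<in> A"
  shows "smooth_on (\<lambda>x. Q c x u) (cmap c ` cdom c)"
proof (rule smooth_on_local)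
  fix x1 assume x1: "x1 \<in> cmap c ` cdom c"
  then have "inv (cinv c x1) \<in> carrier G" using cinv_carrier[OF c] by simp
  then obtain e where e: "e \<in> charts_at A (inv (cinv c x1))" using cover by blast
  then have eA: "e \<in> A" using charts_atD by blast
  let ?T = "iv_dom c e"
  have T: "open ?T" by (rule open_iv_dom[OF c eA])
  have x1T: "x1 \<in> ?T" using x1 charts_atD[OF e] by (simp add: iv_dom_def)
  have 1: "(iv c e x, x) \<in> mu_dom e c c0 \<and> Q c x u = frechet_derivative (mu e c c0) (at (iv c e x, x)) (0, u)"
    if x: "x \<in> ?T" for x
  proof -
    have cx: "c \<in> charts_at A (cinv c x)" "cmap c (cinv c x) = x"
      using cinv_chart[OF c] x by (auto simp: iv_dom_def)
    have p: "cinv c x \<in> carrier G" using charts_atD[OF cx(1)] by simp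
    have ex: "e \<in> charts_at A (inv (cinv c x))" using x eA by (simp add: charts_at_def iv_dom_def)
    have M: "(iv c e x, x) \<in> mu_dom e c c0"
      using mu_dom_iff[OF ex cx(1), of c0] c0 p cx(2) by (simp add: iv_def)
    have "(cmap c0 \<circ> (\<lambda>h. inv (cinv c x) \<otimes> h) \<circ> cinv c) = (\<lambda>y. mu e c c0 (iv c e x, y))"
      by (simp add: fun_eq_iff mu_def iv_def cinv_cmap[OF ex])
    then have "Q c x u = frechet_derivative (\<lambda>y. mu e c c0 (iv c e x, y)) (at x) u"
      unfolding Q_def MD_def cx(2) by simp
    then show ?thesis using frechet_derivative_eqI[OF mu_partial(1)[OF eA c c0_A M]] M by simp
  qed
  have "smooth_on (\<lambda>x. (iv c e x, x)) ?T"
    by (intro smooth_on_Pair smooth_iv smooth_on_ident T c eA)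
  then have "smooth_on (\<lambda>x. frechet_derivative (mu e c c0) (at (iv c e x, x)) (0, u)) ?T"
    by (rule smooth_on_compose[OF T open_mu_dom[OF eA c c0_A] _ _
          smooth_on_frechet_derivative[OF smooth_mu[OF eA c c0_A], where u = "(0, u)"], rotated])
      (use 1 in auto)
  then have "smooth_on (\<lambda>x. Q c x u) ?T"
    by (rule smooth_on_cong[OF T, rotated]) (use 1 in simp)
  then show "\<exists>T. open T \<and> x1 \<in> T \<and> smooth_on (\<lambda>x. Q c x u) T" using T x1T by blast
qed

end

sublocale lie_atlas \<subseteq> fr: frame_atlas X A F Q
proof (rule frame_atlas.intro)
  fix c x assume c: "c \<in> A" and x: "x \<in> cmap c ` cdom c"
  have cx: "c \<in> charts_at A (cinv c x)" "cmap c (cinv c x) = x" using cinv_chart[OF c x] by auto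
  have p: "cinv c x \<in> carrier G" using charts_atD[OF cx(1)] by simp
  show "linear (F c x)" unfolding F_def
    by (rule linear_MD[OF mdiff_left[OF p] c0]) (use cx(1) p in simp)
  show "linear (Q c x)" unfolding Q_def
    by (rule linear_MD[OF mdiff_left[OF inv_closed[OF p]] cx(1)]) (use c0 p in simp)
  show "Q c x (F c x a) = a" "F c x (Q c x a) = a" for a
    using QF_charts[OF cx(1)] FQ_charts[OF cx(1)] unfolding cx(2) by auto
next
  fix p c d assume cd: "c \<in> charts_at A p" "d \<in> charts_at A p"
  have "p \<in> carrier G" using charts_atD[OF cd(1)] by simp
  \<comment> \<open>A change of coordinates is left translation by the unit, read in two
    charts.\<close>
  then have "((cmap d \<circ> (\<lambda>h. \<one> \<otimes> h) \<circ> cinv c) has_derivative (\<lambda>u. F d (cmap d p) (Q c (cmap c p) u))) (at (cmap c p))"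
    using left_translation_has_derivative[OF one_closed cd(1), of d] cd(2) by simp
  then show "((cmap d \<circ> cinv c) has_derivative (\<lambda>u. F d (cmap d p) (Q c (cmap c p) u))) (at (cmap c p))"
    using has_derivative_chart_cong[OF _ cd(1), of d "\<lambda>h. \<one> \<otimes> h" _ "\<lambda>h. h"] by (simp add: o_def)
qed (use dom topspace_eq inj open_image cover smooth_F smooth_Q in auto)

context lie_atlas
begin

lemma left_translate_tv:
  assumes g: "g \<in> carrier G" and h: "h \<in> carrier G"
  shows "left_translate G A g h (fr.tv h a) = fr.tv (g \<otimes> h) a"
proof
  fix d
  define c where "c = (SOME c. c \<in> charts_at A h)"
  have c: "c \<in> charts_at A h" unfolding c_def using cover[OF h] some_in_eq by blast
  show "left_translate G A g h (fr.tv h a) d = fr.tv (g \<otimes> h) a d"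
  proof (cases "d \<in> charts_at A (g \<otimes> h)")
    case True
    then have "left_translate G A g h (fr.tv h a) d = MD c d (\<lambda>k. g \<otimes> k) h (fr.tv h a c)"
      by (simp add: left_translate_def differential_def c_def[symmetric] MD_def)
    then show ?thesis using MD_left_F[OF g c True] c True by (simp add: fr.tv_def)
  qed (simp add: left_translate_def differential_def fr.tv_def)
qed

text \<open>\<open>F c0 x0\<close> is the identity, so this is the bracket of two left-invariant
  fields at the unit.\<close>

definition br :: "'e \<Rightarrow> 'e \<Rightarrow> 'e" where
  "br a b = frechet_derivative (\<lambda>y. F c0 y b) (at x0) a - frechet_derivative (\<lambda>y. F c0 y a) (at x0) b"

lemma F_has_derivative:
  "c \<in> A \<Longrightarrow> x \<in> cmap c ` cdom c \<Longrightarrow>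
    ((\<lambda>y. F c y b) has_derivative frechet_derivative (\<lambda>y. F c y b) (at x)) (at x)"
  by (rule smooth_on_has_derivative[OF smooth_F])

lemma linear_br: "linear (br a)"
proof -
  let ?D = "\<lambda>b. frechet_derivative (\<lambda>y. F c0 y b) (at x0)"
  note dF = F_has_derivative[OF c0_A x0_in]
  note tr = has_derivative_transform_within_open[OF _ open_chart[OF c0_A] x0_in]
  note linF = fr.linF[OF c0_A]
  have add: "?D (b + b') = (\<lambda>u. ?D b u + ?D b' u)" for b b'
    by (rule frechet_derivative_eqI, rule tr, rule has_derivative_add[OF dF[of b] dF[of b']])
      (simp add: linear_add[OF linF])
  have scale: "?D (r *\<^sub>R b) = (\<lambda>u. r *\<^sub>R ?D b u)" for r b
    by (rule frechet_derivative_eqI, rule tr, rule has_derivative_scaleR_right[OF dF[of b]])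
      (simp add: linear_scale[OF linF])
  have lin: "linear (?D a)" by (rule has_derivative_linear[OF dF])
  show ?thesis
    by (rule linearI)
      (simp_all add: br_def add scale linear_add[OF lin] linear_scale[OF lin] algebra_simps)
qed

lemma br_antisym: "br a b = - br b a"
  by (simp add: br_def)

text \<open>Left translation by \<open>g\<close> carries the frame near the unit to the frame near
  \<open>g\<close>. Differentiating this relation gives the bracket at the unit, transported by
  \<open>F c x\<close>, plus a second derivative of the translation.\<close>

lemma frame_bracket:
  assumes c: "c \<in> A" and x: "x \<in> cmap c ` cdom c"
  shows "frechet_derivative (\<lambda>y. F c y b) (at x) (F c x a) -
    frechet_derivative (\<lambda>y. F c y a) (at x) (F c x b) = F c x (br a b)"
proof -
  define g where "g = cinv c x"
  have cg: "c \<in> charts_at A g" "cmap c g = x" using cinv_chart[OF c x] by (auto simp: g_def)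
  have g: "g \<in> carrier G" using charts_atD[OF cg(1)] by simp
  define f where "f = cmap c \<circ> (\<lambda>h. g \<otimes> h) \<circ> cinv c0"
  define T where "T = {y \<in> cmap c0 ` cdom c0. g \<otimes> cinv c0 y \<in> cdom c}"
  have T: "open T" unfolding T_def
    by (rule open_preimage_map[OF c0_A c mdiff_continuous[OF mdiff_left[OF g]]])
  have x0T: "x0 \<in> T" using x0_in charts_atD[OF cg(1)] by (simp add: T_def cinv_x0)
  have ch: "c0 \<in> charts_at A (cinv c0 y) \<and> cmap c0 (cinv c0 y) = y \<and> c \<in> charts_at A (g \<otimes> cinv c0 y)"
    if "y \<in> T" for y
    using that cinv_chart[OF c0_A, of y] c by (auto simp: T_def charts_at_def)
  have fsm: "smooth_on f T"
  proof -
    have "f = (\<lambda>y. mu c c0 c (x, y))" by (simp add: f_def fun_eq_iff mu_def g_def)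
    moreover have "smooth_on (\<lambda>y. (x, y)) T"
      by (intro smooth_on_Pair smooth_on_const smooth_on_ident T)
    then have "smooth_on (\<lambda>y. mu c c0 c (x, y)) T"
      by (rule smooth_on_compose[OF T open_mu_dom[OF c c0_A c] _ _ smooth_mu[OF c c0_A c], rotated])
        (use x in \<open>auto simp: mu_dom_def T_def g_def\<close>)
    ultimately show ?thesis by simp
  qed
  let ?f' = "\<lambda>y. frechet_derivative f (at y)"
  have f': "?f' y = MD c0 c (\<lambda>h. g \<otimes> h) (cinv c0 y)" if "y \<in> T" for y
    using ch[OF that] by (simp add: MD_def f_def)
  have rel: "?f' y (F c0 y b) = F c (f y) b" if y: "y \<in> T" for y b
  proof -
    have c0y: "c0 \<in> charts_at A (cinv c0 y)" "c \<in> charts_at A (g \<otimes> cinv c0 y)" and ey: "cmap c0 (cinv c0 y) = y"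
      using ch[OF y] by auto
    show ?thesis
      using MD_left_F[OF g c0y, of b] unfolding f'[OF y] ey by (simp add: f_def)
  qed
  have fx0: "f x0 = x" using g by (simp add: f_def cinv_x0 cg(2))
  have f'x0: "?f' x0 = F c x" unfolding f'[OF x0T] F_def g_def cinv_x0 ..
  have main: "frechet_derivative (\<lambda>y. F c y b) (at x) (F c x a) =
      frechet_derivative (\<lambda>y. ?f' y b) (at x0) a + F c x (frechet_derivative (\<lambda>y. F c0 y b) (at x0) a)" for a b
  proof -
    have "((\<lambda>y. ?f' y (F c0 y b)) has_derivative
        (\<lambda>u. frechet_derivative (\<lambda>y. ?f' y (F c0 x0 b)) (at x0) u + ?f' x0 (frechet_derivative (\<lambda>y. F c0 y b) (at x0) u))) (at x0)"
    proof (rule has_derivative_linear_family[where A = ?f' and w = "\<lambda>y. F c0 y b"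
          and A' = "\<lambda>u v. frechet_derivative (\<lambda>y. ?f' y v) (at x0) u", OF T x0T])
      show "linear (?f' y)" if "y \<in> T" for y
        using smooth_on_has_derivative[OF fsm that] by (rule has_derivative_linear)
      show "((\<lambda>y. ?f' y v) has_derivative frechet_derivative (\<lambda>y. ?f' y v) (at x0)) (at x0)" for v
        by (rule smooth_on_has_derivative[OF smooth_on_frechet_derivative[OF fsm] x0T])
      show "((\<lambda>y. F c0 y b) has_derivative frechet_derivative (\<lambda>y. F c0 y b) (at x0)) (at x0)"
        by (rule F_has_derivative[OF c0_A x0_in])
    qed
    then have "((\<lambda>y. F c (f y) b) has_derivative
        (\<lambda>u. frechet_derivative (\<lambda>y. ?f' y b) (at x0) u + F c x (frechet_derivative (\<lambda>y. F c0 y b) (at x0) u))) (at x0)"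
      unfolding F_x0 f'x0 by (rule has_derivative_transform_within_open[OF _ T x0T]) (rule rel)
    moreover have "((\<lambda>y. F c (f y) b) has_derivative
        (\<lambda>u. frechet_derivative (\<lambda>y. F c y b) (at x) (F c x u))) (at x0)"
      using diff_chain_at[OF smooth_on_has_derivative[OF fsm x0T], of "\<lambda>y. F c y b"]
        F_has_derivative[OF c x, of b] unfolding fx0 f'x0 by (simp add: o_def)
    ultimately show ?thesis using has_derivative_unique by (metis (no_types, lifting))
  qed
  \<comment> \<open>The second derivative is symmetric in \<open>a\<close> and \<open>b\<close> and
    so drops out of the bracket.\<close>
  have "frechet_derivative (\<lambda>y. ?f' y b) (at x0) a = frechet_derivative (\<lambda>y. ?f' y a) (at x0) b"
    by (rule symmetric_second_derivative[OF T x0T fsm])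
  then show ?thesis
    unfolding main br_def linear_diff[OF fr.linF[OF c x]] by simp
qed

end

section \<open>Nilpotency of the Lie algebra\<close>

context lie_atlas
begin

section \<open>Iterated commutators and their differentials\<close>

text \<open>The variable comes first, in the order of the generators in
  \<open>lower_central\<close>. As a function of \<open>h\<close> it fixes the unit and has
  differential \<open>1 - Ad g\<close> there.\<close>

definition comm :: "'a \<Rightarrow> 'a \<Rightarrow> 'a" where
  "comm g h = h \<otimes> g \<otimes> inv h \<otimes> inv g"

definition dcomm :: "'a \<Rightarrow> 'e \<Rightarrow> 'e" where "dcomm g = MD c0 c0 (comm g) \<one>"

lemma mdiff_comm: "g \<in> carrier G \<Longrightarrow> mdiff (comm g)"
  unfolding comm_def[abs_def]
  by (intro mdiff_mult[of "\<lambda>h. h \<otimes> g \<otimes> inv h" "\<lambda>h. inv g"] mdiff_mult[of "\<lambda>h. h \<otimes> g" "\<lambda>h. inv h"]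
      mdiff_right mdiff_inv mdiff_const inv_closed)

lemma comm_one: "g \<in> carrier G \<Longrightarrow> comm g \<one> = \<one>"
  by (simp add: comm_def)

lemma linear_dcomm: "g \<in> carrier G \<Longrightarrow> linear (dcomm g)"
  unfolding dcomm_def using linear_MD[OF mdiff_comm c0, of g c0] c0 comm_one by simp

text \<open>Every \<open>comm g\<close> fixes the unit, so the chain rule at the unit simply
  composes the maps \<open>dcomm g\<close>.\<close>

lemma foldr_comm:
  assumes "set gs \<subseteq> carrier G"
  shows "mdiff (foldr comm gs)" "foldr comm gs \<one> = \<one>" "MD c0 c0 (foldr comm gs) \<one> = foldr dcomm gs"
proof -
  have "mdiff (foldr comm gs) \<and> foldr comm gs \<one> = \<one> \<and> MD c0 c0 (foldr comm gs) \<one> = foldr dcomm gs"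
    using assms
  proof (induction gs)
    case Nil
    have "foldr comm [] = (\<lambda>q. q)" "foldr dcomm [] = (\<lambda>v. v)" by (simp_all add: fun_eq_iff)
    then show ?case using mdiff_id MD_id[OF c0] by simp
  next
    case (Cons g gs)
    then have g: "g \<in> carrier G" and IH: "mdiff (foldr comm gs)" "foldr comm gs \<one> = \<one>"
        "MD c0 c0 (foldr comm gs) \<one> = foldr dcomm gs" by auto
    have eq: "foldr comm (g # gs) = (\<lambda>h. comm g (foldr comm gs h))" by (simp add: fun_eq_iff)
    have c0': "c0 \<in> charts_at A (foldr comm gs \<one>)" "c0 \<in> charts_at A (comm g (foldr comm gs \<one>))"
      using c0 IH(2) comm_one[OF g] by auto
    have "MD c0 c0 (\<lambda>h. comm g (foldr comm gs h)) \<one> = (\<lambda>u. dcomm g (foldr dcomm gs u))"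
      using MD_comp[OF IH(1) mdiff_comm[OF g] c0 c0'] unfolding IH(2,3) dcomm_def .
    then show ?case
      using mdiff_comp[OF IH(1) mdiff_comm[OF g]] IH(2) comm_one[OF g] unfolding eq
      by (simp add: fun_eq_iff)
  qed
  then show "mdiff (foldr comm gs)" "foldr comm gs \<one> = \<one>" "MD c0 c0 (foldr comm gs) \<one> = foldr dcomm gs" by auto
qed

text \<open>Each further commutator with a group element descends one step in the lower central
  series.\<close>

lemma foldr_comm_lower_central:
  "set gs \<subseteq> carrier G \<Longrightarrow> h \<in> carrier G \<Longrightarrow> foldr comm gs h \<in> lower_central G (length gs)"
proof (induction gs)
  case (Cons g gs)
  then have "foldr comm gs h \<in> lower_central G (length gs)" "g \<in> carrier G" by auto
  then have "comm g (foldr comm gs h) \<in> {x \<otimes> y \<otimes> inv x \<otimes> inv y |x y.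
      x \<in> lower_central G (length gs) \<and> y \<in> carrier G}"
    unfolding comm_def[of g "foldr comm gs h"] by blast
  then show ?case by (simp add: generate.incl)
qed simp

lemma foldr_dcomm_eq_zero:
  assumes nil: "lower_central G N = {\<one>}" and gs: "set gs \<subseteq> carrier G" "length gs = N"
  shows "foldr dcomm gs v = 0"
proof -
  have one: "foldr comm gs q = \<one>" if "q \<in> carrier G" for q
    using foldr_comm_lower_central[OF gs(1) that] nil gs(2) by simp
  have "MD c0 c0 (foldr comm gs) \<one> = MD c0 c0 (\<lambda>q. \<one>) \<one>"
    by (rule MD_cong[OF mdiff_const[OF one_closed] c0 c0]) (simp add: one)
  then show ?thesis using foldr_comm(3)[OF gs(1)] MD_const by (metis (full_types))
qed

section \<open>The differential of the adjoint representation at the unit\<close>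

abbreviation dmu :: "'e \<times> 'e \<Rightarrow> 'e \<times> 'e \<Rightarrow> 'e" where
  "dmu z \<equiv> frechet_derivative (mu c0 c0 c0) (at z)"

lemma linear_dmu: "z \<in> mu_dom c0 c0 c0 \<Longrightarrow> linear (dmu z)"
  using smooth_on_has_derivative[OF smooth_mu[OF c0_A c0_A c0_A]] has_derivative_linear by blast

lemma dmu_x0: "dmu (x0, x0) (a, b) = a + b"
proof -
  have M: "(x0, x0) \<in> mu_dom c0 c0 c0" using F_eq_mu(2)[OF c0_A x0_in] .
  have b: "dmu (x0, x0) (0, b) = b" using F_eq_mu(1)[OF c0_A x0_in] F_x0 by simp
  have "((\<lambda>x'. mu c0 c0 c0 (x', x0)) has_derivative (\<lambda>u. u)) (at x0)"
  proof (rule has_derivative_transform_within_open[OF has_derivative_ident open_chart[OF c0_A] x0_in])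
    fix x assume x: "x \<in> cmap c0 ` cdom c0"
    show "x = mu c0 c0 c0 (x, x0)"
      using cinv_chart[OF c0_A x] cinv_carrier[OF c0_A x] by (simp add: mu_def cinv_x0)
  qed
  then have "(\<lambda>u. dmu (x0, x0) (u, 0)) = (\<lambda>u. u)"
    using mu_partial(2)[OF c0_A c0_A c0_A M] has_derivative_unique by blast
  then have a: "dmu (x0, x0) (a, 0) = a" by metis
  have "dmu (x0, x0) ((a, 0) + (0, b)) = a + b"
    unfolding linear_add[OF linear_dmu[OF M]] a b ..
  then show ?thesis by simp
qed

definition conjg :: "'a \<Rightarrow> 'a \<Rightarrow> 'a" where "conjg g h = g \<otimes> h \<otimes> inv g"

lemma mdiff_conjg: "g \<in> carrier G \<Longrightarrow> mdiff (conjg g)"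
  unfolding conjg_def[abs_def]
  by (intro mdiff_mult[of "\<lambda>h. g \<otimes> h" "\<lambda>h. inv g"] mdiff_left mdiff_const inv_closed)

lemma conjg_one: "g \<in> carrier G \<Longrightarrow> conjg g \<one> = \<one>"
  by (simp add: conjg_def)

text \<open>Differentiate \<open>comm g h \<otimes> conjg g h = h\<close>; at the unit the
  differential of the multiplication is addition. Thus \<open>dcomm g\<close> is
  \<open>1 - Ad g\<close>.\<close>

lemma dcomm_plus_Ad:
  assumes g: "g \<in> carrier G"
  shows "dcomm g v + MD c0 c0 (conjg g) \<one> v = v"
proof -
  have c0': "c0 \<in> charts_at A (comm g \<one>)" "c0 \<in> charts_at A (conjg g \<one>)" "c0 \<in> charts_at A (comm g \<one> \<otimes> conjg g \<one>)"
    using c0 comm_one[OF g] conjg_one[OF g] by auto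
  have "((cmap c0 \<circ> (\<lambda>q. comm g q \<otimes> conjg g q) \<circ> cinv c0) has_derivative
      (\<lambda>u. dmu (x0, x0) (dcomm g u, MD c0 c0 (conjg g) \<one> u))) (at (cmap c0 \<one>))"
    using mult_has_derivative[OF mdiff_comm[OF g] mdiff_conjg[OF g] c0 c0']
    unfolding comm_one[OF g] conjg_one[OF g] x0_def dcomm_def .
  then have "((cmap c0 \<circ> (\<lambda>q. q) \<circ> cinv c0) has_derivative
      (\<lambda>u. dmu (x0, x0) (dcomm g u, MD c0 c0 (conjg g) \<one> u))) (at (cmap c0 \<one>))"
  proof (rule has_derivative_chart_cong[OF _ c0])
    fix q assume q: "q \<in> carrier G"
    define b where "b = g \<otimes> q"
    have b: "b \<in> carrier G" using g q by (simp add: b_def)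
    have "comm g q = q \<otimes> g \<otimes> inv b" "conjg g q = b \<otimes> inv g"
      using g q by (simp_all add: comm_def conjg_def b_def inv_mult_group m_assoc)
    then have "comm g q \<otimes> conjg g q = q \<otimes> g \<otimes> inv b \<otimes> (b \<otimes> inv g)" by simp
    also have "\<dots> = q \<otimes> (g \<otimes> ((inv b \<otimes> b) \<otimes> inv g))"
      by (simp only: m_assoc g q b m_closed inv_closed one_closed)
    also have "\<dots> = q" unfolding l_inv[OF b] using g q by simp
    finally show "comm g q \<otimes> conjg g q = q" .
  qed
  from MD_eqI[OF this] MD_id[OF c0] show ?thesis by (simp add: dmu_x0 fun_eq_iff)
qed

text \<open>From \<open>g \<otimes> h = conjg g h \<otimes> g\<close>: left translation is right
  translation after Ad. Here \<open>dmu (x0, x) (w, 0)\<close> is the differential at the unit of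
  right translation by the point with coordinate \<open>x\<close>.\<close>

lemma F_eq_Ad:
  assumes x: "x \<in> cmap c0 ` cdom c0"
  shows "F c0 x v = dmu (x0, x) (MD c0 c0 (conjg (cinv c0 x)) \<one> v, 0)" "(x0, x) \<in> mu_dom c0 c0 c0"
proof -
  let ?g = "cinv c0 x"
  have g: "?g \<in> carrier G" by (rule cinv_carrier[OF c0_A x])
  have c0g: "c0 \<in> charts_at A ?g" "cmap c0 ?g = x" using cinv_chart[OF c0_A x] by auto
  show "(x0, x) \<in> mu_dom c0 c0 c0" using mu_dom_iff[OF c0 c0g(1), of c0] c0g g by (simp add: x0_def)
  have c0': "c0 \<in> charts_at A (conjg ?g \<one>)" "c0 \<in> charts_at A (conjg ?g \<one> \<otimes> ?g)"
    using c0 c0g(1) conjg_one[OF g] g by auto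
  have "((cmap c0 \<circ> (\<lambda>q. conjg ?g q \<otimes> ?g) \<circ> cinv c0) has_derivative
      (\<lambda>u. dmu (x0, x) (MD c0 c0 (conjg ?g) \<one> u, 0))) (at (cmap c0 \<one>))"
    using mult_has_derivative[OF mdiff_conjg[OF g] mdiff_const[OF g] c0 c0'(1) c0g(1) c0'(2)]
    unfolding conjg_one[OF g] c0g(2) x0_def MD_const .
  then have "((cmap c0 \<circ> (\<lambda>q. ?g \<otimes> q) \<circ> cinv c0) has_derivative
      (\<lambda>u. dmu (x0, x) (MD c0 c0 (conjg ?g) \<one> u, 0))) (at (cmap c0 \<one>))"
    by (rule has_derivative_chart_cong[OF _ c0]) (use g in \<open>simp add: conjg_def m_assoc\<close>)
  from MD_eqI[OF this] show "F c0 x v = dmu (x0, x) (MD c0 c0 (conjg ?g) \<one> v, 0)"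
    unfolding F_def by simp
qed

text \<open>Right translation by the inverse undoes right translation. Writing it with
  \<open>dmu\<close> expresses the inverse by a function that is smooth in \<open>x\<close>.\<close>

lemma right_translation_inverse:
  assumes x: "x \<in> iv_dom c0 c0"
  shows "dmu (x, iv c0 c0 x) (dmu (x0, x) (v, 0), 0) = v" "(x, iv c0 c0 x) \<in> mu_dom c0 c0 c0"
proof -
  let ?g = "cinv c0 x"
  have xS: "x \<in> cmap c0 ` cdom c0" using x by (simp add: iv_dom_def)
  have g: "?g \<in> carrier G" by (rule cinv_carrier[OF c0_A xS])
  have c0g: "c0 \<in> charts_at A ?g" "cmap c0 ?g = x" using cinv_chart[OF c0_A xS] by auto
  have c0i: "c0 \<in> charts_at A (inv ?g)" using x c0_A by (simp add: iv_dom_def charts_at_def)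
  have c01: "c0 \<in> charts_at A (?g \<otimes> inv ?g)" "c0 \<in> charts_at A (\<one> \<otimes> ?g)" "c0 \<in> charts_at A (\<one> \<otimes> ?g \<otimes> inv ?g)"
    using c0 c0g(1) g by auto
  show "(x, iv c0 c0 x) \<in> mu_dom c0 c0 c0" using mu_dom_iff[OF c0g(1) c0i c01(1)] by (simp add: c0g(2) iv_def)
  have r: "MD c0 c0 (\<lambda>h. h \<otimes> ?g) \<one> = (\<lambda>u. dmu (x0, x) (u, 0))"
    using MD_eqI[OF mult_has_derivative[OF mdiff_id mdiff_const[OF g] c0 c0 c0g(1) c01(2)]]
    unfolding MD_const MD_id[OF c0] c0g(2) x0_def .
  have ri: "MD c0 c0 (\<lambda>h. h \<otimes> inv ?g) ?g = (\<lambda>u. dmu (x, iv c0 c0 x) (u, 0))"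
    using MD_eqI[OF mult_has_derivative[OF mdiff_id mdiff_const[OF inv_closed[OF g]] c0g(1) c0g(1) c0i c01(1)]]
    unfolding MD_const MD_id[OF c0g(1)] c0g(2) iv_def .
  have "MD c0 c0 (\<lambda>h. h \<otimes> ?g \<otimes> inv ?g) \<one> = (\<lambda>u. MD c0 c0 (\<lambda>h. h \<otimes> inv ?g) (\<one> \<otimes> ?g) (MD c0 c0 (\<lambda>h. h \<otimes> ?g) \<one> u))"
    by (rule MD_comp[OF mdiff_right[OF g] mdiff_right[OF inv_closed[OF g]] c0 c01(2,3)])
  moreover have "MD c0 c0 (\<lambda>h. h \<otimes> ?g \<otimes> inv ?g) \<one> = MD c0 c0 (\<lambda>h. h) \<one>"
    by (rule MD_cong[OF mdiff_id c0 c0]) (use g in \<open>simp add: m_assoc\<close>)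
  ultimately have "(\<lambda>u. MD c0 c0 (\<lambda>h. h \<otimes> inv ?g) ?g (MD c0 c0 (\<lambda>h. h \<otimes> ?g) \<one> u)) = (\<lambda>u. u)"
    using MD_id[OF c0] g by simp
  then show "dmu (x, iv c0 c0 x) (dmu (x0, x) (v, 0), 0) = v"
    unfolding r ri by metis
qed

text \<open>\<open>1 - Ad g\<close> is the difference of right and left translation from the unit,
  brought back by right translation. In this form it can be differentiated in the group
  element.\<close>

lemma dcomm_eq:
  assumes x: "x \<in> iv_dom c0 c0"
  shows "dcomm (cinv c0 x) v = dmu (x, iv c0 c0 x) (dmu (x0, x) (v, 0) - F c0 x v, 0)"
proof -
  have xS: "x \<in> cmap c0 ` cdom c0" using x by (simp add: iv_dom_def)
  let ?g = "cinv c0 x"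
  have g: "?g \<in> carrier G" by (rule cinv_carrier[OF c0_A xS])
  have "dmu (x0, x) (v, 0) - F c0 x v = dmu (x0, x) ((v, 0) - (MD c0 c0 (conjg ?g) \<one> v, 0))"
    unfolding linear_diff[OF linear_dmu[OF F_eq_Ad(2)[OF xS]]] F_eq_Ad(1)[OF xS] ..
  also have "(v, 0 :: 'e) - (MD c0 c0 (conjg ?g) \<one> v, 0) = (dcomm ?g v, 0)"
    using dcomm_plus_Ad[OF g, of v] by (simp add: diff_eq_eq)
  finally show ?thesis using right_translation_inverse(1)[OF x] by simp
qed

text \<open>Symmetry of the mixed second derivative of the multiplication: the derivative along
  \<open>u\<close> of the right-invariant field \<open>v\<close> is the derivative along
  \<open>v\<close> of the left-invariant field \<open>u\<close>.\<close>

lemma mixed_derivative_mu: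
  "frechet_derivative (\<lambda>x. dmu (x0, x) (v, 0)) (at x0) u = frechet_derivative (\<lambda>y. F c0 y u) (at x0) v"
  "((\<lambda>x. dmu (x0, x) (v, 0)) has_derivative frechet_derivative (\<lambda>x. dmu (x0, x) (v, 0)) (at x0)) (at x0)"
proof -
  have M: "(x0, x0) \<in> mu_dom c0 c0 c0" using F_eq_mu(2)[OF c0_A x0_in] .
  note sm = smooth_mu[OF c0_A c0_A c0_A]
  have D: "((\<lambda>z. dmu z w) has_derivative frechet_derivative (\<lambda>z. dmu z w) (at (x0, x0))) (at (x0, x0))" for w
    by (rule smooth_on_has_derivative[OF smooth_on_frechet_derivative[OF sm] M])
  have "((\<lambda>x. (x0, x)) has_derivative (\<lambda>u. (0, u))) (at x0)" by (auto intro!: derivative_eq_intros)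
  from diff_chain_at[OF this D[of "(v, 0)"]]
  have 1: "((\<lambda>x. dmu (x0, x) (v, 0)) has_derivative
      (\<lambda>u. frechet_derivative (\<lambda>z. dmu z (v, 0)) (at (x0, x0)) (0, u))) (at x0)" by (simp add: o_def)
  then show "((\<lambda>x. dmu (x0, x) (v, 0)) has_derivative frechet_derivative (\<lambda>x. dmu (x0, x) (v, 0)) (at x0)) (at x0)"
    using frechet_derivative_eqI by metis
  have "((\<lambda>x. (x, x0)) has_derivative (\<lambda>u. (u, 0))) (at x0)" by (auto intro!: derivative_eq_intros)
  from diff_chain_at[OF this D[of "(0, u)"]]
  have "((\<lambda>x. dmu (x, x0) (0, u)) has_derivative
      (\<lambda>v. frechet_derivative (\<lambda>z. dmu z (0, u)) (at (x0, x0)) (v, 0))) (at x0)" by (simp add: o_def)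
  then have 2: "((\<lambda>y. F c0 y u) has_derivative
      (\<lambda>v. frechet_derivative (\<lambda>z. dmu z (0, u)) (at (x0, x0)) (v, 0))) (at x0)"
    by (rule has_derivative_transform_within_open[OF _ open_chart[OF c0_A] x0_in])
      (simp add: F_eq_mu(1)[OF c0_A])
  show "frechet_derivative (\<lambda>x. dmu (x0, x) (v, 0)) (at x0) u = frechet_derivative (\<lambda>y. F c0 y u) (at x0) v"
    unfolding frechet_derivative_eqI[OF 1] frechet_derivative_eqI[OF 2]
    by (rule symmetric_second_derivative[OF open_mu_dom[OF c0_A c0_A c0_A] M sm])
qed

text \<open>The differential at the unit of \<open>g \<mapsto> 1 - Ad g\<close> is \<open>- ad\<close>.\<close>

lemma dcomm_has_derivative: "((\<lambda>x. dcomm (cinv c0 x) v) has_derivative (\<lambda>u. - br u v)) (at x0)"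
proof -
  let ?T = "iv_dom c0 c0"
  let ?R = "\<lambda>x w. dmu (x, iv c0 c0 x) (w, 0)"
  let ?w = "\<lambda>x. dmu (x0, x) (v, 0) - F c0 x v"
  let ?w' = "\<lambda>u. frechet_derivative (\<lambda>x. dmu (x0, x) (v, 0)) (at x0) u - frechet_derivative (\<lambda>y. F c0 y v) (at x0) u"
  note sm = smooth_mu[OF c0_A c0_A c0_A]
  have T: "open ?T" by (rule open_iv_dom[OF c0_A c0_A])
  have x0T: "x0 \<in> ?T" using x0_in charts_atD[OF c0] by (simp add: iv_dom_def cinv_x0)
  have iv0: "iv c0 c0 x0 = x0" by (simp add: iv_def cinv_x0 x0_def[symmetric])
  \<comment> \<open>Left- and right-invariant fields agree at the unit. Therefore the derivative of
    \<open>?R\<close> is applied to 0 and only that of \<open>?w\<close> contributes.\<close>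
  have w0: "?w x0 = 0" by (simp add: dmu_x0 F_x0)
  have lin: "linear (?R x)" if "x \<in> ?T" for x
  proof -
    have l: "linear (dmu (x, iv c0 c0 x))" by (rule linear_dmu[OF right_translation_inverse(2)[OF that]])
    have "linear (\<lambda>w::'e. (w, 0::'e))" by (rule linearI) auto
    from linear_compose[OF this l] show ?thesis by (simp add: o_def)
  qed
  have Rsm: "smooth_on (\<lambda>x. ?R x w) ?T" for w
  proof -
    have "smooth_on (\<lambda>x. (x, iv c0 c0 x)) ?T"
      by (intro smooth_on_Pair smooth_on_ident smooth_iv T c0_A)
    then show ?thesis
      by (rule smooth_on_compose[OF T open_mu_dom[OF c0_A c0_A c0_A] _ _
            smooth_on_frechet_derivative[OF sm, where u = "(w, 0)"], rotated])
        (use right_translation_inverse(2) in auto)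
  qed
  have "((\<lambda>x. ?R x (?w x)) has_derivative
      (\<lambda>u. frechet_derivative (\<lambda>x. ?R x (?w x0)) (at x0) u + ?R x0 (?w' u))) (at x0)"
  proof (rule has_derivative_linear_family[where A = ?R and w = ?w and w' = ?w'
        and A' = "\<lambda>u w. frechet_derivative (\<lambda>x. ?R x w) (at x0) u", OF T x0T lin])
    show "((\<lambda>x. ?R x w) has_derivative frechet_derivative (\<lambda>x. ?R x w) (at x0)) (at x0)" for w
      by (rule smooth_on_has_derivative[OF Rsm x0T])
    show "(?w has_derivative ?w') (at x0)"
      by (rule has_derivative_diff[OF mixed_derivative_mu(2) F_has_derivative[OF c0_A x0_in]])
  qed
  moreover have "frechet_derivative (\<lambda>x. ?R x (?w x0)) (at x0) = (\<lambda>u. 0)"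
  proof -
    have "frechet_derivative (\<lambda>x. ?R x (?w x0)) (at x0) = frechet_derivative (\<lambda>x. 0) (at x0)"
      unfolding w0 by (rule frechet_derivative_cong_open[OF T x0T]) (rule linear_0[OF lin])
    then show ?thesis by simp
  qed
  moreover have "?R x0 (?w' u) = - br u v" for u
    unfolding iv0 dmu_x0 mixed_derivative_mu(1) by (simp add: br_def)
  ultimately have "((\<lambda>x. ?R x (?w x)) has_derivative (\<lambda>u. - br u v)) (at x0)" by simp
  then show ?thesis
    by (rule has_derivative_transform_within_open[OF _ T x0T]) (rule dcomm_eq[symmetric])
qed

lemma linear_foldr_dcomm: "set gs \<subseteq> carrier G \<Longrightarrow> linear (foldr dcomm gs)"
proof (induction gs)
  case Nil
  have "foldr dcomm [] = (\<lambda>v. v)" by (simp add: fun_eq_iff)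
  then show ?case using linear_id by (simp add: id_def)
next
  case (Cons g gs)
  then have "linear (dcomm g \<circ> foldr dcomm gs)" using linear_dcomm by (intro linear_compose) auto
  then show ?case by (simp add: o_def)
qed

text \<open>Differentiating the group identity \<open>(1 - Ad g\<^sub>1) \<cdots> (1 - Ad g\<^sub>N) = 0\<close> in one \<open>g\<^sub>i\<close> after the other
  turns each factor into an \<open>ad\<close>.\<close>

lemma br_nilpotent:
  assumes nil: "lower_central G N = {\<one>}" and as: "length as = N"
  shows "foldr br as b = 0"
proof -
  \<comment> \<open>The inner factors \<open>as\<close> are already differentiated, the outer
    factors \<open>gs\<close> still come from the group. In the induction step the last group factor
    runs through the chart at the unit; the product is constantly 0, and so is its derivative, which
    replaces \<open>dcomm\<close> by \<open>- br a\<close>.\<close>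
  have "foldr dcomm gs (foldr br as b) = 0"
    if "length gs + length as = N" "set gs \<subseteq> carrier G" for gs as
    using that
  proof (induction as arbitrary: gs)
    case Nil
    then show ?case using foldr_dcomm_eq_zero[OF nil] by simp
  next
    case (Cons a as)
    let ?w = "foldr br as b"
    have lin: "linear (foldr dcomm gs)" by (rule linear_foldr_dcomm[OF Cons.prems(2)])
    have "((\<lambda>x. foldr dcomm gs (dcomm (cinv c0 x) ?w)) has_derivative (\<lambda>u. foldr dcomm gs (- br u ?w))) (at x0)"
      by (rule bounded_linear.has_derivative[OF lin[unfolded linear_conv_bounded_linear] dcomm_has_derivative])
    moreover have "((\<lambda>x. foldr dcomm gs (dcomm (cinv c0 x) ?w)) has_derivative (\<lambda>u. 0)) (at x0)"
    proof (rule has_derivative_transform_within_open[OF has_derivative_const open_chart[OF c0_A] x0_in])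
      fix x assume "x \<in> cmap c0 ` cdom c0"
      then have "cinv c0 x \<in> carrier G" by (rule cinv_carrier[OF c0_A])
      then have "foldr dcomm (gs @ [cinv c0 x]) ?w = 0"
        using Cons.prems by (intro Cons.IH) auto
      then show "0 = foldr dcomm gs (dcomm (cinv c0 x) ?w)" by simp
    qed
    ultimately have "(\<lambda>u. foldr dcomm gs (- br u ?w)) = (\<lambda>u. 0)" by (rule has_derivative_unique)
    then have "foldr dcomm gs (- br a ?w) = 0" by metis
    then show ?case by (simp add: linear_neg[OF lin])
  qed
  from this[of "[]" as] show ?thesis using as by simp
qed

end

section \<open>Left-invariant complex structures\<close>

locale lie_complex = lie_atlas G X A
  for G :: "('a, 'm) monoid_scheme" (structure) and X :: "'a topology"
    and A :: "('a, 'e::euclidean_space) chart set" +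
  fixes J :: "'a \<Rightarrow> ('a, 'e) tvec \<Rightarrow> ('a, 'e) tvec"
  assumes complex_structure: "left_invariant_complex_structure G X A J"
begin

definition I :: "'e \<Rightarrow> 'e" where "I a = J \<one> (fr.tv \<one> a) c0"

lemma tv_c0: "fr.tv \<one> a c0 = a"
  using c0 F_x0 by (simp add: fr.tv_def x0_def)

lemma tangent_space_one: "tangent_space A \<one> = range (fr.tv \<one>)"
  by (rule fr.tangent_space_eq) (simp add: topspace_eq)

lemma J_one: "J \<one> (fr.tv \<one> a) = fr.tv \<one> (I a)"
proof -
  have "fr.tv \<one> a \<in> tangent_space A \<one>" using tangent_space_one by simp
  then have "J \<one> (fr.tv \<one> a) \<in> tangent_space A \<one>"
    using complex_structure one_closed
    unfolding left_invariant_complex_structure_def almost_complex_structure_def topspace_eq by blast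
  then obtain b where "J \<one> (fr.tv \<one> a) = fr.tv \<one> b" using tangent_space_one by auto
  then show ?thesis unfolding I_def by (simp add: tv_c0)
qed

lemma J_tv:
  assumes g: "g \<in> carrier G"
  shows "J g (fr.tv g a) = fr.tv g (I a)"
proof -
  have "J (g \<otimes> \<one>) (left_translate G A g \<one> (fr.tv \<one> a)) = left_translate G A g \<one> (J \<one> (fr.tv \<one> a))"
    using complex_structure g one_closed tangent_space_one
    unfolding left_invariant_complex_structure_def by blast
  then show ?thesis using g by (simp add: left_translate_tv J_one)
qed

lemma I_sq: "I (I a) = - a"
proof -
  have "J \<one> (J \<one> (fr.tv \<one> a)) = - fr.tv \<one> a"
    using complex_structure one_closed tangent_space_one
    unfolding left_invariant_complex_structure_def almost_complex_structure_def topspace_eq by blast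
  then have "fr.tv \<one> (I (I a)) c0 = - fr.tv \<one> a c0" by (simp add: J_one)
  then show ?thesis by (simp add: tv_c0)
qed

lemma linear_I: "linear I"
proof -
  have "Q c0 x0 u = u" for u using fr.QF[OF c0_A x0_in, of u] by (simp add: F_x0)
  then have "tvec A \<one> c0 u = fr.tv \<one> u" for u
    using fr.tvec_eq[OF c0, of u] by (simp add: x0_def)
  then have "local_J A J c0 x0 u = I u" for u
    unfolding local_J_def cinv_x0 I_def by simp
  then have "local_J A J c0 x0 = I" by (rule ext)
  moreover have "linear (local_J A J c0 x0)"
    using complex_structure c0_A x0_in
    unfolding left_invariant_complex_structure_def almost_complex_structure_def by blast
  ultimately show ?thesis by simp
qed

lemma lie_bracket_tv: "lie_bracket G A (fr.tv \<one> a) (fr.tv \<one> b) c0 = br a b"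
proof -
  have D: "frechet_derivative (\<lambda>x. left_translate G A (cinv c0 x) \<one> (fr.tv \<one> b) c0) (at x0) =
      frechet_derivative (\<lambda>x. F c0 x b) (at x0)" for b
  proof (rule frechet_derivative_cong_open[OF open_chart[OF c0_A] x0_in])
    fix x assume x: "x \<in> cmap c0 ` cdom c0"
    have "cinv c0 x \<in> carrier G" "c0 \<in> charts_at A (cinv c0 x)" "cmap c0 (cinv c0 x) = x"
      using cinv_carrier[OF c0_A x] cinv_chart[OF c0_A x] by auto
    then show "left_translate G A (cinv c0 x) \<one> (fr.tv \<one> b) c0 = F c0 x b"
      by (simp add: left_translate_tv) (simp add: fr.tv_def)
  qed
  show ?thesis
    unfolding lie_bracket_def vf_bracket_def x0_def[symmetric] D br_def
    using c0 by (simp add: left_translate_tv tv_c0)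
qed

text \<open>The bracket of two (1,0)-vectors is a pair \<open>(\<alpha>, \<beta>)\<close> with
  \<open>I \<alpha> = - \<beta>\<close>; its two components are the two sides up to \<open>I\<close>
  and signs.\<close>

lemma integrable: "I (br a b - br (I a) (I b)) = br a (I b) + br (I a) b"
proof -
  \<comment> \<open>The (1,0)-vector with real part \<open>a\<close>, that is,
    \<open>a - i (I a)\<close>.\<close>
  let ?z = "\<lambda>a. (fr.tv \<one> a, fr.tv \<one> (- I a))"
  have neg: "fr.tv \<one> (- a) = - fr.tv \<one> a" for a
  proof -
    have "F d (cmap d \<one>) (- a) = - F d (cmap d \<one>) a" if "d \<in> charts_at A \<one>" for d
      using charts_atD[OF that] by (intro linear_neg[OF fr.linF]) auto
    then show ?thesis by (auto simp: fr.tv_def fun_eq_iff)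
  qed
  have "?z a \<in> lie_algebra10 G A J" for a
    unfolding lie_algebra10_def type10_def using tangent_space_one
    by (auto simp: J_one neg[symmetric] linear_neg[OF linear_I] I_sq)
  then have "complex_lie_bracket G A (?z a) (?z b) \<in> lie_algebra10 G A J"
    using complex_structure unfolding left_invariant_complex_structure_def by blast
  then obtain \<alpha> \<beta> where ab: "fst (complex_lie_bracket G A (?z a) (?z b)) = fr.tv \<one> \<alpha>"
      "snd (complex_lie_bracket G A (?z a) (?z b)) = fr.tv \<one> \<beta>"
      "J \<one> (fr.tv \<one> \<alpha>) = - fr.tv \<one> \<beta>"
    unfolding lie_algebra10_def type10_def tangent_space_one by auto
  have r: "br a (- b) = - br a b" for a b by (rule linear_neg[OF linear_br])
  have l: "br (- a) b = - br a b" for a b using br_antisym[of "- a" b] br_antisym[of a b] r by simp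
  have "\<alpha> = br a b - br (I a) (I b)"
    using fun_cong[OF ab(1), of c0] by (simp add: complex_lie_bracket_def lie_bracket_tv tv_c0 r l)
  moreover have "\<beta> = - (br a (I b) + br (I a) b)"
    using fun_cong[OF ab(2), of c0] by (simp add: complex_lie_bracket_def lie_bracket_tv tv_c0 r l)
  moreover have "I \<alpha> = - \<beta>"
    using fun_cong[OF ab(3), of c0] by (simp add: J_one tv_c0)
  ultimately show ?thesis by simp
qed

lemma group_frame:
  assumes "lower_central G N = {\<one>}" "DIM('e) = 2 * n"
  shows "invariant_frame X A F Q J I br n N"
proof (intro invariant_frame.intro invariant_frame_axioms.intro)
  show "frame_atlas X A F Q" by (rule fr.frame_atlas_axioms)
qed (use assms br_nilpotent J_tv linear_I I_sq frame_bracket linear_br integrable topspace_eq in auto)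

end

section \<open>The quotient by a discrete subgroup\<close>

locale lie_quotient = lie_complex G X A J
  for G :: "('a, 'm) monoid_scheme" (structure) and X :: "'a topology"
    and A :: "('a, 'e::euclidean_space) chart set"
    and J :: "'a \<Rightarrow> ('a, 'e) tvec \<Rightarrow> ('a, 'e) tvec" +
  fixes \<Gamma> :: "'a set"
  assumes discrete: "discrete_subgroup G X \<Gamma>"
begin

abbreviation \<pi> :: "'a \<Rightarrow> 'a set" where "\<pi> g \<equiv> \<Gamma> #> g"

abbreviation Y :: "'a set topology" where "Y \<equiv> quotient_topology G X \<Gamma>"

abbreviation B :: "('a set, 'e) chart set" where "B \<equiv> quotient_atlas G X A \<Gamma>"

section \<open>The projection onto the orbit space\<close>

lemma subgroup_\<Gamma>: "subgroup \<Gamma> G"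
  using discrete by (simp add: discrete_subgroup_def)

lemma \<Gamma>_carrier: "\<gamma> \<in> \<Gamma> \<Longrightarrow> \<gamma> \<in> carrier G"
  using subgroup.mem_carrier[OF subgroup_\<Gamma>] .

lemma \<pi>_mult:
  assumes "\<gamma> \<in> \<Gamma>" "g \<in> carrier G"
  shows "\<pi> (\<gamma> \<otimes> g) = \<pi> g"
proof -
  have "\<gamma> \<otimes> g \<in> \<pi> g" using assms(1) unfolding r_coset_def by blast
  from repr_independence[OF this assms(2) subgroup_\<Gamma>] show ?thesis by simp
qed

lemma \<pi>_eqD:
  assumes "\<pi> g = \<pi> h" "g \<in> carrier G" "h \<in> carrier G"
  obtains \<gamma> where "\<gamma> \<in> \<Gamma>" "h = \<gamma> \<otimes> g"
proof -
  have "h \<in> \<pi> g" using rcos_self[OF assms(3) subgroup_\<Gamma>] assms(1) by simp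
  then show ?thesis using that unfolding r_coset_def by blast
qed

lemma topspace_Y: "topspace Y = rcosets \<Gamma>"
proof
  have "openin Y (topspace Y)" by (rule openin_topspace)
  then show "topspace Y \<subseteq> rcosets \<Gamma>" unfolding openin_quotient_topology by blast
  have "{g \<in> topspace X. \<pi> g \<in> rcosets \<Gamma>} = topspace X"
    using rcosetsI[OF subgroup.subset[OF subgroup_\<Gamma>]] by (auto simp: topspace_eq)
  then have "openin Y (rcosets \<Gamma>)" unfolding openin_quotient_topology by simp
  then show "rcosets \<Gamma> \<subseteq> topspace Y" by (rule openin_subset)
qed

text \<open>Discreteness isolates the unit of \<open>\<Gamma>\<close> by an open set
  \<open>W\<close>. By continuity of \<open>(x, y) \<mapsto> y \<otimes> inv x\<close> all such
  quotients from a small neighbourhood of \<open>g\<close> lie in \<open>W\<close>, so two of its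
  points in one orbit coincide.\<close>

lemma \<pi>_injective_nbhd:
  assumes g: "g \<in> carrier G"
  shows "\<exists>V. openin X V \<and> g \<in> V \<and> inj_on \<pi> V"
proof -
  have "openin (subtopology X \<Gamma>) {\<one>}"
    using discrete subgroup.one_closed[OF subgroup_\<Gamma>] unfolding discrete_subgroup_def by simp
  then obtain W where W: "openin X W" "{\<one>} = W \<inter> \<Gamma>" unfolding openin_subtopology by blast
  let ?f = "\<lambda>z. (case (snd z, inv (fst z)) of (a, b) \<Rightarrow> a \<otimes> b)"
  have "continuous_map (prod_topology X X) X (\<lambda>z. inv (fst z))"
    using continuous_map_compose[OF continuous_map_fst continuous_inv] by (simp add: o_def)
  then have "continuous_map (prod_topology X X) (prod_topology X X) (\<lambda>z. (snd z, inv (fst z)))"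
    by (simp add: continuous_map_pairwise o_def continuous_map_snd)
  from continuous_map_compose[OF this continuous_mult]
  have f: "continuous_map (prod_topology X X) X ?f" by (simp add: o_def)
  define P where "P = {z \<in> topspace (prod_topology X X). ?f z \<in> W}"
  have "openin (prod_topology X X) P" unfolding P_def by (rule openin_continuous_map_preimage[OF f W(1)])
  moreover have "(g, g) \<in> P" using g W(2) by (auto simp: P_def topspace_eq)
  ultimately have "\<exists>U V. openin X U \<and> openin X V \<and> g \<in> U \<and> g \<in> V \<and> U \<times> V \<subseteq> P"
    unfolding openin_prod_topology_alt by (elim allE[of _ g] impE)
  then obtain U V where UV: "openin X U" "openin X V" "g \<in> U" "g \<in> V" "U \<times> V \<subseteq> P"
    by (elim exE conjE) (rule that)
  have "inj_on \<pi> (U \<inter> V)"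
  proof (rule inj_onI)
    fix x y assume x: "x \<in> U \<inter> V" and y: "y \<in> U \<inter> V" and eq: "\<pi> x = \<pi> y"
    then have xy: "x \<in> carrier G" "y \<in> carrier G" using openin_subset[OF UV(1)] topspace_eq by auto
    obtain \<gamma> where \<gamma>: "\<gamma> \<in> \<Gamma>" "y = \<gamma> \<otimes> x" using \<pi>_eqD[OF eq xy] .
    have "(x, y) \<in> P" using x y UV(5) by blast
    then have "y \<otimes> inv x \<in> W" by (simp add: P_def)
    moreover have "y \<otimes> inv x = \<gamma>" using \<gamma> xy \<Gamma>_carrier by (simp add: m_assoc)
    ultimately have "\<gamma> = \<one>" using W(2) \<gamma>(1) by blast
    then show "x = y" using \<gamma> xy by simp
  qed
  then show ?thesis using UV by (intro exI[of _ "U \<inter> V"]) auto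
qed

text \<open>A chart of the quotient does not determine the pair \<open>(c, U)\<close> it is built from, so we choose
  one.\<close>

definition rep :: "('a set, 'e) chart \<Rightarrow> ('a, 'e) chart \<times> 'a set" where
  "rep d = (SOME (c, U). d = (\<pi> ` U, cmap c \<circ> inv_into U \<pi>) \<and>
     c \<in> A \<and> openin X U \<and> U \<subseteq> cdom c \<and> inj_on \<pi> U)"

abbreviation rc :: "('a set, 'e) chart \<Rightarrow> ('a, 'e) chart" where "rc d \<equiv> fst (rep d)"

abbreviation rU :: "('a set, 'e) chart \<Rightarrow> 'a set" where "rU d \<equiv> snd (rep d)"

lemma rep:
  assumes "d \<in> B"
  shows "d = (\<pi> ` rU d, cmap (rc d) \<circ> inv_into (rU d) \<pi>)" "rc d \<in> A" "openin X (rU d)"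
    "rU d \<subseteq> cdom (rc d)" "inj_on \<pi> (rU d)"
proof -
  have "\<exists>z. case z of (c, U) \<Rightarrow> d = (\<pi> ` U, cmap c \<circ> inv_into U \<pi>) \<and>
      c \<in> A \<and> openin X U \<and> U \<subseteq> cdom c \<and> inj_on \<pi> U"
    using assms unfolding quotient_atlas_def by auto
  from someI_ex[OF this] show "d = (\<pi> ` rU d, cmap (rc d) \<circ> inv_into (rU d) \<pi>)" "rc d \<in> A" "openin X (rU d)"
    "rU d \<subseteq> cdom (rc d)" "inj_on \<pi> (rU d)"
    unfolding rep_def[symmetric] by (auto simp: case_prod_beta)
qed

lemma cdom_B: "d \<in> B \<Longrightarrow> cdom d = \<pi> ` rU d"
  using rep(1)[of d] by (metis fst_conv)

lemma cmap_B: "d \<in> B \<Longrightarrow> u \<in> rU d \<Longrightarrow> cmap d (\<pi> u) = cmap (rc d) u"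
  using rep(1)[of d] inv_into_f_f[OF rep(5)] by (metis comp_apply snd_conv)

lemma rU_charts: "d \<in> B \<Longrightarrow> u \<in> rU d \<Longrightarrow> rc d \<in> charts_at A u \<and> u \<in> carrier G"
  using rep(2,4)[of d] dom[of "rc d"] by (auto simp: charts_at_def)

lemma image_B:
  assumes d: "d \<in> B"
  shows "cmap d ` (cdom d \<inter> W) = cmap (rc d) ` (cdom (rc d) \<inter> (rU d \<inter> {g \<in> topspace X. \<pi> g \<in> W}))"
proof -
  have "rU d \<subseteq> topspace X" using rU_charts[OF d] topspace_eq by blast
  moreover have "cmap d ` (cdom d \<inter> W) = (\<lambda>u. cmap d (\<pi> u)) ` (rU d \<inter> {g. \<pi> g \<in> W})"
    unfolding cdom_B[OF d] by auto
  moreover have "(\<lambda>u. cmap d (\<pi> u)) ` (rU d \<inter> {g. \<pi> g \<in> W}) = cmap (rc d) ` (rU d \<inter> {g. \<pi> g \<in> W})"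
    by (rule image_cong) (auto simp: cmap_B[OF d])
  moreover have "cdom (rc d) \<inter> (rU d \<inter> {g \<in> topspace X. \<pi> g \<in> W}) = rU d \<inter> {g. \<pi> g \<in> W}"
    using rep(4)[OF d] calculation(1) by blast
  ultimately show ?thesis by simp
qed

lemma image_B_subset: "d \<in> B \<Longrightarrow> cmap d ` cdom d \<subseteq> cmap (rc d) ` cdom (rc d)"
  using image_B[of d UNIV] by auto

lemma inj_B:
  assumes d: "d \<in> B"
  shows "inj_on (cmap d) (cdom d)"
proof (rule inj_onI)
  fix P P' assume P: "P \<in> cdom d" "P' \<in> cdom d" "cmap d P = cmap d P'"
  then obtain u u' where u: "u \<in> rU d" "P = \<pi> u" "u' \<in> rU d" "P' = \<pi> u'"
    unfolding cdom_B[OF d] by blast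
  then have "cmap (rc d) u = cmap (rc d) u'" using P(3) by (simp add: cmap_B[OF d])
  moreover have "u \<in> cdom (rc d)" "u' \<in> cdom (rc d)" using u rep(4)[OF d] by auto
  ultimately have "u = u'" using inj[OF rep(2)[OF d]] by (simp add: inj_on_eq_iff)
  then show "P = P'" using u by simp
qed

lemma charts_B_E:
  assumes "d \<in> charts_at B P"
  obtains u where "d \<in> B" "u \<in> rU d" "P = \<pi> u" "cmap d P = cmap (rc d) u"
proof -
  have d: "d \<in> B" "P \<in> cdom d" using assms by (auto simp: charts_at_def)
  obtain u where "u \<in> rU d" "P = \<pi> u" using d(2) unfolding cdom_B[OF d(1)] by blast
  then show ?thesis using that d(1) cmap_B[OF d(1)] by simp
qed

lemma cinv_B:
  assumes d: "d \<in> B" and u: "u \<in> rU d"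
  shows "cinv d (cmap (rc d) u) = \<pi> u"
  using inv_into_f_f[OF inj_B[OF d], of "\<pi> u"] cdom_B[OF d] u cmap_B[OF d u] unfolding cinv_def by simp

text \<open>The lift of \<open>\<pi> g\<close> in the domain behind \<open>d\<close> is
  \<open>\<gamma> \<otimes> g\<close> for some \<open>\<gamma>\<close> in \<open>\<Gamma>\<close>.
  Near \<open>g\<close> the projection, read in \<open>d\<close>, is left translation by
  \<open>\<gamma>\<close>, which preserves the frame.\<close>

lemma projection_has_derivative:
  assumes c: "c \<in> charts_at A g" and d: "d \<in> charts_at B (\<pi> g)"
  shows "((cmap d \<circ> \<pi> \<circ> cinv c) has_derivative (\<lambda>u. F (rc d) (cmap d (\<pi> g)) (Q c (cmap c g) u))) (at (cmap c g))"
proof -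
  have g: "g \<in> carrier G" using charts_atD[OF c] by simp
  obtain u where u: "d \<in> B" "u \<in> rU d" "\<pi> g = \<pi> u" "cmap d (\<pi> g) = cmap (rc d) u"
    using charts_B_E[OF d] .
  have uc: "rc d \<in> charts_at A u" "u \<in> carrier G" using rU_charts[OF u(1,2)] by auto
  obtain \<gamma> where \<gamma>: "\<gamma> \<in> \<Gamma>" "u = \<gamma> \<otimes> g" using \<pi>_eqD[OF u(3) g uc(2)] .
  have \<gamma>G: "\<gamma> \<in> carrier G" by (rule \<Gamma>_carrier[OF \<gamma>(1)])
  have cA: "c \<in> A" using charts_atD[OF c] by simp
  let ?W = "{q \<in> topspace X. \<gamma> \<otimes> q \<in> rU d}"
  have W: "openin X ?W"
    by (rule openin_continuous_map_preimage[OF mdiff_continuous[OF mdiff_left[OF \<gamma>G]] rep(3)[OF u(1)]])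
  have "((cmap (rc d) \<circ> (\<lambda>h. \<gamma> \<otimes> h) \<circ> cinv c) has_derivative
      (\<lambda>v. F (rc d) (cmap d (\<pi> g)) (Q c (cmap c g) v))) (at (cmap c g))"
    using left_translation_has_derivative[OF \<gamma>G c, of "rc d"] uc(1) unfolding u(4) \<gamma>(2)[symmetric] by simp
  then show ?thesis
  proof (rule has_derivative_transform_within_open[OF _ open_preimage[OF cA W]])
    show "cmap c g \<in> {x \<in> cmap c ` cdom c. cinv c x \<in> ?W}"
      using charts_atD[OF c] cinv_cmap[OF c] \<gamma>(2) u(2) topspace_eq by simp
    fix x assume x: "x \<in> {x \<in> cmap c ` cdom c. cinv c x \<in> ?W}"
    then have "cinv c x \<in> carrier G" "\<gamma> \<otimes> cinv c x \<in> rU d" using topspace_eq by auto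
    then show "(cmap (rc d) \<circ> (\<lambda>h. \<gamma> \<otimes> h) \<circ> cinv c) x = (cmap d \<circ> \<pi> \<circ> cinv c) x"
      using cmap_B[OF u(1)] \<pi>_mult[OF \<gamma>(1)] by fastforce
  qed
qed

text \<open>A chart of the quotient has the same coordinates as the chart \<open>rc d\<close> of the
  group and takes over its frame. Changes of coordinates are locally left translations by elements
  of \<open>\<Gamma>\<close>, so these frames fit together.\<close>

lemma quotient_frame_atlas: "frame_atlas Y B (\<lambda>d. F (rc d)) (\<lambda>d. Q (rc d))"
proof (rule frame_atlas.intro)
  fix d W assume d: "d \<in> B" and W: "openin Y W"
  have "openin X (rU d \<inter> {g \<in> topspace X. \<pi> g \<in> W})"
    using rep(3)[OF d] W unfolding openin_quotient_topology by (intro openin_Int) auto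
  then show "open (cmap d ` (cdom d \<inter> W))"
    unfolding image_B[OF d] by (rule open_image[OF rep(2)[OF d]])
next
  fix d assume d: "d \<in> B"
  show "cdom d \<subseteq> topspace Y"
    unfolding cdom_B[OF d] topspace_Y
    using rU_charts[OF d] rcosetsI[OF subgroup.subset[OF subgroup_\<Gamma>]] by auto
next
  fix P assume "P \<in> topspace Y"
  then obtain g where g: "g \<in> carrier G" "P = \<pi> g" unfolding topspace_Y RCOSETS_def by blast
  obtain c where c: "c \<in> charts_at A g" using cover[OF g(1)] by blast
  obtain V where V: "openin X V" "g \<in> V" "inj_on \<pi> V" using \<pi>_injective_nbhd[OF g(1)] by blast
  let ?U = "V \<inter> cdom c"
  have "(\<pi> ` ?U, cmap c \<circ> inv_into ?U \<pi>) \<in> B"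
    unfolding quotient_atlas_def
    using V charts_atD[OF c] openin_dom[of c] inj_on_subset[OF V(3), of ?U] by blast
  moreover have "P \<in> \<pi> ` ?U" using V(2) charts_atD[OF c] g(2) by blast
  ultimately show "charts_at B P \<noteq> {}" unfolding charts_at_def by fastforce
next
  fix P d d' assume d: "d \<in> charts_at B P" and d': "d' \<in> charts_at B P"
  obtain u where u: "d \<in> B" "u \<in> rU d" "P = \<pi> u" "cmap d P = cmap (rc d) u"
    using charts_B_E[OF d] .
  have c: "rc d \<in> charts_at A u" using rU_charts[OF u(1,2)] by simp
  show "((cmap d' \<circ> cinv d) has_derivative (\<lambda>v. F (rc d') (cmap d' P) (Q (rc d) (cmap d P) v))) (at (cmap d P))"
    \<comment> \<open>On the lifted domain \<open>cinv d\<close> is the projection after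
      \<open>cinv (rc d)\<close>, which reduces the transition to the derivative of the
      projection.\<close>
    unfolding u(4)
  proof (rule has_derivative_transform_within_open)
    show "((cmap d' \<circ> \<pi> \<circ> cinv (rc d)) has_derivative
        (\<lambda>v. F (rc d') (cmap d' P) (Q (rc d) (cmap (rc d) u) v))) (at (cmap (rc d) u))"
      using projection_has_derivative[OF c, of d'] d' unfolding u(3) by simp
    show "open (cmap (rc d) ` (cdom (rc d) \<inter> rU d))"
      by (rule open_image[OF rep(2,3)[OF u(1)]])
    show "cmap (rc d) u \<in> cmap (rc d) ` (cdom (rc d) \<inter> rU d)" using u(2) rep(4)[OF u(1)] by blast
    fix x assume "x \<in> cmap (rc d) ` (cdom (rc d) \<inter> rU d)"
    then obtain w where w: "w \<in> rU d" "x = cmap (rc d) w" by blast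
    then show "(cmap d' \<circ> \<pi> \<circ> cinv (rc d)) x = (cmap d' \<circ> cinv d) x"
      using cinv_cmap rU_charts[OF u(1) w(1)] cinv_B[OF u(1) w(1)] by simp
  qed
next
  fix d x assume d: "d \<in> B" and x: "x \<in> cmap d ` cdom d"
  then have x': "x \<in> cmap (rc d) ` cdom (rc d)" using image_B_subset by blast
  show "linear (F (rc d) x)" "linear (Q (rc d) x)"
    "\<And>a. Q (rc d) x (F (rc d) x a) = a" "\<And>a. F (rc d) x (Q (rc d) x a) = a"
    using fr.linF fr.linQ fr.QF fr.FQ rep(2)[OF d] x' by auto
next
  fix d a assume d: "d \<in> B"
  show "smooth_on (\<lambda>x. F (rc d) x a) (cmap d ` cdom d)"
    by (rule smooth_on_subset[OF smooth_F[OF rep(2)[OF d]] image_B_subset[OF d]])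
  show "smooth_on (\<lambda>x. Q (rc d) x a) (cmap d ` cdom d)"
    by (rule smooth_on_subset[OF smooth_Q[OF rep(2)[OF d]] image_B_subset[OF d]])
qed (rule inj_B)

end

sublocale lie_quotient \<subseteq> qf: frame_atlas "quotient_topology G X \<Gamma>" "quotient_atlas G X A \<Gamma>"
  "\<lambda>d. F (rc d)" "\<lambda>d. Q (rc d)"
  by (rule quotient_frame_atlas)

context lie_quotient
begin

section \<open>The induced complex structure in the descended frame\<close>

lemma differential_projection:
  assumes g: "g \<in> carrier G"
  shows "differential A B \<pi> g (fr.tv g a) = qf.tv (\<pi> g) a"
proof
  fix d
  define c where "c = (SOME c. c \<in> charts_at A g)"
  have c: "c \<in> charts_at A g" unfolding c_def using cover[OF g] some_in_eq by blast
  show "differential A B \<pi> g (fr.tv g a) d = qf.tv (\<pi> g) a d"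
  proof (cases "d \<in> charts_at B (\<pi> g)")
    case True
    have "differential A B \<pi> g (fr.tv g a) d =
        frechet_derivative (cmap d \<circ> \<pi> \<circ> cinv c) (at (cmap c g)) (fr.tv g a c)"
      using True by (simp add: differential_def c_def[symmetric])
    also have "\<dots> = F (rc d) (cmap d (\<pi> g)) (Q c (cmap c g) (fr.tv g a c))"
      unfolding frechet_derivative_eqI[OF projection_has_derivative[OF c True]] ..
    also have "\<dots> = qf.tv (\<pi> g) a d" using True c QF_charts[OF c] by (simp add: fr.tv_def qf.tv_def)
    finally show ?thesis .
  qed (simp add: differential_def qf.tv_def)
qed

text \<open>At every lift \<open>g\<close> the differential of the projection matches frame vectors
  with equal coordinates, and \<open>J g\<close> acts on coordinates by the same \<open>I\<close>.
  Hence the lift chosen in \<open>quotient_J\<close> has no influence.\<close>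

lemma quotient_J_tv:
  assumes P: "P \<in> topspace Y"
  shows "quotient_J G X A \<Gamma> J P (qf.tv P a) = qf.tv P (I a)"
proof -
  obtain h where h: "h \<in> carrier G" "P = \<pi> h" using P unfolding topspace_Y RCOSETS_def by blast
  define g where "g = (SOME g. g \<in> P)"
  have "h \<in> P" unfolding h(2) by (rule rcos_self[OF h(1) subgroup_\<Gamma>])
  then have gP: "g \<in> P" unfolding g_def by (rule someI)
  then have \<pi>g: "\<pi> g = P" using repr_independence[OF _ h(1) subgroup_\<Gamma>, of g] h(2) by simp
  have g: "g \<in> carrier G"
    using gP h \<Gamma>_carrier unfolding h(2) r_coset_def by auto
  let ?d = "differential A B \<pi> g"
  have d: "?d (fr.tv g a) = qf.tv P a" for a using differential_projection[OF g] \<pi>g by simp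
  have "inj_on ?d (range (fr.tv g))"
  proof (rule inj_onI)
    fix v w assume "v \<in> range (fr.tv g)" "w \<in> range (fr.tv g)" "?d v = ?d w"
    then obtain a b where ab: "v = fr.tv g a" "w = fr.tv g b" "qf.tv P a = qf.tv P b" using d by auto
    have "a = b" using arg_cong[OF ab(3), of "qf.coord P"] by (simp add: qf.coord_tv[OF P])
    then show "v = w" using ab by simp
  qed
  moreover have "tangent_space A g = range (fr.tv g)"
    by (rule fr.tangent_space_eq) (simp add: topspace_eq g)
  ultimately have "inv_into (tangent_space A g) ?d (?d (fr.tv g a)) = fr.tv g a"
    by (simp add: inv_into_f_f)
  then show ?thesis
    unfolding quotient_J_def g_def[symmetric] Let_def d by (simp add: J_tv[OF g] d)
qed

lemma quotient_frame:
  assumes "lower_central G N = {\<one>}" "DIM('e) = 2 * n"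
  shows "invariant_frame Y B (\<lambda>d. F (rc d)) (\<lambda>d. Q (rc d)) (quotient_J G X A \<Gamma> J) I br n N"
proof (intro invariant_frame.intro invariant_frame_axioms.intro)
  show "frame_atlas Y B (\<lambda>d. F (rc d)) (\<lambda>d. Q (rc d))" by (rule quotient_frame_atlas)
  show "quotient_J G X A \<Gamma> J P (qf.tv P a) = qf.tv P (I a)" if "P \<in> topspace Y" for P a
    by (rule quotient_J_tv[OF that])
  fix d x a b assume d: "d \<in> B" and x: "x \<in> cmap d ` cdom d"
  show "frechet_derivative (\<lambda>y. F (rc d) y b) (at x) (F (rc d) x a) -
      frechet_derivative (\<lambda>y. F (rc d) y a) (at x) (F (rc d) x b) = F (rc d) x (br a b)"
    by (rule frame_bracket[OF rep(2)[OF d] subsetD[OF image_B_subset[OF d] x]])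
qed (use assms br_nilpotent linear_I I_sq linear_br integrable in auto)

end

theorem theorem2p7:
  fixes G :: "('a, 'm) monoid_scheme"
    and X :: "'a topology"
    and A :: "('a, 'e::euclidean_space) chart set"
    and J :: "'a \<Rightarrow> ('a, 'e) tvec \<Rightarrow> ('a, 'e) tvec"
    and \<Gamma> :: "'a set"
    and n :: nat
  assumes "lie_group G X A"
    and "connected_space X"
    and "simply_connected_space X"
    and "nilpotent_group G"
    and "left_invariant_complex_structure G X A J"
    and "DIM('e) = 2 * n"
    and "discrete_subgroup G X \<Gamma>"
    and "cocompact G X \<Gamma>"
  shows "(\<exists>\<eta>. left_invariant_form G n A \<eta> \<and>
             (\<exists>g\<in>carrier G. \<exists>vs. \<eta> g vs \<noteq> 0) \<and>
             holomorphic_canonical_section n A J (carrier G) \<eta>) \<and>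
         trivial_canonical_bundle n (quotient_topology G X \<Gamma>) (quotient_atlas G X A \<Gamma>)
           (quotient_J G X A \<Gamma> J)"
proof
  interpret lie_quotient G X A J \<Gamma>
    using assms by (intro lie_quotient.intro lie_complex.intro lie_atlas.intro
        lie_complex_axioms.intro lie_quotient_axioms.intro)
  obtain N where N: "lower_central G N = {\<one>\<^bsub>G\<^esub>}" using assms(4) unfolding nilpotent_group_def by blast
  obtain \<zeta> es where "invariant_volume X A F Q J I br n N \<zeta> es"
    using invariant_frame.invariant_volume_exists[OF group_frame[OF N assms(6)]] by blast
  then interpret gv: invariant_volume X A F Q J I br n N \<zeta> es .
  have "left_invariant_form G n A gv.sec"
    unfolding left_invariant_form_def
  proof (intro ballI allI impI; elim conjE)
    fix g h vs assume g: "g \<in> carrier G" and h: "h \<in> carrier G" and vs: "length vs = n" "set vs \<subseteq> tangent_space A h"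
    have "\<exists>as. vs = map (fr.tv h) as"
      using vs(2) fr.tangent_space_eq[of h] h topspace_eq by (metis ex_map_conv imageE subsetD)
    then obtain as where as: "vs = map (fr.tv h) as" by blast
    have eq: "map (left_translate G A g h) vs = map (fr.tv (g \<otimes>\<^bsub>G\<^esub> h)) as"
      unfolding as by (simp add: left_translate_tv[OF g h])
    show "gv.sec (g \<otimes>\<^bsub>G\<^esub> h) (map (left_translate G A g h) vs) = gv.sec h vs"
      unfolding eq using gv.sec_tv[of "g \<otimes>\<^bsub>G\<^esub> h" as] gv.sec_tv[of h as] vs(1) as g h topspace_eq by simp
  qed
  \<comment> \<open>The volume form is 1 on \<open>es\<close>, so the section is nonzero at the unit
    on the corresponding tangent vectors.\<close>
  moreover have "gv.sec \<one>\<^bsub>G\<^esub> (map (fr.tv \<one>\<^bsub>G\<^esub>) es) \<noteq> 0"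
    using gv.sec_tv[of "\<one>\<^bsub>G\<^esub>" es] gv.es topspace_eq by simp
  then have "\<exists>g\<in>carrier G. \<exists>vs. gv.sec g vs \<noteq> 0" by blast
  moreover have "holomorphic_canonical_section n A J (carrier G) gv.sec"
    using gv.holomorphic_sec[of "carrier G"] openin_topspace[of X] topspace_eq by simp
  ultimately show "\<exists>\<eta>. left_invariant_form G n A \<eta> \<and> (\<exists>g\<in>carrier G. \<exists>vs. \<eta> g vs \<noteq> 0) \<and>
      holomorphic_canonical_section n A J (carrier G) \<eta>" by blast
  \<comment> \<open>The second interpretation of the same locale, now for the descended frame, with
    a volume form chosen anew.\<close>
  obtain \<zeta>' es' where "invariant_volume Y B (\<lambda>d. F (rc d)) (\<lambda>d. Q (rc d)) (quotient_J G X A \<Gamma> J) I br n N \<zeta>' es'"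
    using invariant_frame.invariant_volume_exists[OF quotient_frame[OF N assms(6)]] by blast
  then interpret qv: invariant_volume Y B "\<lambda>d. F (rc d)" "\<lambda>d. Q (rc d)" "quotient_J G X A \<Gamma> J" I br n N \<zeta>' es' .
  show "trivial_canonical_bundle n Y B (quotient_J G X A \<Gamma> J)"
    by (rule qv.trivial_canonical_bundle)
qed

end
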